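(* Let $s\in(0,1]$ and $p\in[1,+\infty)$ be such that $sp=N$ and $s\neq p$. Let $\Omega\subset\mathbb{R}^N$ be an open and bounded domain with Lipschitz boundary. Let $\widetilde s,\widetilde p$ satisfy $$\text{either}\quad\begin{cases}0<\widetilde s<s,\\ 1\le\widetilde p<\dfrac{N}{\widetilde s},\end{cases}\qquad\text{or}\qquad\begin{cases}\widetilde s=0,\\ 1\le\widetilde p<+\infty.\end{cases}$$ Then the space $W^{s,p}(\Omega)$ is compactly embedded in $W^{\widetilde s,\widetilde p}(\Omega)$. Moreover, the curve $\gamma:[0,1]\to\mathbb{R}^2$ defined as $$\gamma(\theta):=(s_\theta,p_\theta)=\left(\theta\widetilde s+(1-\theta)s,\ \frac{p\,\widetilde p}{\widetilde p+\theta(p-\widetilde p)}\right)$$ is such that, if $0<\theta_1<\theta_2\le1$, then the space $W^{s_{\theta_1},p_{\theta_1}}(\Omega)$ is compactly embedded in $W^{s_{\theta_2},p_{\theta_2}}(\Omega)$.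
   Context: $N\ge1$ is an integer and functions are real-valued and measurable. For $s\in[0,1]$ and $p\in[1,+\infty)$ define $[u]_{W^{0,p}(\Omega)}:=\|u\|_{L^p(\Omega)}$, $[u]_{W^{1,p}(\Omega)}:=\|\nabla u\|_{L^p(\Omega)}$ (weak gradient) and, for $s\in(0,1)$, $$[u]_{W^{s,p}(\Omega)}:=\left(c_{N,s,p}\iint_{\Omega\times\Omega}\frac{|u(x)-u(y)|^p}{|x-y|^{N+sp}}\,dx\,dy\right)^{1/p},\qquad c_{N,s,p}:=\frac{s\,2^{2s-1}\,\Gamma\left(\frac{ps+p+N-2}{2}\right)}{\pi^{N/2}\,\Gamma(1-s)}.$$ Set $W^{s,p}(\Omega):=\{u\in L^p(\Omega):[u]_{W^{s,p}(\Omega)}<+\infty\}$, with norm $\|u\|_{W^{0,p}(\Omega)}:=\|u\|_{L^p(\Omega)}$ if $s=0$ and $\|u\|_{W^{s,p}(\Omega)}:=\big([u]^p_{W^{s,p}(\Omega)}+\|u\|^p_{L^p(\Omega)}\big)^{1/p}$ if $s\in(0,1]$. *)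

theory Defs
  imports "HOL-Analysis.Analysis"
begin

text \<open>Functions on \<open>\<Omega>\<close> are represented by total functions of which only the restriction to \<open>\<Omega>\<close>
  matters; elements of the spaces below are functions, not classes modulo a.e. equality. All norms
  take values in \<^typ>\<open>ennreal\<close> and may be infinite.\<close>

text \<open>Real powers of extended nonnegative reals; only meaningful for positive exponents.\<close>

definition epowr :: "ennreal \<Rightarrow> real \<Rightarrow> ennreal" where
  "epowr x a = (if x = \<infinity> then \<infinity> else ennreal (enn2real x powr a))"

definition Lp_norm :: "'a::euclidean_space set \<Rightarrow> real \<Rightarrow> ('a \<Rightarrow> 'b::real_normed_vector) \<Rightarrow> ennreal" where
  "Lp_norm \<Omega> p f = epowr (\<integral>\<^sup>+ x. ennreal (norm (f x) powr p) \<partial>lebesgue_on \<Omega>) (1 / p)"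

primrec times_differentiable :: "nat \<Rightarrow> ('a::euclidean_space \<Rightarrow> real) \<Rightarrow> bool" where
  "times_differentiable 0 f \<longleftrightarrow> continuous_on UNIV f"
| "times_differentiable (Suc k) f \<longleftrightarrow>
     (\<forall>x. f differentiable (at x)) \<and>
     (\<forall>b\<in>Basis. times_differentiable k (\<lambda>x. frechet_derivative f (at x) b))"

definition test_function :: "'a::euclidean_space set \<Rightarrow> ('a \<Rightarrow> real) \<Rightarrow> bool" where
  "test_function \<Omega> \<phi> \<longleftrightarrow>
     (\<forall>k. times_differentiable k \<phi>) \<and>
     (\<exists>K. compact K \<and> K \<subseteq> \<Omega> \<and> (\<forall>x. x \<notin> K \<longrightarrow> \<phi> x = 0))"

definition locally_integrable :: "'a::euclidean_space set \<Rightarrow> ('a \<Rightarrow> 'b::euclidean_space) \<Rightarrow> bool" where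
  "locally_integrable \<Omega> f \<longleftrightarrow> (\<forall>K. compact K \<and> K \<subseteq> \<Omega> \<longrightarrow> f absolutely_integrable_on K)"

definition has_weak_gradient ::
    "'a::euclidean_space set \<Rightarrow> ('a \<Rightarrow> real) \<Rightarrow> ('a \<Rightarrow> 'a) \<Rightarrow> bool" where
  "has_weak_gradient \<Omega> u g \<longleftrightarrow>
     locally_integrable \<Omega> u \<and> locally_integrable \<Omega> g \<and>
     (\<forall>\<phi>. test_function \<Omega> \<phi> \<longrightarrow>
        (\<forall>b\<in>Basis. (LINT x|lebesgue_on \<Omega>. u x * frechet_derivative \<phi> (at x) b)
                   = - (LINT x|lebesgue_on \<Omega>. (g x \<bullet> b) * \<phi> x)))"

text \<open>The weak gradient is unique up to a.e. equality, so the choice does not affect its norm.\<close>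

definition weak_gradient :: "'a::euclidean_space set \<Rightarrow> ('a \<Rightarrow> real) \<Rightarrow> 'a \<Rightarrow> 'a" where
  "weak_gradient \<Omega> u = (SOME g. has_weak_gradient \<Omega> u g)"

definition sobolev_const :: "real \<Rightarrow> real \<Rightarrow> real \<Rightarrow> real" where
  "sobolev_const N s p =
     s * 2 powr (2 * s - 1) * Gamma ((p * s + p + N - 2) / 2) / (pi powr (N / 2) * Gamma (1 - s))"

text \<open>On the diagonal the integrand is \<open>0 / 0 = 0\<close>; the diagonal is a null set.\<close>

definition gagliardo_energy :: "'a::euclidean_space set \<Rightarrow> real \<Rightarrow> real \<Rightarrow> ('a \<Rightarrow> real) \<Rightarrow> ennreal" where
  "gagliardo_energy \<Omega> s p u =
     (\<integral>\<^sup>+ (x, y). ennreal (\<bar>u x - u y\<bar> powr p / norm (x - y) powr (real DIM('a) + s * p))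
        \<partial>(lebesgue_on \<Omega> \<Otimes>\<^sub>M lebesgue_on \<Omega>))"

definition sobolev_seminorm :: "'a::euclidean_space set \<Rightarrow> real \<Rightarrow> real \<Rightarrow> ('a \<Rightarrow> real) \<Rightarrow> ennreal" where
  "sobolev_seminorm \<Omega> s p u =
     (if s = 0 then Lp_norm \<Omega> p u
      else if s = 1 then
        (if \<exists>g. has_weak_gradient \<Omega> u g then Lp_norm \<Omega> p (weak_gradient \<Omega> u) else \<infinity>)
      else epowr (ennreal (sobolev_const (real DIM('a)) s p) * gagliardo_energy \<Omega> s p u) (1 / p))"

definition sobolev_space :: "'a::euclidean_space set \<Rightarrow> real \<Rightarrow> real \<Rightarrow> ('a \<Rightarrow> real) set" where
  "sobolev_space \<Omega> s p =
     {u. u \<in> borel_measurable (lebesgue_on \<Omega>) \<and> Lp_norm \<Omega> p u < \<infinity> \<and> sobolev_seminorm \<Omega> s p u < \<infinity>}"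

definition sobolev_norm :: "'a::euclidean_space set \<Rightarrow> real \<Rightarrow> real \<Rightarrow> ('a \<Rightarrow> real) \<Rightarrow> ennreal" where
  "sobolev_norm \<Omega> s p u =
     (if s = 0 then Lp_norm \<Omega> p u
      else epowr (epowr (sobolev_seminorm \<Omega> s p u) p + epowr (Lp_norm \<Omega> p u) p) (1 / p))"

text \<open>Near every boundary point, \<open>\<Omega>\<close> is the strict epigraph, in some direction \<open>\<nu>\<close>, of a
  Lipschitz function on the hyperplane orthogonal to \<open>\<nu>\<close>.\<close>

definition lipschitz_boundary :: "'a::euclidean_space set \<Rightarrow> bool" where
  "lipschitz_boundary \<Omega> \<longleftrightarrow>
     (\<forall>z\<in>frontier \<Omega>. \<exists>r>0. \<exists>\<nu> L (h :: 'a \<Rightarrow> real).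
        norm \<nu> = 1 \<and> lipschitz_on L {y. y \<bullet> \<nu> = 0} h \<and>
        \<Omega> \<inter> ball z r = {x \<in> ball z r. h (x - (x \<bullet> \<nu>) *\<^sub>R \<nu>) < x \<bullet> \<nu>})"

text \<open>The arguments \<open>(s, p)\<close> and \<open>(t, q)\<close> are pairs of exponents: \<open>W\<^sup>s\<^sup>,\<^sup>p(\<Omega>)\<close> is contained in
  \<open>W\<^sup>t\<^sup>,\<^sup>q(\<Omega>)\<close>, and the inclusion is bounded and maps bounded sequences to sequences having a
  subsequence that converges in \<open>W\<^sup>t\<^sup>,\<^sup>q(\<Omega>)\<close>.\<close>

definition sobolev_compactly_embedded ::
    "'a::euclidean_space set \<Rightarrow> real \<times> real \<Rightarrow> real \<times> real \<Rightarrow> bool" where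
  "sobolev_compactly_embedded \<Omega> = (\<lambda>(s, p) (t, q).
     sobolev_space \<Omega> s p \<subseteq> sobolev_space \<Omega> t q \<and>
     (\<exists>C::real. \<forall>u\<in>sobolev_space \<Omega> s p. sobolev_norm \<Omega> t q u \<le> ennreal C * sobolev_norm \<Omega> s p u) \<and>
     (\<forall>u :: nat \<Rightarrow> 'a \<Rightarrow> real.
        (\<forall>n. u n \<in> sobolev_space \<Omega> s p) \<and> (\<exists>C::real. \<forall>n. sobolev_norm \<Omega> s p (u n) \<le> ennreal C) \<longrightarrow>
        (\<exists>v\<in>sobolev_space \<Omega> t q. \<exists>r :: nat \<Rightarrow> nat. strict_mono r \<and>
           (\<lambda>n. sobolev_norm \<Omega> t q (\<lambda>x. u (r n) x - v x)) \<longlonglongrightarrow> 0)))"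

definition exponent_curve :: "real \<Rightarrow> real \<Rightarrow> real \<Rightarrow> real \<Rightarrow> real \<Rightarrow> real \<times> real" where
  "exponent_curve s p s' p' \<theta> = (\<theta> * s' + (1 - \<theta>) * s, p * p' / (p' + \<theta> * (p - p')))"

end

theory Submission
  imports Defs
begin

text \<open>Everything passes through the pointwise inequality
  \<open>\<bar>u x - u y\<bar> \<le> \<bar>x - y\<bar>\<^sup>\<sigma> (G x + G y)\<close> with \<open>G\<close> in \<open>L\<^sup>q\<close>, valid for nearby \<open>x\<close>, \<open>y\<close> off a null set.
  If \<open>\<sigma> < 1\<close> and \<open>u\<close> has finite Gagliardo energy, compare \<open>u x\<close> and \<open>u y\<close> with \<open>u z\<close> for a \<open>z\<close> at which the
  integrands do not exceed their averages; a Lipschitz domain contains a fixed proportion of every small ball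
  centred in it, so the averages are controlled. If \<open>u\<close> has a weak gradient in \<open>L\<^sup>q\<close>, the inequality holds for every
  \<open>\<sigma> < 1\<close>: averages of \<open>u\<close> over balls shrinking to \<open>x\<close> inside a cone change at a rate given by the gradient.

  Following a chain of points with small \<open>G\<close> in dyadic balls shrinking to \<open>x\<close> replaces \<open>(\<sigma>, q)\<close> by any \<open>(\<alpha>, r)\<close> with
  \<open>r \<ge> q\<close> and \<open>\<alpha> - N / r < \<sigma> - N / q\<close>; as \<open>\<alpha>\<close> may exceed the target smoothness, the Gagliardo energy of the target is
  finite, and small differences \<open>\<bar>x - y\<bar>\<close> contribute little to it, uniformly. Compactness is thus reduced to \<open>L\<^sup>r\<close>, where it
  holds because each \<open>u\<close> is Hoelder continuous off a set of small measure and is bounded in a larger \<open>L\<^sup>p\<close>.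
  The defect \<open>s - N / p\<close> vanishes at the start of the curve and equals \<open>\<theta>\<close> times a negative constant along it,
  so every step along the curve is subcritical.\<close>

section \<open>Geometry of Lipschitz domains\<close>

text \<open>The obstacle is that the averages to be controlled are those of \<open>G^q\<close>,
  which is merely in \<open>L^1\<close>, where the maximal function is unbounded. It is replaced by
  a sum of ball integrals over dyadic radii \<rho> with a surplus power \<rho>^d. For d > 0 Fubini
  alone bounds this sum in \<open>L^1\<close>; the price is an arbitrarily small loss of smoothness,
  affordable because every inequality between defects is strict. For the same reason it does no harm
  that a weak gradient yields only exponents \<sigma> < 1.

  No function is extended beyond \<Omega> or approximated by smooth functions: all comparisons use
  points and balls inside \<Omega>. A lower bound for the volume of small balls is enough for
  fractional spaces, whereas a weak gradient needs balls that can be moved inside \<Omega>, and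
  these are supplied by the cones.

  Chaining is not homogeneous in u, since it compares powers of a mass that is at most 1. The
  estimates are therefore proved for norm at most 1 and then rescaled.\<close>

definition uniform_cone :: "'a::euclidean_space set \<Rightarrow> real \<Rightarrow> 'a set \<Rightarrow> bool" where
  "uniform_cone \<Omega> R V \<longleftrightarrow> 0 < R \<and> finite V \<and>
     (\<forall>x\<in>\<Omega>. \<exists>v\<in>V. \<forall>y\<in>\<Omega> \<inter> cball x R. \<forall>t\<in>{0<..R}. cball (y + t *\<^sub>R v) t \<subseteq> \<Omega>)"

text \<open>Shifting y by t (2 L + 1) in the direction \<nu> gains that much height. Inside the ball
  of radius t the height drops by at most t, and the projection moves by at most 2 t, so h grows by
  at most 2 L t: the strict inequality at y survives. The total displacement is at most t (2 L + 2),
  which keeps the ball inside \<open>ball z r\<close>.\<close>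

lemma epigraph_contains_cone_ball:
  fixes \<nu> :: "'a::euclidean_space"
  assumes lip: "lipschitz_on L {y. y \<bullet> \<nu> = 0} h" and \<nu>: "norm \<nu> = 1"
    and epi: "\<Omega> \<inter> ball z r = {x \<in> ball z r. h (x - (x \<bullet> \<nu>) *\<^sub>R \<nu>) < x \<bullet> \<nu>}"
    and y: "y \<in> \<Omega>" "dist y z < r / 2" and t: "0 < t" "t * (2 * L + 2) < r / 2"
  shows "cball (y + t *\<^sub>R ((2 * L + 1) *\<^sub>R \<nu>)) t \<subseteq> \<Omega>"
proof
  fix p assume p: "p \<in> cball (y + t *\<^sub>R ((2 * L + 1) *\<^sub>R \<nu>)) t"
  have L: "0 \<le> L" using lip by (rule lipschitz_on_nonneg)
  have \<nu>\<nu>: "\<nu> \<bullet> \<nu> = 1" using \<nu> by (simp add: dot_square_norm)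
  define d where "d = p - (y + t *\<^sub>R ((2 * L + 1) *\<^sub>R \<nu>))"
  have nd: "norm d \<le> t" using p by (simp add: d_def dist_norm norm_minus_commute)
  have dn: "\<bar>d \<bullet> \<nu>\<bar> \<le> t" using Cauchy_Schwarz_ineq2[of d \<nu>] nd \<nu> by simp
  have p_eq: "p = y + d + (t * (2 * L + 1)) *\<^sub>R \<nu>" by (simp add: d_def)
  define proj where "proj x = x - (x \<bullet> \<nu>) *\<^sub>R \<nu>" for x :: 'a
  have pj0: "proj x \<in> {y. y \<bullet> \<nu> = 0}" for x
    by (simp add: proj_def inner_diff_left \<nu>\<nu>)
  have pn: "p \<bullet> \<nu> = y \<bullet> \<nu> + d \<bullet> \<nu> + t * (2 * L + 1)" by (simp add: p_eq inner_add_left \<nu>\<nu>)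
  have "proj p - proj y = d - (d \<bullet> \<nu>) *\<^sub>R \<nu>"
    by (simp add: proj_def pn) (simp add: p_eq algebra_simps)
  then have "dist (proj p) (proj y) \<le> norm d + norm ((d \<bullet> \<nu>) *\<^sub>R \<nu>)"
    by (metis dist_norm norm_triangle_ineq4)
  also have "\<dots> \<le> 2 * t" using nd dn \<nu> by simp
  finally have "dist (h (proj p)) (h (proj y)) \<le> L * (2 * t)"
    using lipschitz_onD[OF lip pj0 pj0, of p y] L by (meson mult_left_mono order_trans)
  then have h1: "h (proj p) \<le> h (proj y) + 2 * L * t" by (auto simp: dist_real_def abs_le_iff)
  have r: "0 < r" using y(2) zero_le_dist[of y z] by linarith
  have "y \<in> ball z r" using y r by (simp add: dist_commute)
  then have "y \<in> \<Omega> \<inter> ball z r" using y(1) by blast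
  then have h2: "h (proj y) < y \<bullet> \<nu>" unfolding epi by (simp add: proj_def)
  have "h (proj p) < p \<bullet> \<nu>" using h1 h2 pn dn t by (auto simp: algebra_simps abs_le_iff)
  moreover have "p \<in> ball z r"
  proof -
    have "norm (p - z) \<le> norm (y - z) + norm d + norm ((t * (2 * L + 1)) *\<^sub>R \<nu>)"
      using norm_triangle_ineq[of "y - z" "d"] norm_triangle_ineq[of "y - z + d" "(t * (2 * L + 1)) *\<^sub>R \<nu>"]
      unfolding p_eq by (simp add: algebra_simps)
    also have "norm ((t * (2 * L + 1)) *\<^sub>R \<nu>) = t * (2 * L + 1)" using t L \<nu> by simp
    finally have "norm (p - z) < r" using y nd t by (simp add: dist_norm algebra_simps)
    then show ?thesis by (simp add: dist_norm norm_minus_commute)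
  qed
  ultimately have "p \<in> \<Omega> \<inter> ball z r" unfolding epi by (simp add: proj_def)
  then show "p \<in> \<Omega>" by blast
qed

text \<open>Compactness of the boundary leaves finitely many graph charts, hence finitely many
  directions and one radius R. Points far from the boundary use the direction 0, for which the
  condition asks only for balls centred at y. That a single v serves all y near x matters later,
  when the averages attached to two nearby points are compared along one direction.\<close>

lemma lipschitz_boundary_uniform_cone:
  fixes \<Omega> :: "'a::euclidean_space set"
  assumes "open \<Omega>" "bounded \<Omega>" and lip: "lipschitz_boundary \<Omega>"
  obtains R V where "uniform_cone \<Omega> R V"
proof -
  have "\<exists>r>0. \<exists>v. \<forall>y\<in>\<Omega> \<inter> ball z r. \<forall>t\<in>{0<..r}. cball (y + t *\<^sub>R v) t \<subseteq> \<Omega>"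
    if z: "z \<in> frontier \<Omega>" for z
  proof -
    obtain r \<nu> L h where r: "0 < r" "norm \<nu> = 1" "lipschitz_on L {y. y \<bullet> \<nu> = 0} (h :: 'a \<Rightarrow> real)"
      "\<Omega> \<inter> ball z r = {x \<in> ball z r. h (x - (x \<bullet> \<nu>) *\<^sub>R \<nu>) < x \<bullet> \<nu>}"
      using lip z unfolding lipschitz_boundary_def by blast
    have L: "0 \<le> L" using r(3) by (rule lipschitz_on_nonneg)
    \<comment> \<open>With this radius t (2 L + 2) stays strictly below r / 2, and r' \<le> r /
      2.\<close>
    define r' where "r' = r / (2 * (2 * L + 3))"
    have r': "0 < r'" "r' * (2 * L + 3) = r / 2" using r L by (auto simp: r'_def field_simps)
    have "r' * 1 \<le> r' * (2 * L + 3)" using r' L by (intro mult_left_mono) auto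
    then have r'2: "r' \<le> r / 2" using r' by simp
    show ?thesis
    proof (intro exI[of _ r'] conjI exI[of _ "(2 * L + 1) *\<^sub>R \<nu>"] ballI r')
      fix y t assume y: "y \<in> \<Omega> \<inter> ball z r'" and t: "t \<in> {0<..r'}"
      have "t * (2 * L + 2) < r' * (2 * L + 3)" using t L r'
        by (intro mult_le_less_imp_less) auto
      with y t r' r'2 show "cball (y + t *\<^sub>R (2 * L + 1) *\<^sub>R \<nu>) t \<subseteq> \<Omega>"
        by (intro epigraph_contains_cone_ball[OF r(3,2,4)]) (auto simp: dist_commute)
    qed
  qed
  then obtain rf vf where rv: "\<And>z. z \<in> frontier \<Omega> \<Longrightarrow> 0 < (rf z :: real)"
    "\<And>z y t. z \<in> frontier \<Omega> \<Longrightarrow> y \<in> \<Omega> \<inter> ball z (rf z) \<Longrightarrow> t \<in> {0<..rf z} \<Longrightarrow> cball (y + t *\<^sub>R vf z) t \<subseteq> \<Omega>"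
    by metis
  have "compact (frontier \<Omega>)" using \<open>bounded \<Omega>\<close> by (simp add: compact_frontier_bounded)
  then obtain F where F: "F \<subseteq> frontier \<Omega>" "finite F" "frontier \<Omega> \<subseteq> (\<Union>z\<in>F. ball z (rf z / 2))"
    by (rule compactE_image[where C="frontier \<Omega>" and f="\<lambda>z. ball z (rf z / 2)"]) (use rv(1) in \<open>auto intro!: bexI[where P="\<lambda>z. dist z _ < rf z / 2"]\<close>)
  \<comment> \<open>The half radii of the cover and the factor 8 leave room for the detour from z
    over f and x to y, whose length is below rf z / 2 + 3 R < rf z.\<close>
  define R where "R = Min (insert 1 (rf ` F)) / 8"
  have Rle: "8 * R \<le> rf z" if "z \<in> F" for z unfolding R_def using F that by auto
  have "0 < Min (insert 1 (rf ` F))" using F rv by (subst Min_gr_iff) auto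
  then have R: "0 < R" by (simp add: R_def)
  have "uniform_cone \<Omega> R (insert 0 (vf ` F))"
    unfolding uniform_cone_def
  proof (intro conjI ballI R)
    show "finite (insert 0 (vf ` F))" using F by simp
    fix x assume x: "x \<in> \<Omega>"
    show "\<exists>v\<in>insert 0 (vf ` F). \<forall>y\<in>\<Omega> \<inter> cball x R. \<forall>t\<in>{0<..R}. cball (y + t *\<^sub>R v) t \<subseteq> \<Omega>"
    proof (cases "\<exists>f\<in>frontier \<Omega>. dist x f \<le> 2 * R")
      case True
      then obtain f z where f: "dist x f \<le> 2 * R" "z \<in> F" "f \<in> ball z (rf z / 2)" using F by blast
      show ?thesis
      proof (intro bexI[of _ "vf z"] ballI)
        fix y t assume y: "y \<in> \<Omega> \<inter> cball x R" and t: "t \<in> {0<..R}"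
        have "dist z y \<le> dist z f + dist f x + dist x y"
          using dist_triangle[of z y f] dist_triangle[of f y x] by linarith
        then have "dist z y < rf z" using f y Rle[of z] R by (auto simp: dist_commute)
        then show "cball (y + t *\<^sub>R vf z) t \<subseteq> \<Omega>" using rv(2)[of z y t] f(2) F y t Rle[of z] R by auto
      qed (use f in auto)
    next
      case False
      \<comment> \<open>A ball is connected: if it met both \<Omega> and the complement, it would
        meet the boundary, which is too far away.\<close>
      have "cball x (2 * R) \<subseteq> \<Omega>"
      proof (rule ccontr)
        assume "\<not> ?thesis"
        then have "cball x (2 * R) - \<Omega> \<noteq> {}" by blast
        moreover have "cball x (2 * R) \<inter> \<Omega> \<noteq> {}" using x R by (force intro: exI[of _ x])
        ultimately have "cball x (2 * R) \<inter> frontier \<Omega> \<noteq> {}"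
          by (intro connected_Int_frontier) auto
        with False show False by auto
      qed
      moreover have "cball y t \<subseteq> cball x (2 * R)" if "y \<in> cball x R" "t \<le> R" for y t
      proof
        fix w assume "w \<in> cball y t"
        then show "w \<in> cball x (2 * R)" using that dist_triangle[of x w y] by auto
      qed
      ultimately have "cball y t \<subseteq> \<Omega>" if "y \<in> cball x R" "t \<le> R" for y t using that by blast
      then show ?thesis by (intro bexI[of _ 0] ballI) simp_all
    qed
  qed
  then show ?thesis by (rule that)
qed

section \<open>Interior measure density\<close>

definition measure_density :: "'a::euclidean_space set \<Rightarrow> real \<Rightarrow> real \<Rightarrow> bool" where
  "measure_density \<Omega> R c \<longleftrightarrow> 0 < R \<and> 0 < c \<and>
     (\<forall>x\<in>\<Omega>. \<forall>\<rho>\<in>{0<..R}. ennreal (c * \<rho> powr DIM('a)) \<le> emeasure (lebesgue_on \<Omega>) (\<Omega> \<inter> cball x \<rho>))"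

lemma measure_density_mono: "measure_density \<Omega> R c \<Longrightarrow> 0 < R' \<Longrightarrow> R' \<le> R \<Longrightarrow> measure_density \<Omega> R' c"
  by (auto simp: measure_density_def)

lemma emeasure_cball_powr:
  "0 < \<rho> \<Longrightarrow> emeasure lebesgue (cball (x::'a::euclidean_space) \<rho>) = ennreal (unit_ball_vol DIM('a) * \<rho> powr DIM('a))"
  by (simp add: emeasure_cball powr_realpow)

text \<open>The cone ball at x of radius \<rho> / K fits into \<open>cball x \<rho>\<close>, because
  its farthest point is at distance at most t (norm v + 1). This density is all that the fractional
  estimates know about the boundary of \<Omega>.\<close>

lemma uniform_cone_measure_density:
  fixes \<Omega> :: "'a::euclidean_space set"
  assumes "open \<Omega>" and cone: "uniform_cone \<Omega> R V"
  obtains c where "measure_density \<Omega> R c"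
proof -
  have R: "0 < R" and V: "finite V" using cone by (auto simp: uniform_cone_def)
  define K where "K = Max (insert 1 (norm ` V)) + 1"
  have K: "norm v + 1 \<le> K" if "v \<in> V" for v using V that by (simp add: K_def)
  have K1: "1 \<le> K" using V by (simp add: K_def Max_ge_iff add_increasing2)
  define c where "c = unit_ball_vol DIM('a) * (1 / K) powr DIM('a)"
  have "measure_density \<Omega> R c"
    unfolding measure_density_def
  proof (intro conjI ballI R)
    show "0 < c" using K1 by (simp add: c_def)
    fix x \<rho> assume x: "x \<in> \<Omega>" and \<rho>: "\<rho> \<in> {0<..R}"
    obtain v where v: "v \<in> V" "\<And>y t. y \<in> \<Omega> \<inter> cball x R \<Longrightarrow> t \<in> {0<..R} \<Longrightarrow> cball (y + t *\<^sub>R v) t \<subseteq> \<Omega>"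
      using cone x unfolding uniform_cone_def by blast
    define t where "t = \<rho> / K"
    have "\<rho> / K \<le> \<rho> / 1" using \<rho> K1 by (intro divide_left_mono) auto
    then have t: "t \<in> {0<..R}" "0 < t" "t * K = \<rho>" using \<rho> K1 by (auto simp: t_def)
    have "cball (x + t *\<^sub>R v) t \<subseteq> cball x \<rho>"
    proof
      fix w assume "w \<in> cball (x + t *\<^sub>R v) t"
      then have "dist x w \<le> norm (t *\<^sub>R v) + t"
        using dist_triangle[of x w "x + t *\<^sub>R v"] by (simp add: dist_norm)
      also have "\<dots> = t * (norm v + 1)" using t by (simp add: algebra_simps)
      also have "\<dots> \<le> \<rho>" using t K[OF v(1)] by (metis less_imp_le mult_left_mono)
      finally show "w \<in> cball x \<rho>" by simp
    qed
    then have "cball (x + t *\<^sub>R v) t \<subseteq> \<Omega> \<inter> cball x \<rho>" using v(2)[of x t] x t R by auto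
    then have "emeasure lebesgue (cball (x + t *\<^sub>R v) t) \<le> emeasure lebesgue (\<Omega> \<inter> cball x \<rho>)"
      using \<open>open \<Omega>\<close> by (intro emeasure_mono) auto
    moreover have "emeasure lebesgue (cball (x + t *\<^sub>R v) t) = ennreal (c * \<rho> powr DIM('a))"
      using t K1 \<rho> by (simp add: emeasure_cball_powr c_def powr_mult[symmetric] mult.assoc t_def del: emeasure_completion)
    moreover have "emeasure lebesgue (\<Omega> \<inter> cball x \<rho>) = emeasure (lebesgue_on \<Omega>) (\<Omega> \<inter> cball x \<rho>)"
      using \<open>open \<Omega>\<close> by (subst emeasure_restrict_space) auto
    ultimately show "ennreal (c * \<rho> powr DIM('a)) \<le> emeasure (lebesgue_on \<Omega>) (\<Omega> \<inter> cball x \<rho>)"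
      by simp
  qed
  then show ?thesis by (rule that)
qed

section \<open>Averages, dyadic potentials and colourings\<close>

text \<open>If f exceeded the quotient l of the integral by m almost everywhere on E, then, as E has
  measure at least m > 0, the integral would exceed l m, that is, itself. Only a lower bound m for
  the measure appears because this is what the density condition supplies.\<close>

lemma exists_point_below_average:
  fixes f :: "'a \<Rightarrow> ennreal"
  assumes [measurable]: "f \<in> borel_measurable M" "E \<in> sets M"
    and m: "0 < m" "ennreal m \<le> emeasure M E" and Z: "AE x in M. x \<in> Z"
  shows "\<exists>a\<in>E \<inter> Z. ennreal m * f a \<le> (\<integral>\<^sup>+x\<in>E. f x \<partial>M)"
proof (rule ccontr)
  define I where "I = (\<integral>\<^sup>+x\<in>E. f x \<partial>M)"
  assume "\<not> ?thesis"
  then have less: "I < ennreal m * f a" if "a \<in> E" "a \<in> Z" for a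
    using that
    by (auto simp: I_def not_le)
  have Epos: "\<not> (AE x in M. x \<notin> E)"
  proof
    assume "AE x in M. x \<notin> E"
    then have "emeasure M E = 0" by (simp add: AE_iff_measurable[OF \<open>E \<in> sets M\<close>] sets.Int_space_eq1 flip: Int_def)
    with m show False by simp
  qed
  have "\<exists>a. a \<in> E \<and> a \<in> Z"
  proof (rule ccontr)
    assume "\<nexists>a. a \<in> E \<and> a \<in> Z"
    with Z have "AE x in M. x \<notin> E" by (auto elim!: eventually_mono)
    with Epos show False by simp
  qed
  \<comment> \<open>The integral is finite because it lies strictly below another value; only then
    can it be cancelled at the end.\<close>
  then obtain a where "I < ennreal m * f a" using less by blast
  then have Ifin: "I < \<infinity>" by (metis infinity_ennreal_def order_less_le_trans top_greatest)
  define l where "l = I / ennreal m"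
  have ml: "ennreal m * l = I"
    using m by (simp add: l_def ennreal_times_divide mult.commute[of "ennreal m"] mult_divide_eq_ennreal)
  have lf: "l < f x" if "x \<in> E" "x \<in> Z" for x
  proof (rule ccontr)
    assume "\<not> l < f x"
    then have "ennreal m * f x \<le> ennreal m * l" by (intro mult_left_mono) auto
    with less[OF that] ml show False by simp
  qed
  have "l < \<infinity>" using Ifin m by (simp add: l_def ennreal_divide_eq_top_iff less_top[symmetric])
  \<comment> \<open>Splitting off the constant l leaves the excess f - l, whose integral is
    positive.\<close>
  have "I = (\<integral>\<^sup>+x\<in>E. (l + (f x - l)) \<partial>M)"
    unfolding I_def using Z
    by (intro nn_integral_cong_AE) (auto elim!: eventually_mono split: split_indicator dest!: lf simp: add_diff_inverse_ennreal less_imp_le)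
  also have "\<dots> = (\<integral>\<^sup>+x\<in>E. l \<partial>M) + (\<integral>\<^sup>+x\<in>E. (f x - l) \<partial>M)"
    by (simp add: distrib_right nn_integral_add)
  finally have I_eq: "I = l * emeasure M E + (\<integral>\<^sup>+x\<in>E. (f x - l) \<partial>M)"
    by (simp add: nn_integral_cmult_indicator)
  have "(\<integral>\<^sup>+x\<in>E. (f x - l) \<partial>M) \<noteq> 0"
  proof
    assume "(\<integral>\<^sup>+x\<in>E. (f x - l) \<partial>M) = 0"
    then have "AE x in M. (f x - l) * indicator E x = 0" by (subst (asm) nn_integral_0_iff_AE) auto
    then have "AE x in M. x \<notin> E"
      using Z
    proof eventually_elim
      case (elim x)
      show ?case
      proof
        assume "x \<in> E"
        with elim lf[of x] \<open>l < \<infinity>\<close> show False by (auto simp: diff_eq_0_iff_ennreal)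
      qed
    qed
    with Epos show False by simp
  qed
  then have "I + 0 < I + (\<integral>\<^sup>+x\<in>E. (f x - l) \<partial>M)"
    using Ifin by (simp only: ennreal_add_left_cancel_less) (auto simp: zero_less_iff_neq_zero)
  moreover have "I \<le> l * emeasure M E"
    using m(2) by (subst ml[symmetric]) (simp add: mult.commute mult_left_mono)
  ultimately have "I + 0 < I" using I_eq by (metis add_right_mono order_less_le_trans)
  then show False by simp
qed

section \<open>Dyadic scales and potentials\<close>

lemma dyadic_scale:
  fixes t D :: real
  assumes "0 < t" "t \<le> D"
  obtains k where "D / 2 ^ Suc k < t" "t \<le> D / 2 ^ k"
proof -
  define P where "P k \<longleftrightarrow> D / 2 ^ k < t" for k :: nat
  obtain n where "D / t < 2 ^ n" using real_arch_pow[of 2 "D / t"] by auto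
  then have "P n" using assms by (simp add: P_def field_simps)
  then have P: "P (LEAST k. P k)" by (rule LeastI)
  have "\<not> P 0" using assms by (simp add: P_def)
  with P obtain k where k: "(LEAST k. P k) = Suc k" by (metis not0_implies_Suc)
  then have "\<not> P k" by (intro not_less_Least) simp
  with P k show ?thesis by (intro that[of k]) (auto simp: P_def)
qed

lemma summable_dyadic_powr:
  fixes D e :: real
  assumes "0 < D" "0 < e"
  shows "summable (\<lambda>k. (D / 2 ^ k) powr e)"
proof -
  have "(D / 2 ^ k) powr e = D powr e * ((1/2) powr e) ^ k" for k
    using assms by (simp add: powr_divide powr_mult powr_power powr_realpow[symmetric] powr_powr powr_one_eq_one field_simps)
  moreover have "(1/2 :: real) powr e < 1" using assms using powr_less_mono2[of e "1/2" 1] by simp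
  ultimately show ?thesis by (simp add: summable_mult summable_geometric)
qed

text \<open>A dyadic Riesz potential of order d: for d < N it is comparable with the integral of h
  against |x - y|^(d - N) over the ball of radius D. It takes the place of a maximal function, since
  each ball integral is at most \<rho>^(N - d) times the whole sum.\<close>

definition dyadic_potential :: "'a::euclidean_space measure \<Rightarrow> real \<Rightarrow> real \<Rightarrow> ('a \<Rightarrow> ennreal) \<Rightarrow> 'a \<Rightarrow> ennreal" where
  "dyadic_potential M D d h x =
     (\<Sum>k. ennreal ((D / 2 ^ k) powr (d - real DIM('a))) * (\<integral>\<^sup>+y\<in>cball x (D / 2 ^ k). h y \<partial>M))"

locale bounded_domain =
  fixes \<Omega> :: "'a::euclidean_space set"
  assumes open_domain: "open \<Omega>" and bounded_domain: "bounded \<Omega>"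
begin

abbreviation "M \<equiv> lebesgue_on \<Omega>"

lemma lmeasurable_domain: "\<Omega> \<in> lmeasurable"
  using open_domain bounded_domain by (auto intro: bounded_set_imp_lmeasurable)

sublocale finite_measure M
  by (rule finite_measure_lebesgue_on) (rule lmeasurable_domain)

sublocale pair: pair_sigma_finite M M ..

lemma measurable_id_borel [measurable]: "(\<lambda>x. x) \<in> M \<rightarrow>\<^sub>M borel"
  by (intro measurable_restrict_space1) (auto intro: measurable_completion)

lemma emeasure_cball_le:
  assumes "0 < \<rho>"
  shows "emeasure M (\<Omega> \<inter> cball x \<rho>) \<le> ennreal (unit_ball_vol DIM('a) * \<rho> powr DIM('a))"
proof -
  have "emeasure M (\<Omega> \<inter> cball x \<rho>) = emeasure lebesgue (\<Omega> \<inter> cball x \<rho>)"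
    using open_domain by (subst emeasure_restrict_space) auto
  also have "\<dots> \<le> emeasure lebesgue (cball x \<rho>)" using open_domain by (intro emeasure_mono) auto
  finally show ?thesis using assms by (simp only: emeasure_cball_powr)
qed

lemma sets_cball [measurable]: "\<Omega> \<inter> cball x \<rho> \<in> sets M"
  using open_domain by (auto simp: sets_restrict_space_iff)

lemma measurable_indicator_cball [measurable]:
  "(\<lambda>z. indicator (cball (fst z) \<rho>) (snd z) :: ennreal) \<in> borel_measurable (M \<Otimes>\<^sub>M M)"
proof -
  have "(\<lambda>z. indicator (cball (fst z) \<rho>) (snd z) :: ennreal) = (\<lambda>z. indicator {..\<rho>} (dist (fst z) (snd z)))"
    by (auto simp: fun_eq_iff split: split_indicator)
  also have "\<dots> \<in> borel_measurable (M \<Otimes>\<^sub>M M)" by measurable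
  finally show ?thesis .
qed

lemma measurable_nn_integral_cball [measurable]:
  assumes [measurable]: "h \<in> borel_measurable M"
  shows "(\<lambda>x. \<integral>\<^sup>+y\<in>cball x \<rho>. h y \<partial>M) \<in> borel_measurable M"
  by measurable (simp add: split_beta)

lemma measurable_dyadic_potential [measurable]:
  assumes [measurable]: "h \<in> borel_measurable M"
  shows "dyadic_potential M D d h \<in> borel_measurable M"
  unfolding dyadic_potential_def by measurable

lemma nn_integral_nn_integral_cball_le:
  assumes [measurable]: "h \<in> borel_measurable M" and \<rho>: "0 < \<rho>"
  shows "(\<integral>\<^sup>+x. (\<integral>\<^sup>+y\<in>cball x \<rho>. h y \<partial>M) \<partial>M)
    \<le> ennreal (unit_ball_vol DIM('a) * \<rho> powr DIM('a)) * (\<integral>\<^sup>+y. h y \<partial>M)"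
proof -
  have "(\<integral>\<^sup>+x. (\<integral>\<^sup>+y\<in>cball x \<rho>. h y \<partial>M) \<partial>M) = (\<integral>\<^sup>+y. (\<integral>\<^sup>+x. h y * indicator (cball x \<rho>) y \<partial>M) \<partial>M)"
    by (rule pair.Fubini'[symmetric]) (simp add: split_beta)
  also have "\<dots> = (\<integral>\<^sup>+y. h y * emeasure M (\<Omega> \<inter> cball y \<rho>) \<partial>M)"
  proof (intro nn_integral_cong)
    fix y
    have "(\<integral>\<^sup>+x. h y * indicator (cball x \<rho>) y \<partial>M) = (\<integral>\<^sup>+x. h y * indicator (\<Omega> \<inter> cball y \<rho>) x \<partial>M)"
      by (intro nn_integral_cong) (auto split: split_indicator simp: dist_commute)
    also have "\<dots> = h y * emeasure M (\<Omega> \<inter> cball y \<rho>)" by (rule nn_integral_cmult_indicator) (rule sets_cball)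
    finally show "(\<integral>\<^sup>+x. h y * indicator (cball x \<rho>) y \<partial>M) = h y * emeasure M (\<Omega> \<inter> cball y \<rho>)" .
  qed
  also have "\<dots> \<le> (\<integral>\<^sup>+y. h y * ennreal (unit_ball_vol DIM('a) * \<rho> powr DIM('a)) \<partial>M)"
    by (intro nn_integral_mono mult_left_mono emeasure_cball_le \<rho>) auto
  also have "\<dots> = ennreal (unit_ball_vol DIM('a) * \<rho> powr DIM('a)) * (\<integral>\<^sup>+y. h y \<partial>M)"
    by (subst nn_integral_multc) (auto simp: mult.commute)
  finally show ?thesis .
qed

text \<open>By Fubini each ball costs the factor w \<rho>^N, so the terms are left with \<rho>^d and
  form a geometric series, convergent because d > 0.\<close>

lemma nn_integral_dyadic_potential_le:
  assumes "0 < D" "0 < d"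
  obtains C where "0 \<le> C" "\<And>h. h \<in> borel_measurable M \<Longrightarrow>
    (\<integral>\<^sup>+x. dyadic_potential M D d h x \<partial>M) \<le> ennreal C * (\<integral>\<^sup>+x. h x \<partial>M)"
proof
  let ?w = "unit_ball_vol DIM('a)"
  define C where "C = (\<Sum>k. ?w * (D / 2 ^ k) powr d)"
  have sm: "summable (\<lambda>k. ?w * (D / 2 ^ k) powr d)"
    by (intro summable_mult summable_dyadic_powr assms)
  show "0 \<le> C" unfolding C_def by (intro suminf_nonneg sm) simp
  fix h :: "'a \<Rightarrow> ennreal" assume [measurable]: "h \<in> borel_measurable M"
  have "(\<integral>\<^sup>+x. dyadic_potential M D d h x \<partial>M)
      = (\<Sum>k. (\<integral>\<^sup>+x. ennreal ((D / 2 ^ k) powr (d - real DIM('a))) * (\<integral>\<^sup>+y\<in>cball x (D / 2 ^ k). h y \<partial>M) \<partial>M))"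
    unfolding dyadic_potential_def by (rule nn_integral_suminf) measurable
  also have "\<dots> \<le> (\<Sum>k. ennreal (?w * (D / 2 ^ k) powr d) * (\<integral>\<^sup>+x. h x \<partial>M))"
  proof (intro suminf_le summableI)
    fix k :: nat
    have "(\<integral>\<^sup>+x. ennreal ((D / 2 ^ k) powr (d - real DIM('a))) * (\<integral>\<^sup>+y\<in>cball x (D / 2 ^ k). h y \<partial>M) \<partial>M)
       = ennreal ((D / 2 ^ k) powr (d - real DIM('a))) * (\<integral>\<^sup>+x. (\<integral>\<^sup>+y\<in>cball x (D / 2 ^ k). h y \<partial>M) \<partial>M)"
      by (rule nn_integral_cmult) measurable
    also have "\<dots> \<le> ennreal ((D / 2 ^ k) powr (d - real DIM('a))) * (ennreal (?w * (D / 2 ^ k) powr DIM('a)) * (\<integral>\<^sup>+y. h y \<partial>M))"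
      using assms by (intro mult_left_mono nn_integral_nn_integral_cball_le) auto
    also have "\<dots> = ennreal (?w * (D / 2 ^ k) powr d) * (\<integral>\<^sup>+x. h x \<partial>M)"
      using assms by (simp add: powr_diff mult.assoc[symmetric] ennreal_mult[symmetric] mult.commute[of _ "?w"])
    finally show "(\<integral>\<^sup>+x. ennreal ((D / 2 ^ k) powr (d - real DIM('a))) * (\<integral>\<^sup>+y\<in>cball x (D / 2 ^ k). h y \<partial>M) \<partial>M) \<le> \<dots>" .
  qed
  also have "\<dots> = (\<Sum>k. ennreal (?w * (D / 2 ^ k) powr d)) * (\<integral>\<^sup>+x. h x \<partial>M)"
    by (rule ennreal_suminf_multc)
  also have "(\<Sum>k. ennreal (?w * (D / 2 ^ k) powr d)) = ennreal C"
    unfolding C_def by (rule suminf_ennreal2[OF _ sm]) simp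
  finally show "(\<integral>\<^sup>+x. dyadic_potential M D d h x \<partial>M) \<le> ennreal C * (\<integral>\<^sup>+x. h x \<partial>M)" .
qed

lemma nn_integral_cball_le_dyadic_potential:
  assumes "0 < D"
  shows "(\<integral>\<^sup>+y\<in>cball x (D / 2 ^ k). h y \<partial>M)
    \<le> ennreal ((D / 2 ^ k) powr (real DIM('a) - d)) * dyadic_potential M D d h x"
proof -
  let ?I = "\<integral>\<^sup>+y\<in>cball x (D / 2 ^ k). h y \<partial>M"
  have "?I = ennreal ((D / 2 ^ k) powr (real DIM('a) - d)) * (ennreal ((D / 2 ^ k) powr (d - real DIM('a))) * ?I)"
    using assms by (simp add: mult.assoc[symmetric] ennreal_mult[symmetric] powr_add[symmetric])
  also have "\<dots> \<le> ennreal ((D / 2 ^ k) powr (real DIM('a) - d)) * dyadic_potential M D d h x"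
    unfolding dyadic_potential_def
    by (intro mult_left_mono sum_le_suminf[where I="{k}", simplified]) auto
  finally show ?thesis .
qed

text \<open>Dyadic shells around x. The factor 2 to the power |\<beta> - N| compares the kernel with
  its value at the dyadic radius whether the kernel decreases or increases with the distance, so
  large \<beta> is covered as well.\<close>

lemma riesz_kernel_bound:
  assumes \<beta>: "0 < (\<beta> :: real)"
  obtains C where "0 \<le> C" "\<And>x. x \<in> \<Omega> \<Longrightarrow> (\<integral>\<^sup>+y. ennreal (dist x y powr (\<beta> - real DIM('a))) \<partial>M) \<le> ennreal C"
proof -
  let ?N = "real DIM('a)" and ?w = "unit_ball_vol DIM('a)"
  \<comment> \<open>Adding 1 keeps D positive even if \<Omega> is empty.\<close>
  define D where "D = diameter \<Omega> + 1"
  have D: "0 < D" using diameter_ge_0[OF bounded_domain] by (simp add: D_def)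
  have dD: "dist x y \<le> D" if "x \<in> \<Omega>" "y \<in> \<Omega>" for x y
    using diameter_bounded_bound[OF bounded_domain that] by (simp add: D_def)
  let ?f = "\<lambda>k. 2 powr \<bar>\<beta> - ?N\<bar> * (D / 2 ^ k) powr (\<beta> - ?N)"
  define C where "C = (\<Sum>k. 2 powr \<bar>\<beta> - ?N\<bar> * ?w * (D / 2 ^ k) powr \<beta>)"
  have sm: "summable (\<lambda>k. 2 powr \<bar>\<beta> - ?N\<bar> * ?w * (D / 2 ^ k) powr \<beta>)"
    by (intro summable_mult summable_dyadic_powr \<beta> D)
  have C0: "0 \<le> C" unfolding C_def by (intro suminf_nonneg sm) simp
  have "(\<integral>\<^sup>+y. ennreal (dist x y powr (\<beta> - real DIM('a))) \<partial>M) \<le> ennreal C" if x: "x \<in> \<Omega>" for x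
  proof -
    have "(\<integral>\<^sup>+y. ennreal (dist x y powr (\<beta> - real DIM('a))) \<partial>M)
       \<le> (\<integral>\<^sup>+y. (\<Sum>k. ennreal (?f k) * indicator (\<Omega> \<inter> cball x (D / 2 ^ k)) y) \<partial>M)"
    proof (intro nn_integral_mono)
      fix y assume "y \<in> space M"
      then have y: "y \<in> \<Omega>" by simp
      show "ennreal (dist x y powr (\<beta> - ?N)) \<le> (\<Sum>k. ennreal (?f k) * indicator (\<Omega> \<inter> cball x (D / 2 ^ k)) y)"
      \<comment> \<open>At y = x the kernel is 0, because 0 \<open>powr\<close> any exponent is
        0.\<close>
      proof (cases "x = y")
        case False
        then obtain k where k: "D / 2 ^ Suc k < dist x y" "dist x y \<le> D / 2 ^ k"
          using dyadic_scale[of "dist x y" D] dD[OF x y] by auto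
        have "dist x y powr (\<beta> - ?N) \<le> ?f k"
        proof (cases "\<beta> \<le> ?N")
          case True
          have "dist x y powr (\<beta> - ?N) \<le> (D / 2 ^ k / 2) powr (\<beta> - ?N)"
            using k D True by (intro powr_mono2') (auto simp: field_simps)
          also have "\<dots> = (D / 2 ^ k) powr (\<beta> - ?N) / 2 powr (\<beta> - ?N)" by (rule powr_divide)
          also have "\<dots> = ?f k" using True powr_minus_divide[of 2 "\<beta> - ?N"] by (simp add: divide_inverse mult.commute)
          finally show ?thesis .
        next
          case False
          have "dist x y powr (\<beta> - ?N) \<le> 1 * (D / 2 ^ k) powr (\<beta> - ?N)"
            using k False by (auto intro!: powr_mono2)
          also have "\<dots> \<le> ?f k" by (intro mult_right_mono) (auto intro: ge_one_powr_ge_zero)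
          finally show ?thesis .
        qed
        then have "ennreal (dist x y powr (\<beta> - ?N)) \<le> ennreal (?f k) * indicator (\<Omega> \<inter> cball x (D / 2 ^ k)) y"
          using k y by (auto intro: ennreal_leI)
        also have "\<dots> \<le> (\<Sum>k. ennreal (?f k) * indicator (\<Omega> \<inter> cball x (D / 2 ^ k)) y)"
          by (rule sum_le_suminf[where I="{k}", simplified]) auto
        finally show ?thesis .
      qed simp
    qed
    also have "\<dots> = (\<Sum>k. (\<integral>\<^sup>+y. ennreal (?f k) * indicator (\<Omega> \<inter> cball x (D / 2 ^ k)) y \<partial>M))"
      by (rule nn_integral_suminf) measurable
    also have "\<dots> \<le> (\<Sum>k. ennreal (2 powr \<bar>\<beta> - ?N\<bar> * ?w * (D / 2 ^ k) powr \<beta>))"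
    proof (intro suminf_le summableI)
      fix k :: nat
      have "(\<integral>\<^sup>+y. ennreal (?f k) * indicator (\<Omega> \<inter> cball x (D / 2 ^ k)) y \<partial>M)
          = ennreal (?f k) * emeasure M (\<Omega> \<inter> cball x (D / 2 ^ k))"
        by (rule nn_integral_cmult_indicator) (rule sets_cball)
      also have "\<dots> \<le> ennreal (?f k) * ennreal (?w * (D / 2 ^ k) powr ?N)"
        using D by (intro mult_left_mono emeasure_cball_le) auto
      also have "\<dots> = ennreal (2 powr \<bar>\<beta> - ?N\<bar> * ?w * (D / 2 ^ k) powr \<beta>)"
        using D by (simp add: ennreal_mult[symmetric] powr_diff)
      finally show "(\<integral>\<^sup>+y. ennreal (?f k) * indicator (\<Omega> \<inter> cball x (D / 2 ^ k)) y \<partial>M) \<le> \<dots>" .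
    qed
    also have "\<dots> = ennreal C"
      unfolding C_def by (rule suminf_ennreal2[OF _ sm]) simp
    finally show ?thesis .
  qed
  with C0 show ?thesis by (rule that)
qed

end

section \<open>Finite colourings and diagonal subsequences\<close>

lemma infinite_set_same_colour:
  assumes "infinite (A :: nat set)" "finite (range col)"
  obtains B where "B \<subseteq> A" "infinite B" "\<And>n m. n \<in> B \<Longrightarrow> m \<in> B \<Longrightarrow> col n = col m"
proof -
  have "finite (col ` A)" using assms(2) by (rule finite_subset[rotated]) auto
  then obtain n where n: "n \<in> A" "infinite {m \<in> A. col m = col n}"
    using pigeonhole_infinite[OF assms(1)] by blast
  then show ?thesis by (intro that[of "{m \<in> A. col m = col n}"]) auto
qed

text \<open>Total boundedness phrased by finite colourings: equal colours mean a small value of D.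
  This form involves no triangle inequality, and colourings for several quantities combine by
  pairing. The pigeonhole principle refines infinite index sets for the tolerances (1/2)^k, and the
  diagonal picks one increasing index from each.\<close>

lemma diagonal_subsequence_of_colourings:
  fixes D :: "nat \<Rightarrow> nat \<Rightarrow> ennreal"
  assumes col: "\<And>e. 0 < e \<Longrightarrow> \<exists>c :: nat \<Rightarrow> 'c. finite (range c) \<and> (\<forall>n m. c n = c m \<longrightarrow> D n m \<le> ennreal e)"
  obtains r :: "nat \<Rightarrow> nat" where "strict_mono r"
    "\<And>k n m. k \<le> n \<Longrightarrow> k \<le> m \<Longrightarrow> D (r n) (r m) \<le> ennreal ((1/2) ^ k)"
proof -
  define good where "good k A \<longleftrightarrow> infinite A \<and> (\<forall>n\<in>A. \<forall>m\<in>A. D n m \<le> ennreal ((1/2) ^ k))" for k :: nat and A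
  have step: "\<exists>B\<subseteq>A. good k B" if A: "infinite A" for k A
  proof -
    obtain c :: "nat \<Rightarrow> 'c" where c: "finite (range c)" "\<And>n m. c n = c m \<Longrightarrow> D n m \<le> ennreal ((1/2) ^ k)"
      using col[of "(1/2) ^ k"] by auto
    obtain B where "B \<subseteq> A" "infinite B" "\<And>n m. n \<in> B \<Longrightarrow> m \<in> B \<Longrightarrow> c n = c m"
      using infinite_set_same_colour[OF A c(1)] by blast
    with c(2) show ?thesis unfolding good_def by blast
  qed
  have "\<exists>A. \<forall>k. good k (A k) \<and> A (Suc k) \<subseteq> A k"
  proof (rule dependent_nat_choice)
    show "\<exists>A. good 0 A" using step[of UNIV] by auto
    show "\<exists>B. good (Suc k) B \<and> B \<subseteq> A" if "good k A" for A k
      using step[of A "Suc k"] that by (auto simp: good_def)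
  qed
  then obtain A where A: "\<And>k. good k (A k)" "\<And>k. A (Suc k) \<subseteq> A k" by blast
  have Amono: "A n \<subseteq> A k" if "k \<le> n" for k n
    using lift_Suc_antimono_le[of A, OF A(2) that] .
  have "\<exists>r. \<forall>n. r n \<in> A n \<and> r n < r (Suc n)"
  proof (rule dependent_nat_choice)
    show "\<exists>x. x \<in> A 0" using A(1)[of 0] by (auto simp: good_def dest: infinite_imp_nonempty)
    show "\<exists>y. y \<in> A (Suc n) \<and> x < y" for x n
      using A(1)[of "Suc n"] by (auto simp: good_def infinite_nat_iff_unbounded)
  qed
  then obtain r where r: "\<And>n. r n \<in> A n" "\<And>n. r n < r (Suc n)" by blast
  show ?thesis
  proof (rule that[of r])
    show "strict_mono r" using r(2) by (simp add: strict_mono_Suc_iff)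
    fix k n m :: nat assume "k \<le> n" "k \<le> m"
    then have "r n \<in> A k" "r m \<in> A k" using r(1) Amono by blast+
    then show "D (r n) (r m) \<le> ennreal ((1/2) ^ k)" using A(1)[of k] by (auto simp: good_def)
  qed
qed

section \<open>Functions with a pointwise Hoelder bound\<close>

text \<open>The constant 2^p, cruder than what convexity gives, is valid for exponents below 1 too,
  such as 1 / q.\<close>

lemma powr_add_le:
  fixes a b p :: real
  assumes "0 \<le> a" "0 \<le> b" "0 < p"
  shows "(a + b) powr p \<le> 2 powr p * (a powr p + b powr p)"
proof -
  have "(a + b) powr p \<le> (2 * max a b) powr p" using assms by (intro powr_mono2) auto
  also have "\<dots> = 2 powr p * max a b powr p" using assms by (intro powr_mult)
  also have "\<dots> \<le> 2 powr p * (a powr p + b powr p)"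
    by (intro mult_left_mono) (auto simp: max_def)
  finally show ?thesis .
qed

lemma powr_le_one_plus_powr:
  fixes t r q :: real
  assumes "0 \<le> t" "0 \<le> r" "r \<le> q"
  shows "t powr r \<le> 1 + t powr q"
proof (cases "t \<le> 1")
  case True
  then have "t powr r \<le> 1" using assms by (simp add: powr_le1)
  then show ?thesis by (simp add: add_increasing2)
next
  case False
  then have "t powr r \<le> t powr q" using assms by (intro powr_mono) auto
  then show ?thesis by simp
qed

lemma powr_le_imp_le_powr:
  fixes t X q :: real
  assumes "0 \<le> t" "0 < q" "t powr q \<le> X"
  shows "t \<le> X powr (1 / q)"
proof -
  have "t = (t powr q) powr (1 / q)" using assms by (simp add: powr_powr)
  also have "\<dots> \<le> X powr (1 / q)" using assms by (intro powr_mono2) auto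
  finally show ?thesis .
qed

context bounded_domain
begin

text \<open>The right-hand side is a power of A so that A scales like u.\<close>

definition lp_bound :: "real \<Rightarrow> real \<Rightarrow> ('a \<Rightarrow> real) \<Rightarrow> bool" where
  "lp_bound q A u \<longleftrightarrow> u \<in> borel_measurable M \<and> (\<integral>\<^sup>+x. ennreal (\<bar>u x\<bar> powr q) \<partial>M) \<le> ennreal (A powr q)"

text \<open>Membership in a ball of the Hajlasz-Sobolev space of smoothness \<sigma>, localised to
  distances at most R; G is a Hajlasz gradient. The set Z of full measure absorbs the points where
  the natural choice of G is infinite, so that G can be real-valued.\<close>

definition hajlasz :: "real \<Rightarrow> real \<Rightarrow> real \<Rightarrow> real \<Rightarrow> ('a \<Rightarrow> real) \<Rightarrow> bool" where
  "hajlasz R \<sigma> q A u \<longleftrightarrow> (\<exists>G Z. G \<in> borel_measurable M \<and> (\<forall>x. 0 \<le> G x) \<and>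
     (\<integral>\<^sup>+x. ennreal (G x powr q) \<partial>M) \<le> ennreal (A powr q) \<and> (AE x in M. x \<in> Z) \<and>
     (\<forall>x\<in>Z. \<forall>y\<in>Z. dist x y \<le> R \<longrightarrow> \<bar>u x - u y\<bar> \<le> dist x y powr \<sigma> * (G x + G y)))"

lemma lp_boundI:
  "u \<in> borel_measurable M \<Longrightarrow> (\<integral>\<^sup>+x. ennreal (\<bar>u x\<bar> powr q) \<partial>M) \<le> ennreal (A powr q) \<Longrightarrow> lp_bound q A u"
  by (simp add: lp_bound_def)

lemma hajlaszI:
  assumes "G \<in> borel_measurable M" "\<And>x. 0 \<le> G x" "(\<integral>\<^sup>+x. ennreal (G x powr q) \<partial>M) \<le> ennreal (A powr q)"
    "AE x in M. x \<in> Z"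
    "\<And>x y. x \<in> Z \<Longrightarrow> y \<in> Z \<Longrightarrow> x \<noteq> y \<Longrightarrow> dist x y \<le> R \<Longrightarrow> \<bar>u x - u y\<bar> \<le> dist x y powr \<sigma> * (G x + G y)"
  shows "hajlasz R \<sigma> q A u"
  unfolding hajlasz_def
proof (intro exI[of _ G] exI[of _ Z] conjI ballI impI allI)
  fix x y assume "x \<in> Z" "y \<in> Z" "dist x y \<le> R"
  then show "\<bar>u x - u y\<bar> \<le> dist x y powr \<sigma> * (G x + G y)"
    using assms(5)[of x y] by (cases "x = y") auto
qed (use assms in auto)

lemma hajlaszE:
  assumes "hajlasz R \<sigma> q A u"
  obtains G Z where "G \<in> borel_measurable M" "\<And>x. 0 \<le> G x"
    "(\<integral>\<^sup>+x. ennreal (G x powr q) \<partial>M) \<le> ennreal (A powr q)" "AE x in M. x \<in> Z" "Z \<subseteq> \<Omega>"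
    "\<And>x y. x \<in> Z \<Longrightarrow> y \<in> Z \<Longrightarrow> dist x y \<le> R \<Longrightarrow> \<bar>u x - u y\<bar> \<le> dist x y powr \<sigma> * (G x + G y)"
proof -
  obtain G Z where "G \<in> borel_measurable M" "\<And>x. 0 \<le> G x"
    "(\<integral>\<^sup>+x. ennreal (G x powr q) \<partial>M) \<le> ennreal (A powr q)" and Z: "AE x in M. x \<in> Z" and
    "\<And>x y. x \<in> Z \<Longrightarrow> y \<in> Z \<Longrightarrow> dist x y \<le> R \<Longrightarrow> \<bar>u x - u y\<bar> \<le> dist x y powr \<sigma> * (G x + G y)"
    using assms unfolding hajlasz_def by auto
  moreover have "AE x in M. x \<in> Z \<inter> \<Omega>" using Z by (rule AE_mp) (auto intro: AE_I2)
  ultimately show ?thesis by (intro that[of G "Z \<inter> \<Omega>"]) auto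
qed

lemma lp_bound_scale:
  assumes "lp_bound q A u" "0 \<le> A" "0 \<le> b"
  shows "lp_bound q (b * A) (\<lambda>x. b * u x)"
proof (rule lp_boundI)
  have [measurable]: "u \<in> borel_measurable M" using assms by (simp add: lp_bound_def)
  show "(\<lambda>x. b * u x) \<in> borel_measurable M" by measurable
  have "(\<integral>\<^sup>+x. ennreal (\<bar>b * u x\<bar> powr q) \<partial>M) = (\<integral>\<^sup>+x. ennreal (b powr q) * ennreal (\<bar>u x\<bar> powr q) \<partial>M)"
    using assms by (simp add: abs_mult powr_mult ennreal_mult)
  also have "\<dots> = ennreal (b powr q) * (\<integral>\<^sup>+x. ennreal (\<bar>u x\<bar> powr q) \<partial>M)" by (rule nn_integral_cmult) measurable
  also have "\<dots> \<le> ennreal (b powr q) * ennreal (A powr q)" using assms by (intro mult_left_mono) (auto simp: lp_bound_def)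
  finally show "(\<integral>\<^sup>+x. ennreal (\<bar>b * u x\<bar> powr q) \<partial>M) \<le> ennreal ((b * A) powr q)"
    using assms by (simp add: powr_mult ennreal_mult)
qed

lemma hajlasz_scale:
  assumes "hajlasz R \<sigma> q A u" "0 \<le> A" "0 \<le> b"
  shows "hajlasz R \<sigma> q (b * A) (\<lambda>x. b * u x)"
proof -
  obtain G Z where G: "G \<in> borel_measurable M" "\<And>x. 0 \<le> G x"
    "(\<integral>\<^sup>+x. ennreal (G x powr q) \<partial>M) \<le> ennreal (A powr q)" "AE x in M. x \<in> Z" "Z \<subseteq> \<Omega>"
    "\<And>x y. x \<in> Z \<Longrightarrow> y \<in> Z \<Longrightarrow> dist x y \<le> R \<Longrightarrow> \<bar>u x - u y\<bar> \<le> dist x y powr \<sigma> * (G x + G y)"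
    using hajlaszE[OF assms(1)] by blast
  have "lp_bound q (b * A) (\<lambda>x. b * G x)"
    using lp_bound_scale[of q A G b] G assms by (simp add: lp_bound_def)
  show ?thesis
  proof (rule hajlaszI[where G="\<lambda>x. b * G x" and Z=Z])
    show "(\<lambda>x. b * G x) \<in> borel_measurable M" using G(1) by measurable
    show "0 \<le> b * G x" for x using G assms by simp
    show "(\<integral>\<^sup>+x. ennreal ((b * G x) powr q) \<partial>M) \<le> ennreal ((b * A) powr q)"
      using \<open>lp_bound q (b * A) (\<lambda>x. b * G x)\<close> G assms by (simp add: lp_bound_def)
    fix x y assume "x \<in> Z" "y \<in> Z" "dist x y \<le> R"
    then have "b * \<bar>u x - u y\<bar> \<le> b * (dist x y powr \<sigma> * (G x + G y))" using G assms by (intro mult_left_mono) auto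
    moreover have "\<bar>b * u x - b * u y\<bar> = b * \<bar>u x - u y\<bar>"
      by (metis abs_mult abs_of_nonneg assms(3) right_diff_distrib)
    ultimately show "\<bar>b * u x - b * u y\<bar> \<le> dist x y powr \<sigma> * (b * G x + b * G y)"
      by (simp add: algebra_simps)
  qed (rule G)
qed

lemma nn_integral_powr_add_le:
  assumes [measurable]: "f \<in> borel_measurable M" "g \<in> borel_measurable M"
    and "\<And>x. 0 \<le> f x" "\<And>x. 0 \<le> g x" "0 < q"
  shows "(\<integral>\<^sup>+x. ennreal ((f x + g x) powr q) \<partial>M)
    \<le> ennreal (2 powr q) * ((\<integral>\<^sup>+x. ennreal (f x powr q) \<partial>M) + (\<integral>\<^sup>+x. ennreal (g x powr q) \<partial>M))"
proof -
  have "(\<integral>\<^sup>+x. ennreal ((f x + g x) powr q) \<partial>M) \<le> (\<integral>\<^sup>+x. ennreal (2 powr q) * (ennreal (f x powr q) + ennreal (g x powr q)) \<partial>M)"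
    using assms by (intro nn_integral_mono) (auto simp flip: ennreal_plus ennreal_mult intro!: ennreal_leI powr_add_le)
  also have "\<dots> = ennreal (2 powr q) * ((\<integral>\<^sup>+x. ennreal (f x powr q) \<partial>M) + (\<integral>\<^sup>+x. ennreal (g x powr q) \<partial>M))"
    by (subst nn_integral_cmult) (auto simp: nn_integral_add)
  finally show ?thesis .
qed

text \<open>Source of the factor 4 in the estimates for differences: 2^q comes from splitting the
  power of a sum, and the two equal summands cost another 2 \<le> 2^q.\<close>

lemma four_powr_bound:
  assumes "1 \<le> q" "0 \<le> A"
  shows "ennreal (2 powr q) * (ennreal (A powr q) + ennreal (A powr q)) \<le> ennreal ((4 * A) powr q)"
proof -
  have "2 powr q * (A powr q + A powr q) = 2 powr q * (2 powr 1 * A powr q)" by simp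
  also have "\<dots> \<le> 2 powr q * (2 powr q * A powr q)"
    using assms by (intro mult_left_mono mult_right_mono powr_mono) auto
  also have "\<dots> = (4 * A) powr q" using assms by (simp add: powr_mult[symmetric])
  finally show ?thesis by (simp flip: ennreal_plus ennreal_mult)
qed

lemma lp_bound_diff:
  assumes u: "lp_bound q A u" and v: "lp_bound q A v" and q: "1 \<le> q" and A: "0 \<le> A"
  shows "lp_bound q (4 * A) (\<lambda>x. u x - v x)"
proof (rule lp_boundI)
  have [measurable]: "u \<in> borel_measurable M" "v \<in> borel_measurable M" using u v by (auto simp: lp_bound_def)
  show "(\<lambda>x. u x - v x) \<in> borel_measurable M" by measurable
  have "(\<integral>\<^sup>+x. ennreal (\<bar>u x - v x\<bar> powr q) \<partial>M) \<le> (\<integral>\<^sup>+x. ennreal ((\<bar>u x\<bar> + \<bar>v x\<bar>) powr q) \<partial>M)"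
    using q by (intro nn_integral_mono ennreal_leI powr_mono2) auto
  also have "\<dots> \<le> ennreal (2 powr q) * ((\<integral>\<^sup>+x. ennreal (\<bar>u x\<bar> powr q) \<partial>M) + (\<integral>\<^sup>+x. ennreal (\<bar>v x\<bar> powr q) \<partial>M))"
    using q by (intro nn_integral_powr_add_le) auto
  also have "\<dots> \<le> ennreal (2 powr q) * (ennreal (A powr q) + ennreal (A powr q))"
    using u v by (intro mult_left_mono add_mono) (auto simp: lp_bound_def)
  also have "\<dots> \<le> ennreal ((4 * A) powr q)" using q A by (rule four_powr_bound)
  finally show "(\<integral>\<^sup>+x. ennreal (\<bar>u x - v x\<bar> powr q) \<partial>M) \<le> ennreal ((4 * A) powr q)" .
qed

lemma hajlasz_diff:
  assumes u: "hajlasz R \<sigma> q A u" and v: "hajlasz R \<sigma> q A v" and q: "1 \<le> q" and A: "0 \<le> A"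
  shows "hajlasz R \<sigma> q (4 * A) (\<lambda>x. u x - v x)"
proof -
  obtain G Z where G [measurable]: "G \<in> borel_measurable M" and G': "\<And>x. 0 \<le> G x"
    "(\<integral>\<^sup>+x. ennreal (G x powr q) \<partial>M) \<le> ennreal (A powr q)" "AE x in M. x \<in> Z" "Z \<subseteq> \<Omega>"
    "\<And>x y. x \<in> Z \<Longrightarrow> y \<in> Z \<Longrightarrow> dist x y \<le> R \<Longrightarrow> \<bar>u x - u y\<bar> \<le> dist x y powr \<sigma> * (G x + G y)"
    using hajlaszE[OF u] by blast
  obtain H Y where H [measurable]: "H \<in> borel_measurable M" and H': "\<And>x. 0 \<le> H x"
    "(\<integral>\<^sup>+x. ennreal (H x powr q) \<partial>M) \<le> ennreal (A powr q)" "AE x in M. x \<in> Y" "Y \<subseteq> \<Omega>"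
    "\<And>x y. x \<in> Y \<Longrightarrow> y \<in> Y \<Longrightarrow> dist x y \<le> R \<Longrightarrow> \<bar>v x - v y\<bar> \<le> dist x y powr \<sigma> * (H x + H y)"
    using hajlaszE[OF v] by blast
  show ?thesis
  proof (rule hajlaszI[where G="\<lambda>x. G x + H x" and Z="Z \<inter> Y"])
    show "(\<lambda>x. G x + H x) \<in> borel_measurable M" by measurable
    show "0 \<le> G x + H x" for x using G'(1)[of x] H'(1)[of x] by simp
    show "AE x in M. x \<in> Z \<inter> Y" using G'(3) H'(3) by auto
    have "(\<integral>\<^sup>+x. ennreal ((G x + H x) powr q) \<partial>M)
       \<le> ennreal (2 powr q) * ((\<integral>\<^sup>+x. ennreal (G x powr q) \<partial>M) + (\<integral>\<^sup>+x. ennreal (H x powr q) \<partial>M))"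
      using q G' H' by (intro nn_integral_powr_add_le) auto
    also have "\<dots> \<le> ennreal (2 powr q) * (ennreal (A powr q) + ennreal (A powr q))"
      using G' H' by (intro mult_left_mono add_mono) auto
    also have "\<dots> \<le> ennreal ((4 * A) powr q)" using q A by (rule four_powr_bound)
    finally show "(\<integral>\<^sup>+x. ennreal ((G x + H x) powr q) \<partial>M) \<le> ennreal ((4 * A) powr q)" .
    fix x y assume "x \<in> Z \<inter> Y" "y \<in> Z \<inter> Y" "dist x y \<le> R"
    then have "\<bar>u x - u y\<bar> + \<bar>v x - v y\<bar> \<le> dist x y powr \<sigma> * (G x + G y) + dist x y powr \<sigma> * (H x + H y)"
      using G' H' by (intro add_mono) auto
    then show "\<bar>u x - v x - (u y - v y)\<bar> \<le> dist x y powr \<sigma> * (G x + H x + (G y + H y))"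
      by (simp add: algebra_simps)
  qed
qed

text \<open>The pointwise bound t^r \<le> 1 + t^q takes the place of Hoelder's inequality on a set
  of finite measure. It is not homogeneous, hence the normalisation of the integral to 1.\<close>

lemma nn_integral_powr_lower_exponent:
  assumes [measurable]: "f \<in> borel_measurable M" and "\<And>x. 0 \<le> f x" "0 \<le> r" "r \<le> q"
    and "(\<integral>\<^sup>+x. ennreal (f x powr q) \<partial>M) \<le> ennreal 1"
  shows "(\<integral>\<^sup>+x. ennreal (f x powr r) \<partial>M) \<le> ennreal (measure M \<Omega> + 1)"
proof -
  have "(\<integral>\<^sup>+x. ennreal (f x powr r) \<partial>M) \<le> (\<integral>\<^sup>+x. 1 + ennreal (f x powr q) \<partial>M)"
    using assms by (intro nn_integral_mono) (auto simp flip: ennreal_1 ennreal_plus intro!: ennreal_leI powr_le_one_plus_powr)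
  also have "\<dots> = emeasure M \<Omega> + (\<integral>\<^sup>+x. ennreal (f x powr q) \<partial>M)"
    by (subst nn_integral_add) auto
  also have "\<dots> \<le> ennreal (measure M \<Omega>) + ennreal 1"
    using assms by (intro add_mono) (auto simp: emeasure_eq_measure)
  finally show ?thesis by (simp flip: ennreal_plus ennreal_1)
qed

lemma lp_bound_lower_exponent:
  assumes "lp_bound q 1 u" "1 \<le> r" "r \<le> q"
  shows "lp_bound r ((measure M \<Omega> + 1) powr (1 / r)) u"
  using nn_integral_powr_lower_exponent[of "\<lambda>x. \<bar>u x\<bar>" r q] assms
  by (auto simp: lp_bound_def powr_powr)

text \<open>Smoothness is lowered for free because only distances up to R occur: the surplus power
  of the distance is at most \<open>R powr (\<sigma> - \<alpha>)\<close>.\<close>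

lemma hajlasz_lower_exponent:
  assumes u: "hajlasz R \<sigma> q 1 u" and r: "1 \<le> r" "r \<le> q" and \<alpha>: "\<alpha> \<le> \<sigma>" and R: "0 < R"
  shows "hajlasz R \<alpha> r (R powr (\<sigma> - \<alpha>) * (measure M \<Omega> + 1) powr (1 / r)) u"
proof -
  obtain G Z where G [measurable]: "G \<in> borel_measurable M" and G': "\<And>x. 0 \<le> G x"
    "(\<integral>\<^sup>+x. ennreal (G x powr q) \<partial>M) \<le> ennreal (1 powr q)" "AE x in M. x \<in> Z" "Z \<subseteq> \<Omega>"
    "\<And>x y. x \<in> Z \<Longrightarrow> y \<in> Z \<Longrightarrow> dist x y \<le> R \<Longrightarrow> \<bar>u x - u y\<bar> \<le> dist x y powr \<sigma> * (G x + G y)"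
    using hajlaszE[OF u] by blast
  let ?B = "R powr (\<sigma> - \<alpha>)"
  have "lp_bound r ((measure M \<Omega> + 1) powr (1 / r)) G"
    using lp_bound_lower_exponent[of q G r] r G' by (simp add: lp_bound_def)
  from lp_bound_scale[OF this, of ?B] have lpG: "lp_bound r (?B * (measure M \<Omega> + 1) powr (1 / r)) (\<lambda>x. ?B * G x)" by simp
  show ?thesis
  proof (rule hajlaszI[where G="\<lambda>x. ?B * G x" and Z=Z])
    show "(\<lambda>x. ?B * G x) \<in> borel_measurable M" by measurable
    show "(\<integral>\<^sup>+x. ennreal ((?B * G x) powr r) \<partial>M) \<le> ennreal ((?B * (measure M \<Omega> + 1) powr (1 / r)) powr r)"
      using lpG G' by (simp add: lp_bound_def)
    fix x y assume xy: "x \<in> Z" "y \<in> Z" "dist x y \<le> R" "x \<noteq> y"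
    have "dist x y powr \<sigma> = dist x y powr \<alpha> * dist x y powr (\<sigma> - \<alpha>)" by (simp flip: powr_add)
    also have "\<dots> \<le> dist x y powr \<alpha> * ?B" using xy \<alpha> by (intro mult_left_mono powr_mono2) auto
    finally have "dist x y powr \<sigma> * (G x + G y) \<le> dist x y powr \<alpha> * ?B * (G x + G y)"
      using G'(1)[of x] G'(1)[of y] by (intro mult_right_mono) auto
    then show "\<bar>u x - u y\<bar> \<le> dist x y powr \<alpha> * (?B * G x + ?B * G y)"
      using G'(5)[OF xy(1-3)] by (simp add: algebra_simps)
  qed (use G' in auto)
qed

section \<open>Chains of points: trading smoothness for integrability\<close>

text \<open>Here integrability is gained. Some a in the ball has G^q below average, so S = c
  \<rho>^N G(a)^q is at most the mass of G^q in the ball, which is at most 1 and at most \<rho>^(N -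
  d) Q, with Q the potential at x. From S \<le> 1 and q \<le> r follows S \<le> S^(q / r), and this
  produces the factor Q^(1 / r), which lies in \<open>L^r\<close> because Q is integrable in
  x.\<close>

lemma chain_point:
  assumes dens: "measure_density \<Omega> R c" and D: "0 < D" "D \<le> R"
    and q: "1 \<le> q" "q \<le> r" and d: "d = r * (\<sigma> - DIM('a) / q + DIM('a) / r - \<alpha>)"
    and G [measurable]: "G \<in> borel_measurable M" and G0: "\<And>x. 0 \<le> G x"
    and Gq: "(\<integral>\<^sup>+x. ennreal (G x powr q) \<partial>M) \<le> 1"
    and Z: "AE x in M. x \<in> Z" and x: "x \<in> \<Omega>"
    and P: "dyadic_potential M D d (\<lambda>y. ennreal (G y powr q)) x < \<infinity>"
  shows "\<exists>a\<in>Z \<inter> cball x (D / 2 ^ k). G a \<le> c powr (- 1 / q) * (D / 2 ^ k) powr (\<alpha> - \<sigma>)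
    * enn2real (dyadic_potential M D d (\<lambda>y. ennreal (G y powr q)) x) powr (1 / r)"
proof -
  let ?N = "real DIM('a)"
  define \<rho> where "\<rho> = D / 2 ^ k"
  define Q where "Q = enn2real (dyadic_potential M D d (\<lambda>y. ennreal (G y powr q)) x)"
  have Q: "0 \<le> Q" "dyadic_potential M D d (\<lambda>y. ennreal (G y powr q)) x = ennreal Q"
    using P by (auto simp: Q_def)
  have c: "0 < c" and R: "0 < R" using dens by (auto simp: measure_density_def)
  have "D / 2 ^ k \<le> D / 1" using D by (intro divide_left_mono) auto
  then have \<rho>: "0 < \<rho>" "\<rho> \<le> R" using D by (auto simp: \<rho>_def)
  have cd: "ennreal (c * \<rho> powr ?N) \<le> emeasure M (\<Omega> \<inter> cball x \<rho>)"
    using dens x \<rho> by (auto simp: measure_density_def)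
  obtain a where a: "a \<in> \<Omega> \<inter> cball x \<rho>" "a \<in> Z"
     "ennreal (c * \<rho> powr ?N) * ennreal (G a powr q) \<le> (\<integral>\<^sup>+y\<in>\<Omega> \<inter> cball x \<rho>. ennreal (G y powr q) \<partial>M)"
    using exists_point_below_average[OF _ sets_cball _ cd Z, of "\<lambda>y. ennreal (G y powr q)"] c \<rho> by auto
  define S where "S = c * \<rho> powr ?N * G a powr q"
  have S0: "0 \<le> S" using c by (simp add: S_def)
  have "ennreal S = ennreal (c * \<rho> powr ?N) * ennreal (G a powr q)"
    using c by (simp add: S_def ennreal_mult)
  also have "\<dots> \<le> (\<integral>\<^sup>+y\<in>\<Omega> \<inter> cball x \<rho>. ennreal (G y powr q) \<partial>M)" by (rule a(3))
  also have "\<dots> \<le> (\<integral>\<^sup>+y\<in>cball x \<rho>. ennreal (G y powr q) \<partial>M)"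
    by (auto intro!: nn_integral_mono split: split_indicator)
  finally have S: "ennreal S \<le> \<dots>" .
  have "ennreal S \<le> (\<integral>\<^sup>+y. ennreal (G y powr q) \<partial>M)"
    by (rule order_trans[OF S]) (auto intro!: nn_integral_mono split: split_indicator)
  with Gq have S1: "S \<le> 1" by (metis ennreal_le_1 order_trans)
  have "ennreal S \<le> ennreal (\<rho> powr (?N - d)) * ennreal Q"
    using S nn_integral_cball_le_dyadic_potential[OF D(1), where k=k and d=d and h="\<lambda>y. ennreal (G y powr q)" and x=x]
    by (simp only: \<rho>_def Q(2) order_trans)
  then have S2: "S \<le> \<rho> powr (?N - d) * Q" using Q by (simp flip: ennreal_mult)
  have "S = S powr 1" using S0 by simp
  \<comment> \<open>The step that depends on the normalisation of G: a number in [0, 1] grows when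
    its exponent decreases.\<close>
  also have "\<dots> \<le> S powr (q / r)" using S0 S1 q by (intro powr_mono') (auto simp: divide_le_eq)
  also have "\<dots> \<le> (\<rho> powr (?N - d) * Q) powr (q / r)" using S0 S2 q by (intro powr_mono2) auto
  also have "\<dots> = \<rho> powr ((?N - d) * (q / r)) * Q powr (q / r)"
    using Q \<rho> by (simp add: powr_mult powr_powr)
  finally have "G a powr q \<le> \<rho> powr ((?N - d) * (q / r)) * Q powr (q / r) / (c * \<rho> powr ?N)"
    using c \<rho> by (simp add: S_def pos_le_divide_eq mult.commute)
  also have "\<dots> = c powr (-1) * \<rho> powr ((?N - d) * (q / r) - ?N) * Q powr (q / r)"
    using c \<rho> by (simp add: powr_diff powr_minus_divide field_simps)
  finally have "G a \<le> (c powr (-1) * \<rho> powr ((?N - d) * (q / r) - ?N) * Q powr (q / r)) powr (1 / q)"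
    using G0 q by (intro powr_le_imp_le_powr) auto
  also have "\<dots> = c powr (- 1 / q) * \<rho> powr (((?N - d) * (q / r) - ?N) / q) * Q powr (1 / r)"
    unfolding powr_mult powr_powr using q by simp
  \<comment> \<open>The value of d is the one for which (N - d) / r - N / q collapses to \<alpha> -
    \<sigma>.\<close>
  also have "((?N - d) * (q / r) - ?N) / q = \<alpha> - \<sigma>"
    using q by (simp add: d field_simps)
  finally have "G a \<le> c powr (- 1 / q) * \<rho> powr (\<alpha> - \<sigma>) * Q powr (1 / r)" .
  then show ?thesis using a by (auto simp: Q_def \<rho>_def)
qed

text \<open>Telescoping along points that converge to x. The possible growth \<rho>^(\<alpha> -
  \<sigma>) of G at the chosen points is compensated by the power \<sigma> of the distance, so each
  increment is of order \<rho>^\<alpha> Q. The last link, to x itself, uses the finite value G x and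
  vanishes in the limit; continuity of u at x is not involved.\<close>

lemma chain_limit:
  fixes D :: real
  assumes D: "0 < D" "2 * D \<le> R" and \<alpha>: "0 < \<alpha>" "\<alpha> \<le> \<sigma>" and KQ: "0 \<le> K" "0 \<le> Q"
    and u: "\<And>x y. x \<in> Z \<Longrightarrow> y \<in> Z \<Longrightarrow> dist x y \<le> R \<Longrightarrow> \<bar>u x - u y\<bar> \<le> dist x y powr \<sigma> * (G x + G y)"
    and G0: "\<And>x. 0 \<le> G x"
    and x: "x \<in> Z" and a: "\<And>k. a k \<in> Z" "\<And>k. dist x (a k) \<le> D / 2 ^ k"
      "\<And>k. G (a k) \<le> K * (D / 2 ^ k) powr (\<alpha> - \<sigma>) * Q"
  shows "\<bar>u x - u (a j)\<bar> \<le> 2 powr \<sigma> * (1 + 2 powr \<sigma>) * K / (1 - 2 powr (- \<alpha>)) * (D / 2 ^ j) powr \<alpha> * Q"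
proof -
  define \<rho> where "\<rho> k = D / 2 ^ k" for k :: nat
  have \<rho>0: "0 < \<rho> k" for k using D by (simp add: \<rho>_def)
  have \<rho>D: "\<rho> k \<le> D" for k
  proof -
    have "D / 2 ^ k \<le> D / 1" using D by (intro divide_left_mono) auto
    then show ?thesis by (simp add: \<rho>_def)
  qed
  have \<rho>S: "\<rho> (Suc k) = \<rho> k / 2" for k by (simp add: \<rho>_def)
  have lt1: "2 powr (- \<alpha>) < 1" using \<alpha> powr_less_mono[of "- \<alpha>" 0 2] by simp
  define K2 where "K2 = 2 powr \<sigma> * (1 + 2 powr \<sigma>) * K"
  define K3 where "K3 = K2 / (1 - 2 powr (- \<alpha>))"
  have K2: "0 \<le> K2" using KQ by (simp add: K2_def)
  have GS: "G (a (Suc k)) \<le> 2 powr \<sigma> * (K * \<rho> k powr (\<alpha> - \<sigma>) * Q)" for k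
  proof -
    have "G (a (Suc k)) \<le> K * \<rho> (Suc k) powr (\<alpha> - \<sigma>) * Q" using a(3)[of "Suc k"] by (simp add: \<rho>_def)
    also have "\<rho> (Suc k) powr (\<alpha> - \<sigma>) = 2 powr (\<sigma> - \<alpha>) * \<rho> k powr (\<alpha> - \<sigma>)"
    proof -
      have "2 powr (\<sigma> - \<alpha>) = 1 / 2 powr (\<alpha> - \<sigma>)" using powr_minus_divide[of 2 "\<alpha> - \<sigma>"] by simp
      then show ?thesis unfolding \<rho>S powr_divide by simp
    qed
    also have "K * (2 powr (\<sigma> - \<alpha>) * \<rho> k powr (\<alpha> - \<sigma>)) * Q = 2 powr (\<sigma> - \<alpha>) * (K * \<rho> k powr (\<alpha> - \<sigma>) * Q)" by simp
    also have "\<dots> \<le> 2 powr \<sigma> * (K * \<rho> k powr (\<alpha> - \<sigma>) * Q)"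
      using KQ \<alpha> by (intro mult_right_mono powr_mono) auto
    finally show ?thesis .
  qed
  \<comment> \<open>Since \<rho>^\<alpha> shrinks by the factor 2^(-\<alpha>) from one scale to the
    next, the increment can be written as a difference of consecutive powers, and the sum over the
    chain collapses.\<close>
  have step: "\<bar>u (a k) - u (a (Suc k))\<bar> \<le> K3 * Q * (\<rho> k powr \<alpha> - \<rho> (Suc k) powr \<alpha>)" for k
  proof -
    have "dist (a k) (a (Suc k)) \<le> dist x (a k) + dist x (a (Suc k))" by (rule dist_triangle3)
    also have "\<dots> \<le> \<rho> k + \<rho> (Suc k)" using a(2)[of k] a(2)[of "Suc k"] by (simp add: \<rho>_def)
    also have "\<dots> \<le> 2 * \<rho> k" using \<rho>0[of k] by (simp add: \<rho>S)
    finally have d: "dist (a k) (a (Suc k)) \<le> 2 * \<rho> k" .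
    then have "\<bar>u (a k) - u (a (Suc k))\<bar> \<le> dist (a k) (a (Suc k)) powr \<sigma> * (G (a k) + G (a (Suc k)))"
      using \<rho>D[of k] D by (intro u a) auto
    also have "\<dots> \<le> (2 * \<rho> k) powr \<sigma> * (K * \<rho> k powr (\<alpha> - \<sigma>) * Q + 2 powr \<sigma> * (K * \<rho> k powr (\<alpha> - \<sigma>) * Q))"
      using d \<alpha> G0 GS[of k] a(3)[of k] by (intro mult_mono powr_mono2 add_mono) (auto simp: \<rho>_def)
    also have "\<dots> = K2 * (\<rho> k powr \<sigma> * \<rho> k powr (\<alpha> - \<sigma>)) * Q"
      using \<rho>0[of k] by (simp add: K2_def powr_mult algebra_simps)
    also have "\<rho> k powr \<sigma> * \<rho> k powr (\<alpha> - \<sigma>) = \<rho> k powr \<alpha>" by (simp flip: powr_add)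
    also have "K2 * \<rho> k powr \<alpha> * Q = K3 * Q * (\<rho> k powr \<alpha> - \<rho> (Suc k) powr \<alpha>)"
    proof -
      define m where "m = 2 powr (- \<alpha>)"
      have "\<rho> (Suc k) powr \<alpha> = \<rho> k powr \<alpha> * m" unfolding \<rho>S powr_divide m_def powr_minus_divide by simp
      then have "\<rho> k powr \<alpha> - \<rho> (Suc k) powr \<alpha> = \<rho> k powr \<alpha> * (1 - m)" by (simp add: algebra_simps)
      moreover have "m \<noteq> 1" using lt1 \<alpha> by (simp add: m_def)
      ultimately show ?thesis unfolding K3_def m_def[symmetric] by simp
    qed
    finally show ?thesis .
  qed
  have tele: "\<bar>u (a j) - u (a (j + n))\<bar> \<le> K3 * Q * (\<rho> j powr \<alpha> - \<rho> (j + n) powr \<alpha>)" for n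
  proof (induction n)
    case (Suc n)
    then show ?case using step[of "j + n"] by (simp add: algebra_simps)
  qed simp
  have K3: "0 \<le> K3 * Q" using K2 KQ lt1 by (simp add: K3_def)
  \<comment> \<open>The chain is stopped at index j + n; the terms in parentheses belong to the last
    link and tend to 0 with growing n.\<close>
  have bound: "\<bar>u x - u (a j)\<bar> \<le> K3 * Q * \<rho> j powr \<alpha> + (\<rho> (j + n) powr \<sigma> * G x + K * Q * \<rho> (j + n) powr \<alpha>)" for n
  proof -
    let ?m = "j + n"
    have "\<bar>u x - u (a ?m)\<bar> \<le> dist x (a ?m) powr \<sigma> * (G x + G (a ?m))"
      using a(2)[of ?m] \<rho>D[of ?m] D by (intro u a x) (auto simp: \<rho>_def)
    also have "\<dots> \<le> \<rho> ?m powr \<sigma> * (G x + K * \<rho> ?m powr (\<alpha> - \<sigma>) * Q)"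
      using a(2,3)[of ?m] G0 \<alpha> by (intro mult_mono powr_mono2 add_mono) (auto simp: \<rho>_def)
    also have "\<dots> = \<rho> ?m powr \<sigma> * G x + K * Q * (\<rho> ?m powr \<sigma> * \<rho> ?m powr (\<alpha> - \<sigma>))" by (simp add: algebra_simps)
    also have "\<rho> ?m powr \<sigma> * \<rho> ?m powr (\<alpha> - \<sigma>) = \<rho> ?m powr \<alpha>" by (simp flip: powr_add)
    finally have "\<bar>u x - u (a ?m)\<bar> \<le> \<rho> ?m powr \<sigma> * G x + K * Q * \<rho> ?m powr \<alpha>" .
    moreover have "K3 * Q * (\<rho> j powr \<alpha> - \<rho> ?m powr \<alpha>) \<le> K3 * Q * \<rho> j powr \<alpha>" using K3 by (intro mult_left_mono) auto
    ultimately show ?thesis using tele[of n] by linarith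
  qed
  have lim: "(\<lambda>n. \<rho> (j + n) powr e) \<longlonglongrightarrow> 0" if "0 < e" for e
  proof -
    have "(\<lambda>n. \<rho> n powr e) \<longlonglongrightarrow> 0" unfolding \<rho>_def using D(1) that by (intro summable_LIMSEQ_zero summable_dyadic_powr)
    then show ?thesis by (subst add.commute) (rule LIMSEQ_ignore_initial_segment)
  qed
  have "(\<lambda>n. K3 * Q * \<rho> j powr \<alpha> + (\<rho> (j + n) powr \<sigma> * G x + K * Q * \<rho> (j + n) powr \<alpha>))
     \<longlonglongrightarrow> K3 * Q * \<rho> j powr \<alpha> + (0 * G x + K * Q * 0)"
    using \<alpha> by (intro tendsto_intros lim) auto
  then have "\<bar>u x - u (a j)\<bar> \<le> K3 * Q * \<rho> j powr \<alpha>"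
    using bound by (intro LIMSEQ_le_const[where X="\<lambda>n. K3 * Q * \<rho> j powr \<alpha> + (\<rho> (j + n) powr \<sigma> * G x + K * Q * \<rho> (j + n) powr \<alpha>)"]) auto
  then show ?thesis by (simp add: K3_def K2_def \<rho>_def mult_ac)
qed

end

lemma ennreal_enn2real_le: "ennreal (enn2real x) \<le> x"
  by (cases x) auto

context bounded_domain
begin

text \<open>A Sobolev embedding for Hajlasz gradients with strict loss. Two points at distance about
  \<rho> are joined through chain points a and b of scale \<rho>. Both chains and the middle step
  from a to b contribute \<rho>^\<alpha> (Q x + Q y), where Q is the r-th root of the
  potential.\<close>

lemma hajlasz_improve:
  assumes dens: "measure_density \<Omega> R c" and q: "1 \<le> q" "q \<le> r" and \<alpha>: "0 < \<alpha>"
    and gap: "\<alpha> - DIM('a) / r < \<sigma> - DIM('a) / q"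
  obtains C where "0 \<le> C" "\<And>u. hajlasz R \<sigma> q 1 u \<Longrightarrow> hajlasz (R / 3) \<alpha> r C u"
proof -
  let ?N = "real DIM('a)"
  have R: "0 < R" and c: "0 < c" using dens by (auto simp: measure_density_def)
  \<comment> \<open>The points a and b below are at most 3 \<rho> \<le> 3 D apart, and the
    hypothesis on u reaches up to distance R.\<close>
  define D where "D = R / 3"
  have D: "0 < D" "D \<le> R" "2 * D \<le> R" using R by (auto simp: D_def)
  \<comment> \<open>Positive precisely because the gap is strict.\<close>
  define d where "d = r * (\<sigma> - ?N / q + ?N / r - \<alpha>)"
  have d: "0 < d" using gap q by (simp add: d_def)
  have "?N / r \<le> ?N / q" using q by (intro divide_left_mono) auto
  then have \<alpha>\<sigma>: "\<alpha> \<le> \<sigma>" "0 < \<sigma>" using gap \<alpha> by auto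
  obtain CP where CP: "0 \<le> CP" "\<And>h. h \<in> borel_measurable M \<Longrightarrow>
    (\<integral>\<^sup>+x. dyadic_potential M D d h x \<partial>M) \<le> ennreal CP * (\<integral>\<^sup>+x. h x \<partial>M)"
    using nn_integral_dyadic_potential_le[OF D(1) d] by blast
  define K where "K = c powr (- 1 / q)"
  define K3 where "K3 = 2 powr \<sigma> * (1 + 2 powr \<sigma>) * K / (1 - 2 powr (- \<alpha>))"
  define K4 where "K4 = (K3 + 3 powr \<sigma> * K) * 2 powr \<alpha>"
  have K: "0 \<le> K" by (simp add: K_def)
  have "2 powr (- \<alpha>) < 1" using \<alpha> powr_less_mono[of "- \<alpha>" 0 2] by simp
  then have K3: "0 \<le> K3" using K by (simp add: K3_def)
  then have K4: "0 \<le> K4" using K by (simp add: K4_def)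
  have "hajlasz (R / 3) \<alpha> r (K4 * CP powr (1 / r)) u" if u: "hajlasz R \<sigma> q 1 u" for u
  proof -
    obtain G Z where G [measurable]: "G \<in> borel_measurable M" and G': "\<And>x. 0 \<le> G x"
      "(\<integral>\<^sup>+x. ennreal (G x powr q) \<partial>M) \<le> ennreal (1 powr q)" "AE x in M. x \<in> Z" "Z \<subseteq> \<Omega>"
      "\<And>x y. x \<in> Z \<Longrightarrow> y \<in> Z \<Longrightarrow> dist x y \<le> R \<Longrightarrow> \<bar>u x - u y\<bar> \<le> dist x y powr \<sigma> * (G x + G y)"
      using hajlaszE[OF u] by blast
    define P where "P = dyadic_potential M D d (\<lambda>y. ennreal (G y powr q))"
    have P [measurable]: "P \<in> borel_measurable M" unfolding P_def by measurable
    have "(\<integral>\<^sup>+x. P x \<partial>M) \<le> ennreal CP * (\<integral>\<^sup>+x. ennreal (G x powr q) \<partial>M)" unfolding P_def by (rule CP) measurable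
    also have "\<dots> \<le> ennreal CP * 1" using G'(2) by (intro mult_left_mono) auto
    finally have intP: "(\<integral>\<^sup>+x. P x \<partial>M) \<le> ennreal CP" by simp
    then have "(\<integral>\<^sup>+x. P x \<partial>M) \<noteq> \<infinity>" by (auto simp: top_unique)
    then have AEP: "AE x in M. P x \<noteq> \<infinity>" using P by (intro nn_integral_PInf_AE) auto
    define Q where "Q x = enn2real (P x) powr (1 / r)" for x
    have Q: "0 \<le> Q x" for x by (simp add: Q_def)
    \<comment> \<open>Outside Y, a null set, the potential is infinite and its real value is the
      meaningless default 0.\<close>
    define Y where "Y = {x \<in> Z. P x \<noteq> \<infinity>}"
    show ?thesis
    proof (rule hajlaszI[where G="\<lambda>x. K4 * Q x" and Z=Y])
      show "(\<lambda>x. K4 * Q x) \<in> borel_measurable M" unfolding Q_def by measurable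
      show "0 \<le> K4 * Q x" for x using K4 Q by simp
      show "AE x in M. x \<in> Y" using AEP G'(3) by (auto simp: Y_def)
      have "(\<integral>\<^sup>+x. ennreal ((K4 * Q x) powr r) \<partial>M) \<le> (\<integral>\<^sup>+x. ennreal (K4 powr r) * P x \<partial>M)"
      proof (intro nn_integral_mono)
        fix x
        have "ennreal ((K4 * Q x) powr r) = ennreal (K4 powr r) * ennreal (enn2real (P x))"
          using q by (simp add: powr_mult Q_def powr_powr ennreal_mult)
        also have "\<dots> \<le> ennreal (K4 powr r) * P x" by (intro mult_left_mono ennreal_enn2real_le) auto
        finally show "ennreal ((K4 * Q x) powr r) \<le> ennreal (K4 powr r) * P x" .
      qed
      also have "\<dots> = ennreal (K4 powr r) * (\<integral>\<^sup>+x. P x \<partial>M)" by (rule nn_integral_cmult) measurable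
      also have "\<dots> \<le> ennreal (K4 powr r) * ennreal CP" using intP by (intro mult_left_mono) auto
      also have "\<dots> = ennreal ((K4 * CP powr (1 / r)) powr r)"
        using q CP(1) by (simp add: powr_mult powr_powr ennreal_mult)
      finally show "(\<integral>\<^sup>+x. ennreal ((K4 * Q x) powr r) \<partial>M) \<le> ennreal ((K4 * CP powr (1 / r)) powr r)" .
      fix x y assume xy: "x \<in> Y" "y \<in> Y" "x \<noteq> y" "dist x y \<le> R / 3"
      then obtain j where j: "D / 2 ^ Suc j < dist x y" "dist x y \<le> D / 2 ^ j"
        using dyadic_scale[of "dist x y" D] by (auto simp: D_def)
      define \<rho> where "\<rho> = D / 2 ^ j"
      have "D / 2 ^ j \<le> D / 1" using D by (intro divide_left_mono) auto
      then have \<rho>: "0 < \<rho>" "\<rho> \<le> D" using D by (auto simp: \<rho>_def)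
      have chain: "\<exists>a\<in>Z. dist z a \<le> \<rho> \<and> G a \<le> K * \<rho> powr (\<alpha> - \<sigma>) * Q z \<and> \<bar>u z - u a\<bar> \<le> K3 * \<rho> powr \<alpha> * Q z"
        if z: "z \<in> Y" for z
      proof -
        have "\<exists>a\<in>Z \<inter> cball z (D / 2 ^ k). G a \<le> K * (D / 2 ^ k) powr (\<alpha> - \<sigma>) * Q z" for k
          unfolding K_def Q_def P_def
          using z G' P by (intro chain_point[OF dens D(1,2) q d_def G G'(1) _ G'(3)]) (auto simp: Y_def P_def less_top)
        then obtain a where a: "\<And>k. a k \<in> Z" "\<And>k. dist z (a k) \<le> D / 2 ^ k" "\<And>k. G (a k) \<le> K * (D / 2 ^ k) powr (\<alpha> - \<sigma>) * Q z"
          by (metis IntE mem_cball)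
        have "\<bar>u z - u (a j)\<bar> \<le> K3 * \<rho> powr \<alpha> * Q z"
          unfolding K3_def \<rho>_def
          by (rule chain_limit[OF D(1,3) \<alpha> \<alpha>\<sigma>(1) K Q G'(5) G'(1) _ a]) (use z in \<open>auto simp: Y_def\<close>)
        then show ?thesis using a(1)[of j] a(2)[of j] a(3)[of j] by (auto simp: \<rho>_def)
      qed
      obtain a where a: "a \<in> Z" "dist x a \<le> \<rho>" "G a \<le> K * \<rho> powr (\<alpha> - \<sigma>) * Q x" "\<bar>u x - u a\<bar> \<le> K3 * \<rho> powr \<alpha> * Q x"
        using chain[OF xy(1)] by blast
      obtain b where b: "b \<in> Z" "dist y b \<le> \<rho>" "G b \<le> K * \<rho> powr (\<alpha> - \<sigma>) * Q y" "\<bar>u y - u b\<bar> \<le> K3 * \<rho> powr \<alpha> * Q y"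
        using chain[OF xy(2)] by blast
      have "dist a b \<le> dist x a + (dist x y + dist y b)"
        using dist_triangle3[of a b x] dist_triangle[of x b y] by linarith
      also have "\<dots> \<le> 3 * \<rho>" using a b j by (simp add: \<rho>_def)
      finally have ab: "dist a b \<le> 3 * \<rho>" .
      have "\<bar>u a - u b\<bar> \<le> dist a b powr \<sigma> * (G a + G b)"
        using ab \<rho> by (intro G' a b) (auto simp: D_def)
      also have "\<dots> \<le> (3 * \<rho>) powr \<sigma> * (K * \<rho> powr (\<alpha> - \<sigma>) * Q x + K * \<rho> powr (\<alpha> - \<sigma>) * Q y)"
        using ab a b G' \<alpha>\<sigma> by (intro mult_mono powr_mono2 add_mono) auto
      also have "\<dots> = 3 powr \<sigma> * K * (\<rho> powr \<sigma> * \<rho> powr (\<alpha> - \<sigma>)) * (Q x + Q y)"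
        by (simp add: powr_mult algebra_simps)
      also have "\<rho> powr \<sigma> * \<rho> powr (\<alpha> - \<sigma>) = \<rho> powr \<alpha>" by (simp flip: powr_add)
      finally have "\<bar>u a - u b\<bar> \<le> 3 powr \<sigma> * K * \<rho> powr \<alpha> * (Q x + Q y)" .
      then have "\<bar>u x - u y\<bar> \<le> (K3 + 3 powr \<sigma> * K) * \<rho> powr \<alpha> * (Q x + Q y)"
        using a(4) b(4) by (simp add: algebra_simps)
      also have "\<dots> \<le> (K3 + 3 powr \<sigma> * K) * (2 * dist x y) powr \<alpha> * (Q x + Q y)"
        using j \<rho> K K3 Q \<alpha> by (intro mult_right_mono mult_left_mono powr_mono2) (auto simp: \<rho>_def)
      also have "\<dots> = dist x y powr \<alpha> * (K4 * Q x + K4 * Q y)"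
        by (simp add: powr_mult K4_def algebra_simps)
      finally show "\<bar>u x - u y\<bar> \<le> dist x y powr \<alpha> * (K4 * Q x + K4 * Q y)" .
    qed
  qed
  moreover have "0 \<le> K4 * CP powr (1 / r)" using K4 by simp
  ultimately show ?thesis using that by blast
qed

text \<open>A Poincare-type argument at the fixed scale R: u x is compared with u b at a point b
  where G^r and |u|^q are below average together. The value u b is then bounded by a constant, so
  the integrability of u is inherited from G and no longer limited by q.\<close>

lemma hajlasz_lp_improve:
  assumes dens: "measure_density \<Omega> R c" and q: "1 \<le> q" and r: "1 \<le> r"
  and \<alpha>: "0 \<le> \<alpha>"
  obtains C where "0 \<le> C" "\<And>u. hajlasz R \<alpha> r 1 u \<Longrightarrow> lp_bound q 1 u \<Longrightarrow> lp_bound r C u"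
proof -
  let ?N = "real DIM('a)"
  have R: "0 < R" and c: "0 < c" using dens by (auto simp: measure_density_def)
  \<comment> \<open>The numerator 2 is the sum of the two normalised integrals.\<close>
  define T where "T = 2 / (c * R powr ?N)"
  have T: "0 < T" "c * R powr ?N * T = 2" using c R by (auto simp: T_def)
  define B where "B = R powr \<alpha>"
  define L where "L = T powr (1 / q) + B * T powr (1 / r)"
  have L: "0 \<le> L" by (simp add: L_def B_def)
  define C where "C = (2 powr r * (L powr r * measure M \<Omega> + B powr r)) powr (1 / r)"
  show ?thesis
  proof (rule that[of C])
    show "0 \<le> C" by (simp add: C_def)
    fix u assume u: "hajlasz R \<alpha> r 1 u" and lp: "lp_bound q 1 u"
    have um [measurable]: "u \<in> borel_measurable M" using lp by (simp add: lp_bound_def)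
    obtain G Z where G [measurable]: "G \<in> borel_measurable M" and G': "\<And>x. 0 \<le> G x"
      "(\<integral>\<^sup>+x. ennreal (G x powr r) \<partial>M) \<le> ennreal (1 powr r)" "AE x in M. x \<in> Z" "Z \<subseteq> \<Omega>"
      "\<And>x y. x \<in> Z \<Longrightarrow> y \<in> Z \<Longrightarrow> dist x y \<le> R \<Longrightarrow> \<bar>u x - u y\<bar> \<le> dist x y powr \<alpha> * (G x + G y)"
      using hajlaszE[OF u] by blast
    have uG: "\<bar>u x\<bar> \<le> L + B * G x" if x: "x \<in> Z" for x
    proof -
      let ?f = "\<lambda>y. ennreal (G y powr r + \<bar>u y\<bar> powr q)"
      have cd: "ennreal (c * R powr ?N) \<le> emeasure M (\<Omega> \<inter> cball x R)"
        using dens x G'(4) R by (auto simp: measure_density_def)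
      obtain b where b: "b \<in> \<Omega> \<inter> cball x R" "b \<in> Z" "ennreal (c * R powr ?N) * ?f b \<le> (\<integral>\<^sup>+y\<in>\<Omega> \<inter> cball x R. ?f y \<partial>M)"
        using exists_point_below_average[OF _ sets_cball _ cd G'(3), of ?f] c R by auto
      note b(3)
      also have "(\<integral>\<^sup>+y\<in>\<Omega> \<inter> cball x R. ?f y \<partial>M) \<le> (\<integral>\<^sup>+y. ennreal (G y powr r) + ennreal (\<bar>u y\<bar> powr q) \<partial>M)"
        by (intro nn_integral_mono) (auto split: split_indicator)
      also have "\<dots> = (\<integral>\<^sup>+y. ennreal (G y powr r) \<partial>M) + (\<integral>\<^sup>+y. ennreal (\<bar>u y\<bar> powr q) \<partial>M)"
        by (rule nn_integral_add) measurable
      also have "\<dots> \<le> ennreal 1 + ennreal 1" using G'(2) lp by (intro add_mono) (auto simp: lp_bound_def)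
      finally have "ennreal (c * R powr ?N * (G b powr r + \<bar>u b\<bar> powr q)) \<le> ennreal 2"
        using c by (simp add: ennreal_mult flip: ennreal_1 ennreal_plus)
      then have "c * R powr ?N * (G b powr r + \<bar>u b\<bar> powr q) \<le> c * R powr ?N * T"
        unfolding T(2) by (subst (asm) ennreal_le_iff) auto
      then have bT: "G b powr r + \<bar>u b\<bar> powr q \<le> T" using c R by (simp add: mult_le_cancel_left_pos)
      have "G b powr r \<le> T" "\<bar>u b\<bar> powr q \<le> T"
        using bT powr_ge_zero[of "G b" r] powr_ge_zero[of "\<bar>u b\<bar>" q] by linarith+
      then have GT: "G b \<le> T powr (1 / r)" and uT: "\<bar>u b\<bar> \<le> T powr (1 / q)"
        using q r G'(1) by (auto intro: powr_le_imp_le_powr)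
      show ?thesis
      proof (cases "x = b")
        case True
        then show ?thesis using uT G'(1)[of x] by (simp add: L_def B_def add_increasing2)
      next
        case False
        show ?thesis
        proof (cases "0 \<le> \<alpha>")
          case True
          have "\<bar>u x - u b\<bar> \<le> dist x b powr \<alpha> * (G x + G b)" using b x by (intro G') auto
          also have "\<dots> \<le> B * (G x + T powr (1 / r))"
            unfolding B_def using b G'(1) GT True by (intro mult_mono powr_mono2 add_mono) auto
          finally show ?thesis using uT by (simp add: L_def algebra_simps)
        qed (use \<open>0 \<le> \<alpha>\<close> in auto)
      qed
    qed
    show "lp_bound r C u"
    proof (rule lp_boundI)
      have "(\<integral>\<^sup>+x. ennreal (\<bar>u x\<bar> powr r) \<partial>M) \<le> (\<integral>\<^sup>+x. ennreal ((L + B * G x) powr r) \<partial>M)"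
        using G'(3) uG r by (intro nn_integral_mono_AE) (auto elim!: eventually_mono intro!: ennreal_leI powr_mono2)
      also have "\<dots> \<le> ennreal (2 powr r) * ((\<integral>\<^sup>+x. ennreal (L powr r) \<partial>M) + (\<integral>\<^sup>+x. ennreal ((B * G x) powr r) \<partial>M))"
        using r L G' by (intro nn_integral_powr_add_le) (auto simp: B_def)
      also have "(\<integral>\<^sup>+x. ennreal (L powr r) \<partial>M) = ennreal (L powr r * measure M \<Omega>)"
        by (simp add: emeasure_eq_measure ennreal_mult)
      also have "ennreal (2 powr r) * (ennreal (L powr r * measure M \<Omega>) + (\<integral>\<^sup>+x. ennreal ((B * G x) powr r) \<partial>M))
        \<le> ennreal (2 powr r) * (ennreal (L powr r * measure M \<Omega>) + ennreal (B powr r))"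
        using lp_bound_scale[of r 1 G B] G' by (intro mult_left_mono add_left_mono) (simp_all add: lp_bound_def B_def)
      finally show "(\<integral>\<^sup>+x. ennreal (\<bar>u x\<bar> powr r) \<partial>M) \<le> ennreal (C powr r)"
        using r by (simp add: C_def powr_powr add_nonneg_nonneg flip: ennreal_plus ennreal_mult)
    qed (rule um)
  qed
qed

text \<open>The candidate for G x is a multiple of the q-th root of f x, the inner integral of the
  energy. Some z near x makes |u x - u z|^q + |u y - u z|^q at most its average. All distances are
  at most 2 \<rho>, so passing to the energy integrand costs (2 \<rho>)^e, and division by the
  volume c \<rho>^N leaves \<rho>^(\<sigma> q).\<close>

lemma gagliardo_hajlasz:
  assumes dens: "measure_density \<Omega> R c" and q: "1 \<le> q" and \<sigma>: "0 < \<sigma>"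
  obtains C where "0 \<le> C" "\<And>u. u \<in> borel_measurable M \<Longrightarrow> gagliardo_energy \<Omega> \<sigma> q u \<le> 1 \<Longrightarrow> hajlasz R \<sigma> q C u"
proof -
  let ?N = "real DIM('a)"
  have R: "0 < R" and c: "0 < c" using dens by (auto simp: measure_density_def)
  define e where "e = ?N + \<sigma> * q"
  have e: "0 < e" using \<sigma> q by (simp add: e_def add_pos_pos)
  define K1 where "K1 = 2 powr e / c"
  have K1: "0 < K1" using c by (simp add: K1_def)
  \<comment> \<open>Each half of the triangle inequality through z contributes K / 2; the remaining
    factor 2 pays for splitting the q-th root of a + b.\<close>
  define K where "K = 4 * K1 powr (1 / q)"
  have K: "0 \<le> K" by (simp add: K_def)
  show ?thesis
  proof (rule that[OF K])
    fix u assume [measurable]: "u \<in> borel_measurable M" and energy: "gagliardo_energy \<Omega> \<sigma> q u \<le> 1"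
    define F where "F x y = ennreal (\<bar>u x - u y\<bar> powr q / norm (x - y) powr e)" for x y
    have F [measurable]: "case_prod F \<in> borel_measurable (M \<Otimes>\<^sub>M M)" unfolding F_def by measurable
    define f where "f x = (\<integral>\<^sup>+y. F x y \<partial>M)" for x
    have [measurable]: "f \<in> borel_measurable M" unfolding f_def by measurable
    have "(\<integral>\<^sup>+x. f x \<partial>M) = integral\<^sup>N (M \<Otimes>\<^sub>M M) (case_prod F)"
      using nn_integral_fst[OF F] by (simp add: f_def)
    also have "\<dots> = gagliardo_energy \<Omega> \<sigma> q u"
      by (simp add: gagliardo_energy_def F_def[abs_def] e_def)
    finally have "(\<integral>\<^sup>+x. f x \<partial>M) = gagliardo_energy \<Omega> \<sigma> q u" .
    with energy have intf: "(\<integral>\<^sup>+x. f x \<partial>M) \<le> 1" by simp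
    then have "(\<integral>\<^sup>+x. f x \<partial>M) \<noteq> \<infinity>" by (auto simp: top_unique)
    then have AEf: "AE x in M. f x \<noteq> \<infinity>" by (intro nn_integral_PInf_AE) auto
    define Z where "Z = {x \<in> \<Omega>. f x \<noteq> \<infinity>}"
    define G where "G x = K * enn2real (f x) powr (1 / q)" for x
    show "hajlasz R \<sigma> q K u"
    proof (rule hajlaszI[where G=G and Z=Z])
      show "G \<in> borel_measurable M" unfolding G_def by measurable
      show "0 \<le> G x" for x using K by (simp add: G_def)
      show Z: "AE x in M. x \<in> Z"
        unfolding Z_def using AEf by (rule AE_mp) (auto intro!: AE_I2)
      have "(\<integral>\<^sup>+x. ennreal (G x powr q) \<partial>M) \<le> (\<integral>\<^sup>+x. ennreal (K powr q) * f x \<partial>M)"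
      proof (intro nn_integral_mono)
        fix x
        have "ennreal (G x powr q) = ennreal (K powr q) * ennreal (enn2real (f x))"
          using q by (simp add: powr_mult G_def powr_powr ennreal_mult)
        also have "\<dots> \<le> ennreal (K powr q) * f x" by (intro mult_left_mono ennreal_enn2real_le) auto
        finally show "ennreal (G x powr q) \<le> ennreal (K powr q) * f x" .
      qed
      also have "\<dots> = ennreal (K powr q) * (\<integral>\<^sup>+x. f x \<partial>M)" by (rule nn_integral_cmult) measurable
      also have "\<dots> \<le> ennreal (K powr q) * 1" using intf by (intro mult_left_mono) auto
      finally show "(\<integral>\<^sup>+x. ennreal (G x powr q) \<partial>M) \<le> ennreal (K powr q)" by simp
      fix x y assume x: "x \<in> Z" and y: "y \<in> Z" and xy: "x \<noteq> y" "dist x y \<le> R"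
      define \<rho> where "\<rho> = dist x y"
      have \<rho>: "0 < \<rho>" "\<rho> \<le> R" using xy by (auto simp: \<rho>_def)
      define a where "a = enn2real (f x)"
      define b where "b = enn2real (f y)"
      have ab: "f x = ennreal a" "f y = ennreal b" "0 \<le> a" "0 \<le> b"
        using x y by (auto simp: Z_def a_def b_def less_top)
      have F_ge: "ennreal (\<bar>u z - u w\<bar> powr q) \<le> ennreal ((2 * \<rho>) powr e) * F z w" if "dist z w \<le> 2 * \<rho>" for z w
      proof (cases "z = w")
        case False
        have "\<bar>u z - u w\<bar> powr q = norm (z - w) powr e * (\<bar>u z - u w\<bar> powr q / norm (z - w) powr e)"
          using False by simp
        also have "\<dots> \<le> (2 * \<rho>) powr e * (\<bar>u z - u w\<bar> powr q / norm (z - w) powr e)"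
          using that e by (intro mult_right_mono powr_mono2) (auto simp: dist_norm)
        finally show ?thesis by (simp add: F_def ennreal_leI flip: ennreal_mult)
      qed simp
      \<comment> \<open>The sum is averaged so that one and the same z is good for x and for
        y.\<close>
      let ?g = "\<lambda>z. ennreal (\<bar>u x - u z\<bar> powr q + \<bar>u y - u z\<bar> powr q)"
      have cd: "ennreal (c * \<rho> powr ?N) \<le> emeasure M (\<Omega> \<inter> cball x \<rho>)"
        using dens x \<rho> by (auto simp: measure_density_def Z_def)
      obtain z where z: "z \<in> \<Omega> \<inter> cball x \<rho>" "ennreal (c * \<rho> powr ?N) * ?g z \<le> (\<integral>\<^sup>+w\<in>\<Omega> \<inter> cball x \<rho>. ?g w \<partial>M)"
        using exists_point_below_average[OF _ sets_cball _ cd Z, of ?g] c \<rho> by auto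
      note z(2)
      also have "(\<integral>\<^sup>+w\<in>\<Omega> \<inter> cball x \<rho>. ?g w \<partial>M)
        \<le> (\<integral>\<^sup>+w. ennreal ((2 * \<rho>) powr e) * (F x w + F y w) \<partial>M)"
      proof (intro nn_integral_mono)
        fix w
        show "?g w * indicator (\<Omega> \<inter> cball x \<rho>) w \<le> ennreal ((2 * \<rho>) powr e) * (F x w + F y w)"
        proof (cases "w \<in> \<Omega> \<inter> cball x \<rho>")
          case True
          then have "dist x w \<le> 2 * \<rho>" "dist y w \<le> 2 * \<rho>"
            using \<rho> dist_triangle3[of y w x] zero_le_dist[of x y] by (auto simp: \<rho>_def simp del: zero_le_dist)
          then have "ennreal (\<bar>u x - u w\<bar> powr q) + ennreal (\<bar>u y - u w\<bar> powr q)
             \<le> ennreal ((2 * \<rho>) powr e) * F x w + ennreal ((2 * \<rho>) powr e) * F y w"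
            by (intro add_mono F_ge)
          then show ?thesis using True by (simp add: distrib_left)
        qed simp
      qed
      also have "\<dots> = ennreal ((2 * \<rho>) powr e) * (f x + f y)"
      proof -
        have "F x \<in> borel_measurable M" "F y \<in> borel_measurable M" using x y by (auto simp: F_def Z_def)
        then show ?thesis by (simp add: nn_integral_cmult nn_integral_add f_def)
      qed
      finally have "ennreal (c * \<rho> powr ?N * (\<bar>u x - u z\<bar> powr q + \<bar>u y - u z\<bar> powr q)) \<le> ennreal ((2 * \<rho>) powr e * (a + b))"
        using ab c by (simp add: ennreal_mult)
      then have "c * \<rho> powr ?N * (\<bar>u x - u z\<bar> powr q + \<bar>u y - u z\<bar> powr q) \<le> (2 * \<rho>) powr e * (a + b)"
        using ab by (subst (asm) ennreal_le_iff) auto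
      then have "\<bar>u x - u z\<bar> powr q + \<bar>u y - u z\<bar> powr q \<le> (2 * \<rho>) powr e * (a + b) / (c * \<rho> powr ?N)"
        using c \<rho> by (simp add: pos_le_divide_eq mult.commute)
      also have "\<dots> = K1 * (\<rho> powr e / \<rho> powr ?N) * (a + b)" by (simp add: K1_def powr_mult)
      also have "\<rho> powr e / \<rho> powr ?N = \<rho> powr (\<sigma> * q)" by (simp add: e_def flip: powr_diff)
      finally have uz: "\<bar>u x - u z\<bar> powr q + \<bar>u y - u z\<bar> powr q \<le> K1 * \<rho> powr (\<sigma> * q) * (a + b)" .
      have half: "t \<le> (K / 2) * \<rho> powr \<sigma> * (a powr (1 / q) + b powr (1 / q))"
        if "0 \<le> t" "t powr q \<le> K1 * \<rho> powr (\<sigma> * q) * (a + b)" for t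
      proof -
        have "t \<le> (K1 * \<rho> powr (\<sigma> * q) * (a + b)) powr (1 / q)" using that q by (intro powr_le_imp_le_powr) auto
        also have "\<dots> = K1 powr (1 / q) * \<rho> powr \<sigma> * (a + b) powr (1 / q)" using q by (simp add: powr_mult powr_powr)
        also have "\<dots> \<le> K1 powr (1 / q) * \<rho> powr \<sigma> * (2 powr (1 / q) * (a powr (1 / q) + b powr (1 / q)))"
          using ab q by (intro mult_left_mono powr_add_le) auto
        also have "\<dots> \<le> K1 powr (1 / q) * \<rho> powr \<sigma> * (2 powr 1 * (a powr (1 / q) + b powr (1 / q)))"
          using q by (intro mult_left_mono mult_right_mono powr_mono) auto
        finally show ?thesis by (simp add: K_def algebra_simps)
      qed
      have "\<bar>u x - u z\<bar> \<le> (K / 2) * \<rho> powr \<sigma> * (a powr (1 / q) + b powr (1 / q))"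
        using uz powr_ge_zero[of "\<bar>u y - u z\<bar>" q] by (intro half) linarith+
      moreover have "\<bar>u y - u z\<bar> \<le> (K / 2) * \<rho> powr \<sigma> * (a powr (1 / q) + b powr (1 / q))"
        using uz powr_ge_zero[of "\<bar>u x - u z\<bar>" q] by (intro half) linarith+
      ultimately have "\<bar>u x - u y\<bar> \<le> K * \<rho> powr \<sigma> * (a powr (1 / q) + b powr (1 / q))" by linarith
      then show "\<bar>u x - u y\<bar> \<le> dist x y powr \<sigma> * (G x + G y)"
        by (simp add: G_def a_def b_def \<rho>_def algebra_simps)
    qed
  qed
qed

end

section \<open>Embeddings and compactness\<close>

context bounded_domain
begin

definition hajlasz_ball :: "real \<Rightarrow> real \<Rightarrow> real \<Rightarrow> real \<Rightarrow> ('a \<Rightarrow> real) \<Rightarrow> bool" where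
  "hajlasz_ball R \<sigma> q A u \<longleftrightarrow> hajlasz R \<sigma> q A u \<and> lp_bound q A u"

lemma lp_bound_mono:
  assumes "lp_bound q A u" "0 \<le> A" "A \<le> B" "0 \<le> q"
  shows "lp_bound q B u"
proof -
  have "ennreal (A powr q) \<le> ennreal (B powr q)" using assms by (intro ennreal_leI powr_mono2)
  with assms show ?thesis unfolding lp_bound_def by (meson order_trans)
qed

lemma hajlasz_mono:
  assumes "hajlasz R \<sigma> q A u" "0 \<le> A" "A \<le> B" "0 \<le> q"
  shows "hajlasz R \<sigma> q B u"
proof -
  have "ennreal (A powr q) \<le> ennreal (B powr q)" using assms by (intro ennreal_leI powr_mono2)
  with assms(1) show ?thesis unfolding hajlasz_def by (meson order_trans)
qed

lemma hajlasz_ball_mono: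
  "hajlasz_ball R \<sigma> q A u \<Longrightarrow> 0 \<le> A \<Longrightarrow> A \<le> B \<Longrightarrow> 0 \<le> q \<Longrightarrow> hajlasz_ball R \<sigma> q B u"
  unfolding hajlasz_ball_def by (blast intro: hajlasz_mono lp_bound_mono)

lemma hajlasz_ball_scale:
  "hajlasz_ball R \<sigma> q A u \<Longrightarrow> 0 \<le> A \<Longrightarrow> 0 \<le> b \<Longrightarrow> hajlasz_ball R \<sigma> q (b * A) (\<lambda>x. b * u x)"
  unfolding hajlasz_ball_def by (blast intro: hajlasz_scale lp_bound_scale)

lemma hajlasz_ball_diff:
  "hajlasz_ball R \<sigma> q A u \<Longrightarrow> hajlasz_ball R \<sigma> q A v \<Longrightarrow> 1 \<le> q \<Longrightarrow> 0 \<le> A \<Longrightarrow>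
    hajlasz_ball R \<sigma> q (4 * A) (\<lambda>x. u x - v x)"
  unfolding hajlasz_ball_def by (blast intro: hajlasz_diff lp_bound_diff)

text \<open>Restores homogeneity: an estimate known for constant 1 is applied to u / A.\<close>

lemma hajlasz_ball_transfer:
  assumes unit: "\<And>u. hajlasz_ball R \<sigma> q 1 u \<Longrightarrow> hajlasz_ball R' \<alpha> r C u"
    and "hajlasz_ball R \<sigma> q A u" "0 < A" "0 \<le> C"
  shows "hajlasz_ball R' \<alpha> r (A * C) u"
proof -
  have "hajlasz_ball R \<sigma> q (1 / A * A) (\<lambda>x. 1 / A * u x)" using assms by (intro hajlasz_ball_scale) auto
  then have "hajlasz_ball R' \<alpha> r C (\<lambda>x. 1 / A * u x)" using assms by (intro unit) simp
  from hajlasz_ball_scale[OF this, of A] show ?thesis using assms by simp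
qed

text \<open>The differences are improved first; the \<open>L^r\<close> bound on u itself then
  follows from the improved gradient.\<close>

lemma hajlasz_ball_raise:
  assumes dens: "measure_density \<Omega> R c" and q: "1 \<le> q" "q \<le> r" and \<alpha>: "0 < \<alpha>"
    and gap: "\<alpha> - DIM('a) / r < \<sigma> - DIM('a) / q"
  obtains C where "0 \<le> C" "\<And>u. hajlasz_ball R \<sigma> q 1 u \<Longrightarrow> hajlasz_ball (R / 3) \<alpha> r C u"
proof -
  obtain C1 where C1: "0 \<le> C1" "\<And>u. hajlasz R \<sigma> q 1 u \<Longrightarrow> hajlasz (R / 3) \<alpha> r C1 u"
    using hajlasz_improve[OF assms] by blast
  have "measure_density \<Omega> (R / 3) c" using dens by (rule measure_density_mono) (use dens in \<open>auto simp: measure_density_def\<close>)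
  then obtain C2 where C2: "0 \<le> C2" "\<And>u. hajlasz (R / 3) \<alpha> r 1 u \<Longrightarrow> lp_bound q 1 u \<Longrightarrow> lp_bound r C2 u"
    using hajlasz_lp_improve[of "R / 3" c q r \<alpha>] q \<alpha> by auto
  \<comment> \<open>Division by B makes both hypotheses of the second estimate hold with constant
    1.\<close>
  define B where "B = max 1 C1"
  have B: "1 \<le> B" "C1 \<le> B" by (auto simp: B_def)
  show ?thesis
  proof (rule that[of "max C1 (B * C2)"])
    show "0 \<le> max C1 (B * C2)" using C1 by simp
    fix u assume "hajlasz_ball R \<sigma> q 1 u"
    then have u: "hajlasz R \<sigma> q 1 u" "lp_bound q 1 u" by (auto simp: hajlasz_ball_def)
    have h: "hajlasz (R / 3) \<alpha> r C1 u" using u C1 by blast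
    then have "hajlasz (R / 3) \<alpha> r (1 / B * C1) (\<lambda>x. 1 / B * u x)" using B C1 by (intro hajlasz_scale) auto
    then have h1: "hajlasz (R / 3) \<alpha> r 1 (\<lambda>x. 1 / B * u x)" using B C1 q by (elim hajlasz_mono) auto
    have "lp_bound q (1 / B * 1) (\<lambda>x. 1 / B * u x)" using u B by (intro lp_bound_scale) auto
    then have "lp_bound q 1 (\<lambda>x. 1 / B * u x)" using B q by (elim lp_bound_mono) auto
    with h1 have "lp_bound r C2 (\<lambda>x. 1 / B * u x)" by (rule C2)
    from lp_bound_scale[OF this, of B] have "lp_bound r (B * C2) u" using B C2 by simp
    then show "hajlasz_ball (R / 3) \<alpha> r (max C1 (B * C2)) u"
      unfolding hajlasz_ball_def using h C1 C2 B q by (auto intro: hajlasz_mono lp_bound_mono)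
  qed
qed

text \<open>The target exponent r may lie below q. Raising to max q r and then lowering on the
  bounded set covers both cases; if the maximum is q, the gap condition reduces to \<alpha> <
  \<sigma>.\<close>

lemma hajlasz_ball_embedding:
  assumes dens: "measure_density \<Omega> R c" and q: "1 \<le> q" "1 \<le> r" and \<alpha>: "0 < \<alpha>" "\<alpha> < \<sigma>"
    and gap: "\<alpha> - DIM('a) / r < \<sigma> - DIM('a) / q"
  obtains C where "0 < C" "\<And>u A. 0 < A \<Longrightarrow> hajlasz_ball R \<sigma> q A u \<Longrightarrow> hajlasz_ball (R / 3) \<alpha> r (A * C) u"
proof -
  define m where "m = max q r"
  have m: "q \<le> m" "r \<le> m" "1 \<le> m" using q by (auto simp: m_def)
  have R: "0 < R" using dens by (auto simp: measure_density_def)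
  have "\<alpha> - DIM('a) / m < \<sigma> - DIM('a) / q" using gap \<alpha> by (auto simp: m_def max_def)
  then obtain C1 where C1: "0 \<le> C1" "\<And>u. hajlasz_ball R \<sigma> q 1 u \<Longrightarrow> hajlasz_ball (R / 3) \<alpha> m C1 u"
    using hajlasz_ball_raise[OF dens q(1) m(1) \<alpha>(1)] by blast
  define L where "L = (measure M \<Omega> + 1) powr (1 / r)"
  have low: "hajlasz_ball (R / 3) \<alpha> r L u" if "hajlasz_ball (R / 3) \<alpha> m 1 u" for u
    using that hajlasz_lower_exponent[of "R / 3" \<alpha> m u r \<alpha>] lp_bound_lower_exponent[of m u r] q m R
    by (auto simp: hajlasz_ball_def L_def)
  have C1': "hajlasz_ball (R / 3) \<alpha> m (C1 + 1) u" if "hajlasz_ball R \<sigma> q 1 u" for u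
    using C1(2)[OF that] C1(1) by (rule hajlasz_ball_mono) (use m in auto)
  have L: "0 \<le> L" by (simp add: L_def)
  show ?thesis
  proof (rule that[of "(C1 + 1) * L + 1"])
    show "0 < (C1 + 1) * L + 1" using C1 L by (simp add: add_nonneg_pos)
    fix u A assume A: "0 < A" and u: "hajlasz_ball R \<sigma> q A u"
    have "hajlasz_ball (R / 3) \<alpha> m (A * (C1 + 1)) u"
      by (rule hajlasz_ball_transfer[OF C1' u A]) (use C1 in auto)
    from hajlasz_ball_transfer[OF low this _ L] have "hajlasz_ball (R / 3) \<alpha> r (A * (C1 + 1) * L) u"
      using A C1 by simp
    then show "hajlasz_ball (R / 3) \<alpha> r (A * ((C1 + 1) * L + 1)) u"
      using A C1 L q by (elim hajlasz_ball_mono) (auto simp: algebra_simps)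
  qed
qed

section \<open>Gagliardo energy of functions with a Hajlasz gradient\<close>

lemma gagliardo_energy_iterated:
  assumes [measurable]: "u \<in> borel_measurable M"
  shows "gagliardo_energy \<Omega> \<tau> r u =
    (\<integral>\<^sup>+x. (\<integral>\<^sup>+y. ennreal (\<bar>u x - u y\<bar> powr r / norm (x - y) powr (real DIM('a) + \<tau> * r)) \<partial>M) \<partial>M)"
  using nn_integral_fst[of "\<lambda>(x, y). ennreal (\<bar>u x - u y\<bar> powr r / norm (x - y) powr (real DIM('a) + \<tau> * r))" M]
  by (simp add: gagliardo_energy_def)

text \<open>The double integral is split at |x - y| = \<eta>. Nearby, the pointwise bound leaves |x
  - y| to the power (\<alpha> - \<tau>) r - N times G^r; far apart, the kernel is at most \<eta>^(-N
  - \<tau> r) and only the \<open>L^r\<close> size of w enters. As C depends on neither \<eta>, A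
  nor w, smallness in \<open>L^r\<close> within a bounded family forces small energy: \<eta> is
  chosen first, the \<open>L^r\<close> tolerance afterwards.\<close>

lemma hajlasz_gagliardo_energy:
  assumes r: "1 \<le> (r :: real)" and \<tau>: "0 \<le> (\<tau> :: real)" "\<tau> < \<alpha>"
  obtains C where "0 \<le> C" "\<And>A \<eta> w. hajlasz_ball R \<alpha> r A w \<Longrightarrow> 0 < \<eta> \<Longrightarrow> \<eta> \<le> R \<Longrightarrow>
    gagliardo_energy \<Omega> \<tau> r w \<le> ennreal (C * \<eta> powr ((\<alpha> - \<tau>) * r / 2) * A powr r)
      + ennreal (C * \<eta> powr (- (real DIM('a) + \<tau> * r))) * (\<integral>\<^sup>+x. ennreal (\<bar>w x\<bar> powr r) \<partial>M)"
proof -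
  let ?N = "real DIM('a)"
  \<comment> \<open>Half of the surplus exponent: one half becomes the small factor \<eta>^\<beta>,
    the other keeps the kernel |x - y|^(\<beta> - N) integrable.\<close>
  define \<beta> where "\<beta> = (\<alpha> - \<tau>) * r / 2"
  define e where "e = ?N + \<tau> * r"
  have \<beta>: "0 < \<beta>" using r \<tau> by (simp add: \<beta>_def)
  have e: "0 \<le> e" using r \<tau> by (simp add: e_def)
  obtain CK where CK: "0 \<le> CK" "\<And>x. x \<in> \<Omega> \<Longrightarrow> (\<integral>\<^sup>+y. ennreal (dist x y powr (\<beta> - ?N)) \<partial>M) \<le> ennreal CK"
    using riesz_kernel_bound[OF \<beta>] by blast
  define \<mu> where "\<mu> = measure M \<Omega>"
  have \<mu>: "0 \<le> \<mu>" "emeasure M \<Omega> = ennreal \<mu>" by (auto simp: \<mu>_def emeasure_eq_measure)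
  define C where "C = 2 powr r * 2 * (CK + \<mu>)"
  have C: "0 \<le> C" "2 powr r * (2 * CK) \<le> C" "2 powr r * (2 * \<mu>) \<le> C" using CK \<mu> by (auto simp: C_def)
  have "gagliardo_energy \<Omega> \<tau> r w \<le> ennreal (C * \<eta> powr \<beta> * A powr r)
      + ennreal (C * \<eta> powr (- e)) * (\<integral>\<^sup>+x. ennreal (\<bar>w x\<bar> powr r) \<partial>M)"
    if w: "hajlasz_ball R \<alpha> r A w" and \<eta>: "0 < \<eta>" "\<eta> \<le> R" for A \<eta> w
  proof -
    have [measurable]: "w \<in> borel_measurable M" using w by (simp add: hajlasz_ball_def lp_bound_def)
    obtain G Z where G [measurable]: "G \<in> borel_measurable M" and G': "\<And>x. 0 \<le> G x"
      "(\<integral>\<^sup>+x. ennreal (G x powr r) \<partial>M) \<le> ennreal (A powr r)" "AE x in M. x \<in> Z" "Z \<subseteq> \<Omega>"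
      "\<And>x y. x \<in> Z \<Longrightarrow> y \<in> Z \<Longrightarrow> dist x y \<le> R \<Longrightarrow> \<bar>w x - w y\<bar> \<le> dist x y powr \<alpha> * (G x + G y)"
      using w hajlaszE unfolding hajlasz_ball_def by blast
    define a where "a = ennreal (2 powr r * \<eta> powr \<beta>)"
    define b where "b = ennreal (2 powr r * \<eta> powr (- e))"
    define k where "k x y = ennreal (dist x y powr (\<beta> - ?N))" for x y :: 'a
    define g where "g x = ennreal (G x powr r)" for x
    define W where "W x = ennreal (\<bar>w x\<bar> powr r)" for x
    have k [measurable]: "case_prod k \<in> borel_measurable (M \<Otimes>\<^sub>M M)" unfolding k_def by measurable
    have k1 [measurable]: "k x \<in> borel_measurable M" if "x \<in> \<Omega>" for x unfolding k_def using that by measurable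
    have [measurable]: "g \<in> borel_measurable M" "W \<in> borel_measurable M" unfolding g_def W_def by measurable
    have ksym: "k x y = k y x" for x y by (simp add: k_def dist_commute)
    have kC: "(\<integral>\<^sup>+y. k x y \<partial>M) \<le> ennreal CK" if "x \<in> \<Omega>" for x unfolding k_def using CK that by blast
    have pt: "ennreal (\<bar>w x - w y\<bar> powr r / norm (x - y) powr e) \<le> a * (k x y * g x + k x y * g y) + b * (W x + W y)"
      if x: "x \<in> Z" and y: "y \<in> Z" for x y
    proof (cases "x = y")
      case False
      define t where "t = dist x y"
      have t: "0 < t" "norm (x - y) = t" using False by (auto simp: t_def dist_norm)
      show ?thesis
      proof (cases "t \<le> \<eta>")
        case True
        have "\<bar>w x - w y\<bar> powr r \<le> (t powr \<alpha> * (G x + G y)) powr r"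
          using G'(5)[OF x y] True \<eta> r by (intro powr_mono2) (auto simp: t_def)
        also have "\<dots> = t powr (\<alpha> * r) * (G x + G y) powr r" by (simp add: powr_mult powr_powr)
        also have "\<dots> \<le> t powr (\<alpha> * r) * (2 powr r * (G x powr r + G y powr r))"
          using r G' by (intro mult_left_mono powr_add_le) auto
        finally have "\<bar>w x - w y\<bar> powr r / t powr e \<le> t powr (\<alpha> * r) * (2 powr r * (G x powr r + G y powr r)) / t powr e"
          by (intro divide_right_mono) auto
        also have "\<dots> = (t powr (\<alpha> * r) / t powr e) * (2 powr r * (G x powr r + G y powr r))" by simp
        also have "t powr (\<alpha> * r) / t powr e = t powr \<beta> * t powr (\<beta> - ?N)"
          by (simp add: e_def \<beta>_def algebra_simps add_divide_distrib diff_divide_distrib flip: powr_diff powr_add)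
        also have "t powr \<beta> * t powr (\<beta> - ?N) * (2 powr r * (G x powr r + G y powr r))
           \<le> \<eta> powr \<beta> * t powr (\<beta> - ?N) * (2 powr r * (G x powr r + G y powr r))"
          using True \<beta> t by (intro mult_right_mono powr_mono2) auto
        finally have "\<bar>w x - w y\<bar> powr r / t powr e \<le> 2 powr r * \<eta> powr \<beta> * (t powr (\<beta> - ?N) * G x powr r + t powr (\<beta> - ?N) * G y powr r)"
          by (simp add: algebra_simps)
        then have "ennreal (\<bar>w x - w y\<bar> powr r / t powr e) \<le> a * (k x y * g x + k x y * g y)"
          by (simp add: a_def k_def g_def t_def ennreal_leI flip: ennreal_mult ennreal_plus)
        then show ?thesis using t by (simp add: add_increasing2)
      next
        case False
        have "\<bar>w x - w y\<bar> powr r \<le> (\<bar>w x\<bar> + \<bar>w y\<bar>) powr r" using r by (intro powr_mono2) auto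
        also have "\<dots> \<le> 2 powr r * (\<bar>w x\<bar> powr r + \<bar>w y\<bar> powr r)" using r by (intro powr_add_le) auto
        finally have "\<bar>w x - w y\<bar> powr r * t powr (- e) \<le> 2 powr r * (\<bar>w x\<bar> powr r + \<bar>w y\<bar> powr r) * \<eta> powr (- e)"
          using False \<eta> e by (intro mult_mono powr_mono2') auto
        then have "\<bar>w x - w y\<bar> powr r / t powr e \<le> 2 powr r * \<eta> powr (- e) * (\<bar>w x\<bar> powr r + \<bar>w y\<bar> powr r)"
          by (simp add: powr_minus_divide algebra_simps)
        then have "ennreal (\<bar>w x - w y\<bar> powr r / t powr e) \<le> b * (W x + W y)"
          by (simp add: b_def W_def ennreal_leI flip: ennreal_mult ennreal_plus)
        then show ?thesis using t by (simp add: add_increasing)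
      qed
    qed simp
    define IW where "IW = (\<integral>\<^sup>+x. W x \<partial>M)"
    have "gagliardo_energy \<Omega> \<tau> r w = (\<integral>\<^sup>+x. (\<integral>\<^sup>+y. ennreal (\<bar>w x - w y\<bar> powr r / norm (x - y) powr e) \<partial>M) \<partial>M)"
      unfolding e_def by (rule gagliardo_energy_iterated) measurable
    also have "\<dots> \<le> (\<integral>\<^sup>+x. (\<integral>\<^sup>+y. a * (k x y * g x + k x y * g y) + b * (W x + W y) \<partial>M) \<partial>M)"
      using G'(3)
    proof (intro nn_integral_mono_AE, eventually_elim)
      case (elim x)
      then show ?case using G'(3) by (intro nn_integral_mono_AE) (auto elim!: eventually_mono intro!: pt)
    qed
    also have "\<dots> = (\<integral>\<^sup>+x. a * ((\<integral>\<^sup>+y. k x y \<partial>M) * g x + (\<integral>\<^sup>+y. k x y * g y \<partial>M)) + b * (W x * ennreal \<mu> + IW) \<partial>M)"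
      by (intro nn_integral_cong) (simp add: nn_integral_add nn_integral_cmult nn_integral_multc IW_def \<mu>(2))
    also have "\<dots> = a * ((\<integral>\<^sup>+x. (\<integral>\<^sup>+y. k x y \<partial>M) * g x \<partial>M) + (\<integral>\<^sup>+x. (\<integral>\<^sup>+y. k x y * g y \<partial>M) \<partial>M)) + b * (IW * ennreal \<mu> + IW * ennreal \<mu>)"
      by (simp add: nn_integral_add nn_integral_cmult nn_integral_multc IW_def \<mu>(2))
    \<comment> \<open>By Fubini and the symmetry of k, the term with g y has the same integral as
      the term with g x.\<close>
    also have "(\<integral>\<^sup>+x. (\<integral>\<^sup>+y. k x y * g y \<partial>M) \<partial>M) = (\<integral>\<^sup>+y. (\<integral>\<^sup>+x. k x y * g y \<partial>M) \<partial>M)"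
      by (rule pair.Fubini'[symmetric]) measurable
    also have "\<dots> = (\<integral>\<^sup>+x. (\<integral>\<^sup>+y. k x y \<partial>M) * g x \<partial>M)"
      by (intro nn_integral_cong) (simp add: ksym nn_integral_multc)
    also have "a * ((\<integral>\<^sup>+x. (\<integral>\<^sup>+y. k x y \<partial>M) * g x \<partial>M) + (\<integral>\<^sup>+x. (\<integral>\<^sup>+y. k x y \<partial>M) * g x \<partial>M)) + b * (IW * ennreal \<mu> + IW * ennreal \<mu>)
       \<le> a * (ennreal CK * ennreal (A powr r) + ennreal CK * ennreal (A powr r)) + b * (IW * ennreal \<mu> + IW * ennreal \<mu>)"
    proof -
      have "(\<integral>\<^sup>+x. (\<integral>\<^sup>+y. k x y \<partial>M) * g x \<partial>M) \<le> (\<integral>\<^sup>+x. ennreal CK * g x \<partial>M)"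
        by (intro nn_integral_mono mult_right_mono kC) auto
      also have "\<dots> = ennreal CK * (\<integral>\<^sup>+x. g x \<partial>M)" by (rule nn_integral_cmult) measurable
      also have "\<dots> \<le> ennreal CK * ennreal (A powr r)" using G'(2) by (intro mult_left_mono) (auto simp: g_def)
      finally show ?thesis by (intro add_right_mono mult_left_mono add_mono) auto
    qed
    also have "a * (ennreal CK * ennreal (A powr r) + ennreal CK * ennreal (A powr r))
       = ennreal (2 powr r * (2 * CK) * \<eta> powr \<beta> * A powr r)"
      using CK by (simp add: a_def mult_ac flip: ennreal_mult ennreal_plus)
    also have "b * (IW * ennreal \<mu> + IW * ennreal \<mu>) = ennreal (2 powr r * (2 * \<mu>) * \<eta> powr (- e)) * IW"
    proof -
      have "b * (IW * ennreal \<mu> + IW * ennreal \<mu>) = b * (ennreal \<mu> + ennreal \<mu>) * IW" by (simp add: algebra_simps)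
      also have "b * (ennreal \<mu> + ennreal \<mu>) = ennreal (2 powr r * (2 * \<mu>) * \<eta> powr (- e))"
        using \<mu> by (simp add: b_def mult_ac flip: ennreal_mult ennreal_plus)
      finally show ?thesis .
    qed
    also have "ennreal (2 powr r * (2 * CK) * \<eta> powr \<beta> * A powr r) + ennreal (2 powr r * (2 * \<mu>) * \<eta> powr (- e)) * IW
      \<le> ennreal (C * \<eta> powr \<beta> * A powr r) + ennreal (C * \<eta> powr (- e)) * IW"
      using C by (intro add_mono mult_right_mono ennreal_leI) auto
    finally show ?thesis by (simp add: IW_def W_def)
  qed
  then show ?thesis using C(1) by (intro that[of C]) (auto simp: \<beta>_def e_def)
qed

end

section \<open>Almost everywhere limits and total boundedness\<close>

lemma powr_equation_solvable:
  fixes y a :: real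
  assumes "0 < y" "a \<noteq> 0"
  obtains t where "0 < t" "t powr a = y"
  using assms by (intro that[of "y powr (1 / a)"]) (auto simp: powr_powr)

lemma nn_integral_Fatou_bound:
  fixes f :: "nat \<Rightarrow> 'a \<Rightarrow> ennreal"
  assumes [measurable]: "\<And>n. f n \<in> borel_measurable M"
    and lim: "AE x in M. (\<lambda>n. f n x) \<longlonglongrightarrow> g x" and B: "\<And>n. (\<integral>\<^sup>+x. f n x \<partial>M) \<le> B"
  shows "(\<integral>\<^sup>+x. g x \<partial>M) \<le> B"
proof -
  have "(\<integral>\<^sup>+x. g x \<partial>M) \<le> (\<integral>\<^sup>+x. liminf (\<lambda>n. f n x) \<partial>M)"
    using lim by (intro nn_integral_mono_AE) (auto elim!: eventually_mono simp: lim_imp_Liminf)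
  also have "\<dots> \<le> liminf (\<lambda>n. \<integral>\<^sup>+x. f n x \<partial>M)" by (rule nn_integral_liminf) simp
  also have "\<dots> \<le> B" using B by (intro Liminf_le) auto
  finally show ?thesis .
qed

text \<open>Summable \<open>L^1\<close> distances make the telescoping series absolutely convergent
  off a null set. The fast rate spares the passage to a further subsequence.\<close>

lemma AE_limit_of_fast_Cauchy:
  fixes w :: "nat \<Rightarrow> 'a \<Rightarrow> real"
  assumes [measurable]: "\<And>n. w n \<in> borel_measurable M"
    and fast: "\<And>n. (\<integral>\<^sup>+x. ennreal \<bar>w n x - w (Suc n) x\<bar> \<partial>M) \<le> ennreal ((1/2) ^ n)"
  obtains v where "v \<in> borel_measurable M" "AE x in M. (\<lambda>n. w n x) \<longlonglongrightarrow> v x"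
proof (rule that[of "\<lambda>x. lim (\<lambda>n. w n x)"])
  show "(\<lambda>x. lim (\<lambda>n. w n x)) \<in> borel_measurable M" by measurable
  have "(\<integral>\<^sup>+x. (\<Sum>n. ennreal \<bar>w n x - w (Suc n) x\<bar>) \<partial>M) = (\<Sum>n. \<integral>\<^sup>+x. ennreal \<bar>w n x - w (Suc n) x\<bar> \<partial>M)"
    by (rule nn_integral_suminf) measurable
  also have "\<dots> \<le> (\<Sum>n. ennreal ((1/2) ^ n))" by (intro suminf_le fast summableI)
  also have "\<dots> = ennreal (\<Sum>n. (1/2) ^ n)" by (intro suminf_ennreal2) (auto intro: summable_geometric)
  finally have "(\<integral>\<^sup>+x. (\<Sum>n. ennreal \<bar>w n x - w (Suc n) x\<bar>) \<partial>M) \<noteq> \<infinity>"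
    by (metis ennreal_less_top infinity_ennreal_def leD)
  then have "AE x in M. (\<Sum>n. ennreal \<bar>w n x - w (Suc n) x\<bar>) \<noteq> \<infinity>"
    by (intro nn_integral_PInf_AE) measurable
  then show "AE x in M. (\<lambda>n. w n x) \<longlonglongrightarrow> lim (\<lambda>n. w n x)"
  proof eventually_elim
    case (elim x)
    then have "summable (\<lambda>n. \<bar>w n x - w (Suc n) x\<bar>)" by (intro summable_suminf_not_top) auto
    then have "summable (\<lambda>n. w n x - w (Suc n) x)" by (rule summable_rabs_cancel)
    then have "convergent (\<lambda>n. \<Sum>i<n. (w i x - w (Suc i) x))" by (simp add: summable_iff_convergent)
    then have "convergent (\<lambda>n. w 0 x - w n x)" by (simp only: sum_lessThan_telescope'[where f="\<lambda>i. w i x"])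
    from convergent_diff[OF convergent_const[of "w 0 x"] this] have "convergent (\<lambda>n. w n x)" by simp
    then show ?case by (simp add: convergent_LIMSEQ_iff)
  qed
qed

context bounded_domain
begin

text \<open>Convergence is known almost everywhere in one variable. With the iterated integral,
  Fatou's lemma applies in each variable separately, and null sets of the product do not
  appear.\<close>

lemma gagliardo_energy_Fatou:
  assumes [measurable]: "\<And>n. w n \<in> borel_measurable M" "v \<in> borel_measurable M"
    and lim: "AE x in M. (\<lambda>n. w n x) \<longlonglongrightarrow> v x" and r: "0 < r"
    and B: "\<And>n. gagliardo_energy \<Omega> \<tau> r (w n) \<le> B"
  shows "gagliardo_energy \<Omega> \<tau> r v \<le> B"
proof -
  define F where "F u x y = ennreal (\<bar>u x - u y\<bar> powr r / norm (x - y) powr (real DIM('a) + \<tau> * r))"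
    for u :: "'a \<Rightarrow> real" and x y
  have F [measurable]: "case_prod (F u) \<in> borel_measurable (M \<Otimes>\<^sub>M M)" if [measurable]: "u \<in> borel_measurable M" for u
    unfolding F_def by measurable
  have energy: "gagliardo_energy \<Omega> \<tau> r u = (\<integral>\<^sup>+x. (\<integral>\<^sup>+y. F u x y \<partial>M) \<partial>M)" if "u \<in> borel_measurable M" for u
    using gagliardo_energy_iterated[OF that] by (simp add: F_def)
  have Fx: "F u x \<in> borel_measurable M" if "u \<in> borel_measurable M" "x \<in> \<Omega>" for u x
    using measurable_Pair2[OF F[OF that(1)], of x] that by simp
  have "gagliardo_energy \<Omega> \<tau> r v \<le> (\<integral>\<^sup>+x. liminf (\<lambda>n. \<integral>\<^sup>+y. F (w n) x y \<partial>M) \<partial>M)"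
    unfolding energy[OF assms(2)]
  proof (rule nn_integral_mono_AE)
    have "AE x in M. x \<in> \<Omega>" by (rule AE_I2) simp
    with lim show "AE x in M. (\<integral>\<^sup>+y. F v x y \<partial>M) \<le> liminf (\<lambda>n. \<integral>\<^sup>+y. F (w n) x y \<partial>M)"
    proof eventually_elim
      case (elim x)
      have "(\<integral>\<^sup>+y. F v x y \<partial>M) \<le> (\<integral>\<^sup>+y. liminf (\<lambda>n. F (w n) x y) \<partial>M)"
        using lim
      proof (intro nn_integral_mono_AE, eventually_elim)
        case (elim y)
        have "(\<lambda>n. F (w n) x y) \<longlonglongrightarrow> F v x y"
          unfolding F_def using \<open>(\<lambda>n. w n x) \<longlonglongrightarrow> v x\<close> elim r
          by (cases "x = y") (auto intro!: tendsto_intros tendsto_ennrealI)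
        then show ?case by (simp add: lim_imp_Liminf)
      qed
      also have "\<dots> \<le> liminf (\<lambda>n. \<integral>\<^sup>+y. F (w n) x y \<partial>M)"
        using elim by (intro nn_integral_liminf Fx) auto
      finally show ?case .
    qed
  qed
  also have "\<dots> \<le> liminf (\<lambda>n. \<integral>\<^sup>+x. (\<integral>\<^sup>+y. F (w n) x y \<partial>M) \<partial>M)"
    by (rule nn_integral_liminf) measurable
  also have "\<dots> = liminf (\<lambda>n. gagliardo_energy \<Omega> \<tau> r (w n))" by (simp add: energy)
  also have "\<dots> \<le> B" using B by (intro Liminf_le) auto
  finally show ?thesis .
qed

text \<open>Total boundedness in \<open>L^r\<close>. On the set E n, where G n and |u n| are at most
  T, the function u n is locally Hoelder with constant 2 T, so rounded values at one point of each
  of finitely many small balls determine it up to 3 \<epsilon>. The complement is small by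
  Chebyshev, and the larger exponent r' keeps |u n - u m|^r from concentrating there.\<close>

lemma hajlasz_finite_colouring:
  fixes u :: "nat \<Rightarrow> 'a \<Rightarrow> real"
  assumes r: "1 \<le> r" "r < r'" and \<alpha>: "0 < \<alpha>" and R: "0 < R" and A: "0 < A"
    and u: "\<And>n. hajlasz_ball R \<alpha> r' A (u n)" and e: "0 < e"
  shows "\<exists>col :: nat \<Rightarrow> 'a \<Rightarrow> int. finite (range col) \<and>
    (\<forall>n m. col n = col m \<longrightarrow> (\<integral>\<^sup>+x. ennreal (\<bar>u n x - u m x\<bar> powr r) \<partial>M) \<le> ennreal e)"
proof -
  have um [measurable]: "u n \<in> borel_measurable M" for n using u by (simp add: hajlasz_ball_def lp_bound_def)
  have ulp: "(\<integral>\<^sup>+x. ennreal (\<bar>u n x\<bar> powr r') \<partial>M) \<le> ennreal (A powr r')" for n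
    using u by (simp add: hajlasz_ball_def lp_bound_def)
  have "\<forall>n. \<exists>G Z. G \<in> borel_measurable M \<and> (\<forall>x. 0 \<le> G x) \<and>
     (\<integral>\<^sup>+x. ennreal (G x powr r') \<partial>M) \<le> ennreal (A powr r') \<and> (AE x in M. x \<in> Z) \<and> Z \<subseteq> \<Omega> \<and>
     (\<forall>x\<in>Z. \<forall>y\<in>Z. dist x y \<le> R \<longrightarrow> \<bar>u n x - u n y\<bar> \<le> dist x y powr \<alpha> * (G x + G y))"
  proof
    fix n
    have "hajlasz R \<alpha> r' A (u n)" using u[of n] by (simp add: hajlasz_ball_def)
    from hajlaszE[OF this] show "\<exists>G Z. G \<in> borel_measurable M \<and> (\<forall>x. 0 \<le> G x) \<and>
     (\<integral>\<^sup>+x. ennreal (G x powr r') \<partial>M) \<le> ennreal (A powr r') \<and> (AE x in M. x \<in> Z) \<and> Z \<subseteq> \<Omega> \<and>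
     (\<forall>x\<in>Z. \<forall>y\<in>Z. dist x y \<le> R \<longrightarrow> \<bar>u n x - u n y\<bar> \<le> dist x y powr \<alpha> * (G x + G y))"
      by metis
  qed
  then obtain G Z where Gm [measurable]: "\<And>n. G n \<in> borel_measurable M" and G': "\<And>n x. 0 \<le> (G n x :: real)"
      "\<And>n. (\<integral>\<^sup>+x. ennreal (G n x powr r') \<partial>M) \<le> ennreal (A powr r')" "\<And>n. AE x in M. x \<in> Z n" "\<And>n. Z n \<subseteq> \<Omega>"
      "\<And>n x y. x \<in> Z n \<Longrightarrow> y \<in> Z n \<Longrightarrow> dist x y \<le> R \<Longrightarrow> \<bar>u n x - u n y\<bar> \<le> dist x y powr \<alpha> * (G n x + G n y)"
    by metis
  define \<mu> where "\<mu> = measure M \<Omega>"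
  have \<mu>: "0 \<le> \<mu>" "emeasure M \<Omega> = ennreal \<mu>" by (auto simp: \<mu>_def emeasure_eq_measure)
  \<comment> \<open>X bounds the r'-power integral of the difference of two members of the sequence;
    Y adds up the four r'-power integrals of u and G for two members.\<close>
  define X where "X = (4 * A) powr r'"
  define Y where "Y = 4 * A powr r'"
  have XY: "0 \<le> X" "0 \<le> Y" by (auto simp: X_def Y_def)
  \<comment> \<open>Three contributions of e / 3 are planned. The height S, which cuts off large
    differences, is fixed first; T must come after it because the exceptional set is weighted by
    S^r; the radius d depends on both T and \<epsilon>.\<close>
  obtain S where S: "0 < S" "S powr (r - r') = e / (3 * (X + 1))"
    using powr_equation_solvable[of "e / (3 * (X + 1))" "r - r'"] r e XY by auto
  have "S powr (r - r') * X = e / 3 * (X / (X + 1))" unfolding S by simp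
  also have "\<dots> \<le> e / 3 * 1" using e XY by (intro mult_left_mono) (auto simp: divide_le_eq)
  finally have S1: "S powr (r - r') * X \<le> e / 3" by simp
  obtain T where T: "0 < T" "T powr (- r') = e / (3 * (S powr r * Y + 1))"
  proof (rule powr_equation_solvable)
    show "0 < e / (3 * (S powr r * Y + 1))" using e XY by (intro divide_pos_pos mult_pos_pos add_nonneg_pos) auto
    show "- r' \<noteq> 0" using r by simp
  qed
  have "S powr r * Y * T powr (- r') = e / 3 * (S powr r * Y / (S powr r * Y + 1))" unfolding T by simp
  also have "\<dots> \<le> e / 3 * 1" using e XY by (intro mult_left_mono) (auto simp: divide_le_eq add_nonneg_pos)
  finally have T1: "S powr r * T powr (- r') * Y \<le> e / 3" by (simp add: mult_ac)
  obtain \<epsilon>' where \<epsilon>': "0 < \<epsilon>'" "\<epsilon>' powr r = e / (3 * (\<mu> + 1))"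
    using powr_equation_solvable[of "e / (3 * (\<mu> + 1))" r] r e \<mu> by auto
  define \<epsilon> where "\<epsilon> = \<epsilon>' / 3"
  have \<epsilon>: "0 < \<epsilon>" "(3 * \<epsilon>) powr r * \<mu> \<le> e / 3" using \<epsilon>' e \<mu> by (auto simp: \<epsilon>_def field_simps)
  obtain d' where d': "0 < d'" "d' powr \<alpha> = \<epsilon> / (2 * T)"
    using powr_equation_solvable[of "\<epsilon> / (2 * T)" \<alpha>] \<alpha> \<epsilon> T by auto
  define d where "d = min R d' / 2"
  have d: "0 < d" "2 * d \<le> R" using R d' by (auto simp: d_def)
  have "(2 * d) powr \<alpha> \<le> d' powr \<alpha>" using \<alpha> R d' by (intro powr_mono2) (auto simp: d_def)
  then have d\<epsilon>: "(2 * d) powr \<alpha> * (2 * T) \<le> \<epsilon>" using T d' by (simp add: field_simps)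
  have "compact (closure \<Omega>)" using bounded_domain by (simp add: compact_closure)
  then obtain F where F: "finite F" "closure \<Omega> \<subseteq> (\<Union>a\<in>F. ball a d)"
    using d(1) unfolding compact_eq_totally_bounded by blast
  define E where "E n = {x \<in> Z n. G n x \<le> T \<and> \<bar>u n x\<bar> \<le> T}" for n
  define pick where "pick n a = (SOME x. x \<in> E n \<inter> ball a d)" for n a
  \<comment> \<open>The value 0 for balls that miss E n is never compared with u n; it merely
    respects the bound T.\<close>
  define c where "c n a = (if E n \<inter> ball a d = {} then 0 else u n (pick n a))" for n a
  have pick: "pick n a \<in> E n \<inter> ball a d" if "E n \<inter> ball a d \<noteq> {}" for n a
    unfolding pick_def using that by (rule some_in_eq[THEN iffD2])
  have cT: "\<bar>c n a\<bar> \<le> T" for n a using pick[of n a] T by (auto simp: c_def E_def)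
  \<comment> \<open>The value 0 off F makes the range a set of functions with finite support in F
    and finitely many values.\<close>
  define col where "col n a = (if a \<in> F then \<lfloor>c n a / \<epsilon>\<rfloor> else 0)" for n a
  have "range col \<subseteq> {f. \<forall>a. (a \<in> F \<longrightarrow> f a \<in> {\<lfloor>- T / \<epsilon>\<rfloor>..\<lfloor>T / \<epsilon>\<rfloor>}) \<and> (a \<notin> F \<longrightarrow> f a = 0)}"
  proof -
    have "\<lfloor>- T / \<epsilon>\<rfloor> \<le> \<lfloor>c n a / \<epsilon>\<rfloor>" "\<lfloor>c n a / \<epsilon>\<rfloor> \<le> \<lfloor>T / \<epsilon>\<rfloor>" for n a
    proof -
      have "- T \<le> c n a" "c n a \<le> T" using cT[of n a] by linarith+
      then show "\<lfloor>- T / \<epsilon>\<rfloor> \<le> \<lfloor>c n a / \<epsilon>\<rfloor>" "\<lfloor>c n a / \<epsilon>\<rfloor> \<le> \<lfloor>T / \<epsilon>\<rfloor>"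
        using \<epsilon>(1) by (intro floor_mono divide_right_mono; simp)+
    qed
    then show ?thesis by (auto simp: col_def)
  qed
  then have "finite (range col)" by (rule finite_subset) (intro finite_set_of_finite_funs F(1) finite_atLeastAtMost_int)
  moreover have "(\<integral>\<^sup>+x. ennreal (\<bar>u n x - u m x\<bar> powr r) \<partial>M) \<le> ennreal e" if col: "col n = col m" for n m
  proof -
    define w where "w x = u n x - u m x" for x
    have [measurable]: "w \<in> borel_measurable M" unfolding w_def by measurable
    have close: "\<bar>u k x - c k a\<bar> \<le> \<epsilon>" if x: "x \<in> E k" "x \<in> ball a d" for k x a
    proof -
      have "E k \<inter> ball a d \<noteq> {}" using x by blast
      then have p: "pick k a \<in> E k" "pick k a \<in> ball a d" using pick[of k a] by blast+
      have "dist x (pick k a) \<le> dist a x + dist a (pick k a)" by (rule dist_triangle3)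
      also have "\<dots> \<le> 2 * d" using x p by auto
      finally have dd: "dist x (pick k a) \<le> 2 * d" .
      have "\<bar>u k x - u k (pick k a)\<bar> \<le> dist x (pick k a) powr \<alpha> * (G k x + G k (pick k a))"
        using x p dd d by (intro G') (auto simp: E_def)
      also have "\<dots> \<le> (2 * d) powr \<alpha> * (2 * T)"
        using x p dd \<alpha> G' by (intro mult_mono powr_mono2) (auto simp: E_def intro: add_nonneg_nonneg)
      finally show ?thesis using x d\<epsilon> by (auto simp: c_def)
    qed
    have good: "\<bar>w x\<bar> \<le> 3 * \<epsilon>" if x: "x \<in> E n" "x \<in> E m" for x
    proof -
      have "x \<in> closure \<Omega>" using x G'(4)[of n] closure_subset by (auto simp: E_def)
      then obtain a where a: "a \<in> F" "x \<in> ball a d" using F(2) by blast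
      have "\<lfloor>c n a / \<epsilon>\<rfloor> = \<lfloor>c m a / \<epsilon>\<rfloor>" using fun_cong[OF col, of a] a by (simp add: col_def)
      then have "\<bar>c n a / \<epsilon> - c m a / \<epsilon>\<bar> \<le> 1" by linarith
      then have "\<bar>c n a - c m a\<bar> \<le> \<epsilon>" using \<epsilon> by (simp add: diff_divide_distrib[symmetric] abs_divide divide_le_eq)
      then show ?thesis using close[OF x(1) a(2)] close[OF x(2) a(2)] unfolding w_def by linarith
    qed
    define H where "H x = (G n x powr r' + \<bar>u n x\<bar> powr r') + (G m x powr r' + \<bar>u m x\<bar> powr r')" for x
    \<comment> \<open>Chebyshev: off E n or off E m, one of the four quantities in H exceeds
      T.\<close>
    have bad: "1 \<le> T powr (- r') * H x" if x: "x \<in> Z n" "x \<in> Z m" "\<not> (x \<in> E n \<and> x \<in> E m)" for x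
    proof -
      have big: "T powr r' \<le> t powr r'" if "T < t" for t using that T r by (intro powr_mono2) auto
      have "G n x > T \<or> \<bar>u n x\<bar> > T \<or> G m x > T \<or> \<bar>u m x\<bar> > T" using x by (auto simp: E_def)
      then have "T powr r' \<le> H x" unfolding H_def
        using big[of "G n x"] big[of "\<bar>u n x\<bar>"] big[of "G m x"] big[of "\<bar>u m x\<bar>"]
          powr_ge_zero[of "G n x" r'] powr_ge_zero[of "\<bar>u n x\<bar>" r'] powr_ge_zero[of "G m x" r'] powr_ge_zero[of "\<bar>u m x\<bar>" r']
        by linarith
      then have "T powr (- r') * T powr r' \<le> T powr (- r') * H x" by (intro mult_left_mono) auto
      then show ?thesis using T(1) by (simp flip: powr_add)
    qed
    have H0: "0 \<le> H x" for x by (simp add: H_def)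
    have pt: "\<bar>w x\<bar> powr r \<le> (3 * \<epsilon>) powr r + (S powr r * T powr (- r') * H x + S powr (r - r') * \<bar>w x\<bar> powr r')"
      if x: "x \<in> Z n" "x \<in> Z m" for x
    proof (cases "x \<in> E n \<and> x \<in> E m")
      case True
      then have "\<bar>w x\<bar> powr r \<le> (3 * \<epsilon>) powr r" using good r by (intro powr_mono2) auto
      moreover have "0 \<le> S powr r * T powr (- r') * H x + S powr (r - r') * \<bar>w x\<bar> powr r'" using H0 by simp
      ultimately show ?thesis by linarith
    next
      case False
      \<comment> \<open>Truncation at height S: above it, the negative power r - r' of |w| is at
        most that of S.\<close>
      have "\<bar>w x\<bar> powr r \<le> S powr r + S powr (r - r') * \<bar>w x\<bar> powr r'"
      proof (cases "\<bar>w x\<bar> \<le> S")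
        case True
        then have "\<bar>w x\<bar> powr r \<le> S powr r" using r by (intro powr_mono2) auto
        then show ?thesis by (simp add: add_increasing2)
      next
        case False
        have "\<bar>w x\<bar> powr r = \<bar>w x\<bar> powr (r - r') * \<bar>w x\<bar> powr r'" by (simp flip: powr_add)
        also have "\<dots> \<le> S powr (r - r') * \<bar>w x\<bar> powr r'"
          using False S r by (intro mult_right_mono powr_mono2') auto
        finally show ?thesis by (simp add: add_increasing)
      qed
      also have "S powr r \<le> S powr r * (T powr (- r') * H x)"
        using bad[OF x False] by (intro mult_le_cancel_left1[THEN iffD2]) auto
      finally show ?thesis by (simp add: mult.assoc add_increasing)
    qed
    have "(\<integral>\<^sup>+x. ennreal (\<bar>w x\<bar> powr r) \<partial>M) \<le> (\<integral>\<^sup>+x. ennreal ((3 * \<epsilon>) powr r) +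
        (ennreal (S powr r * T powr (- r')) * ((ennreal (G n x powr r') + ennreal (\<bar>u n x\<bar> powr r')) + (ennreal (G m x powr r') + ennreal (\<bar>u m x\<bar> powr r')))
         + ennreal (S powr (r - r')) * ennreal (\<bar>w x\<bar> powr r')) \<partial>M)"
      using G'(3)[of n] G'(3)[of m]
    proof (intro nn_integral_mono_AE, eventually_elim)
      case (elim x)
      then show ?case using pt[of x] unfolding H_def
        by (simp add: ennreal_leI flip: ennreal_plus ennreal_mult)
    qed
    also have "\<dots> = ennreal ((3 * \<epsilon>) powr r) * ennreal \<mu> +
        (ennreal (S powr r * T powr (- r')) * (((\<integral>\<^sup>+x. ennreal (G n x powr r') \<partial>M) + (\<integral>\<^sup>+x. ennreal (\<bar>u n x\<bar> powr r') \<partial>M))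
           + ((\<integral>\<^sup>+x. ennreal (G m x powr r') \<partial>M) + (\<integral>\<^sup>+x. ennreal (\<bar>u m x\<bar> powr r') \<partial>M)))
         + ennreal (S powr (r - r')) * (\<integral>\<^sup>+x. ennreal (\<bar>w x\<bar> powr r') \<partial>M))"
      by (simp add: nn_integral_add nn_integral_cmult \<mu>(2))
    also have "\<dots> \<le> ennreal ((3 * \<epsilon>) powr r) * ennreal \<mu> +
        (ennreal (S powr r * T powr (- r')) * ((ennreal (A powr r') + ennreal (A powr r'))
           + (ennreal (A powr r') + ennreal (A powr r')))
         + ennreal (S powr (r - r')) * ennreal X)"
    proof -
      have "lp_bound r' (4 * A) w" unfolding w_def
        using u r A by (intro lp_bound_diff) (auto simp: hajlasz_ball_def)
      then have "(\<integral>\<^sup>+x. ennreal (\<bar>w x\<bar> powr r') \<partial>M) \<le> ennreal X" by (simp add: lp_bound_def X_def)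
      then show ?thesis by (intro add_mono mult_left_mono ulp G' order_refl) auto
    qed
    also have "\<dots> = ennreal ((3 * \<epsilon>) powr r * \<mu> + (S powr r * T powr (- r') * Y + S powr (r - r') * X))"
      using \<mu> XY by (simp add: Y_def flip: ennreal_plus ennreal_mult)
    also have "\<dots> \<le> ennreal e" using \<epsilon> T1 S1 by (intro ennreal_leI) linarith
    finally show ?thesis by (simp add: w_def)
  qed
  ultimately show ?thesis by blast
qed

end

text \<open>g is the slack common to both strict inequalities. One third of it is spent on raising
  \<tau> to \<alpha>, at most another third on raising r to r'; the cap 1/2 on s keeps r / (1 - s)
  meaningful.\<close>

lemma intermediate_exponents:
  fixes \<tau> \<sigma> q r N :: real
  assumes "\<tau> < \<sigma>" "\<tau> - N / r < \<sigma> - N / q" "0 < r" "0 < N"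
  obtains \<alpha> r' where "\<tau> < \<alpha>" "\<alpha> < \<sigma>" "r < r'" "\<alpha> - N / r' < \<sigma> - N / q" "\<alpha> - N / r < \<sigma> - N / q"
proof -
  define g where "g = min (\<sigma> - \<tau>) ((\<sigma> - N / q) - (\<tau> - N / r))"
  have g: "0 < g" "g \<le> \<sigma> - \<tau>" "g \<le> (\<sigma> - N / q) - (\<tau> - N / r)" using assms by (auto simp: g_def)
  define s where "s = min (1/2) (g * r / (3 * N))"
  have s: "0 < s" "s < 1" "s \<le> g * r / (3 * N)" using g assms by (auto simp: s_def)
  have "s * N / r \<le> g / 3" using s(3) assms by (simp add: field_simps)
  moreover have "N / (r / (1 - s)) = N / r - s * N / r" using s assms by (simp add: field_simps)
  moreover have "r < r / (1 - s)" using s assms by (simp add: field_simps)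
  ultimately show ?thesis using g by (intro that[of "\<tau> + g / 3" "r / (1 - s)"]) auto
qed

section \<open>Bounded and compact embeddings of Hajlasz balls\<close>

context bounded_domain
begin

lemma hajlasz_bounded_embedding:
  assumes dens: "measure_density \<Omega> R c" and q: "1 \<le> q" "1 \<le> r" and \<tau>: "0 \<le> \<tau>" "\<tau> < \<sigma>"
    and gap: "\<tau> - DIM('a) / r < \<sigma> - DIM('a) / q"
  obtains C where "0 < C" "\<And>u A. 0 < A \<Longrightarrow> hajlasz_ball R \<sigma> q A u \<Longrightarrow>
    lp_bound r (A * C) u \<and> gagliardo_energy \<Omega> \<tau> r u \<le> ennreal ((A * C) powr r)"
proof -
  have R: "0 < R" using dens by (simp add: measure_density_def)
  obtain \<alpha> r' where \<alpha>: "\<tau> < \<alpha>" "\<alpha> < \<sigma>" "\<alpha> - DIM('a) / r < \<sigma> - DIM('a) / q"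
    using intermediate_exponents[OF \<tau>(2) gap] q by auto
  obtain C1 where C1: "0 < C1" "\<And>u A. 0 < A \<Longrightarrow> hajlasz_ball R \<sigma> q A u \<Longrightarrow> hajlasz_ball (R / 3) \<alpha> r (A * C1) u"
    using hajlasz_ball_embedding[OF dens q _ \<alpha>(2,3)] \<alpha> \<tau> by auto
  define R' where "R' = R / 3"
  have R': "0 < R'" using R by (simp add: R'_def)
  obtain C2 where C2: "0 \<le> C2" "\<And>A \<eta> w. hajlasz_ball R' \<alpha> r A w \<Longrightarrow> 0 < \<eta> \<Longrightarrow> \<eta> \<le> R' \<Longrightarrow>
    gagliardo_energy \<Omega> \<tau> r w \<le> ennreal (C2 * \<eta> powr ((\<alpha> - \<tau>) * r / 2) * A powr r)
      + ennreal (C2 * \<eta> powr (- (real DIM('a) + \<tau> * r))) * (\<integral>\<^sup>+x. ennreal (\<bar>w x\<bar> powr r) \<partial>M)"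
    using hajlasz_gagliardo_energy[OF q(2) \<tau>(1) \<alpha>(1)] by blast
  define K where "K = C2 * R' powr ((\<alpha> - \<tau>) * r / 2) + C2 * R' powr (- (real DIM('a) + \<tau> * r))"
  \<comment> \<open>The summand 1 lets the same constant serve the energy and the \<open>L^r\<close>
    bound. For mere boundedness the splitting radius is the largest admissible one, R'.\<close>
  define B where "B = (1 + K) powr (1 / r)"
  have K: "0 \<le> K" using C2 by (simp add: K_def)
  have B: "1 \<le> B" "B powr r = 1 + K" using K q by (auto simp: B_def powr_powr ge_one_powr_ge_zero)
  show ?thesis
  proof (rule that[of "C1 * B"])
    show "0 < C1 * B" using C1 B by simp
    fix u A assume A: "0 < (A :: real)" and u: "hajlasz_ball R \<sigma> q A u"
    have h: "hajlasz_ball R' \<alpha> r (A * C1) u" using C1(2)[OF A u] by (simp add: R'_def)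
    then have lp: "lp_bound r (A * C1) u" by (simp add: hajlasz_ball_def)
    have "A * C1 \<le> A * C1 * B" using mult_left_mono[OF B(1), of "A * C1"] A C1 by simp
    then have "lp_bound r (A * (C1 * B)) u" using lp A C1 q by (elim lp_bound_mono) (auto simp: mult.assoc)
    moreover have "gagliardo_energy \<Omega> \<tau> r u \<le> ennreal ((A * (C1 * B)) powr r)"
    proof -
      have "gagliardo_energy \<Omega> \<tau> r u \<le> ennreal (C2 * R' powr ((\<alpha> - \<tau>) * r / 2) * (A * C1) powr r)
         + ennreal (C2 * R' powr (- (real DIM('a) + \<tau> * r))) * (\<integral>\<^sup>+x. ennreal (\<bar>u x\<bar> powr r) \<partial>M)"
        by (rule C2(2)[OF h R' order_refl])
      also have "\<dots> \<le> ennreal (C2 * R' powr ((\<alpha> - \<tau>) * r / 2) * (A * C1) powr r)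
         + ennreal (C2 * R' powr (- (real DIM('a) + \<tau> * r))) * ennreal ((A * C1) powr r)"
        using lp by (intro add_left_mono mult_left_mono) (auto simp: lp_bound_def)
      also have "\<dots> = ennreal (K * (A * C1) powr r)"
        using C2(1) by (simp add: K_def distrib_right flip: ennreal_mult ennreal_plus)
      also have "\<dots> \<le> ennreal ((1 + K) * (A * C1) powr r)" by (intro ennreal_leI mult_right_mono) auto
      also have "(1 + K) * (A * C1) powr r = (A * (C1 * B)) powr r" by (simp add: powr_mult B)
      finally show ?thesis .
    qed
    ultimately show "lp_bound r (A * (C1 * B)) u \<and> gagliardo_energy \<Omega> \<tau> r u \<le> ennreal ((A * (C1 * B)) powr r)" ..
  qed
qed

text \<open>All differences lie in one Hajlasz ball, so their energy is controlled by their
  \<open>L^r\<close> distance; total boundedness in \<open>L^r\<close>, obtained from the larger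
  exponent r', thus yields a subsequence that is fast Cauchy in energy too. Fatou's lemma carries
  the estimates over to the almost everywhere limit v.\<close>

lemma hajlasz_compact_embedding:
  assumes dens: "measure_density \<Omega> R c" and q: "1 \<le> q" "1 \<le> r" and \<tau>: "0 \<le> \<tau>" "\<tau> < \<sigma>"
    and gap: "\<tau> - DIM('a) / r < \<sigma> - DIM('a) / q"
    and A: "0 < A" and u: "\<And>n. hajlasz_ball R \<sigma> q A (u n)"
  obtains \<rho> v where "strict_mono (\<rho> :: nat \<Rightarrow> nat)" "v \<in> borel_measurable M"
    "(\<integral>\<^sup>+x. ennreal (\<bar>v x\<bar> powr r) \<partial>M) < \<infinity>" "gagliardo_energy \<Omega> \<tau> r v < \<infinity>"
    "(\<lambda>n. \<integral>\<^sup>+x. ennreal (\<bar>u (\<rho> n) x - v x\<bar> powr r) \<partial>M) \<longlonglongrightarrow> 0"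
    "(\<lambda>n. gagliardo_energy \<Omega> \<tau> r (\<lambda>x. u (\<rho> n) x - v x)) \<longlonglongrightarrow> 0"
proof -
  have R: "0 < R" using dens by (simp add: measure_density_def)
  define R' where "R' = R / 3"
  have R': "0 < R'" using R by (simp add: R'_def)
  have um [measurable]: "u n \<in> borel_measurable M" for n using u by (simp add: hajlasz_ball_def lp_bound_def)
  obtain \<alpha> r' where \<alpha>: "\<tau> < \<alpha>" "\<alpha> < \<sigma>" "r < r'" "\<alpha> - DIM('a) / r' < \<sigma> - DIM('a) / q" "\<alpha> - DIM('a) / r < \<sigma> - DIM('a) / q"
    using intermediate_exponents[OF \<tau>(2) gap] q by auto
  have \<alpha>0: "0 < \<alpha>" using \<alpha> \<tau> by simp
  obtain C1 where C1: "0 < C1" "\<And>u A. 0 < A \<Longrightarrow> hajlasz_ball R \<sigma> q A u \<Longrightarrow> hajlasz_ball (R / 3) \<alpha> r (A * C1) u"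
    using hajlasz_ball_embedding[OF dens q \<alpha>0 \<alpha>(2,5)] by blast
  have "1 \<le> r'" using q \<alpha> by simp
  then obtain C2 where C2: "0 < C2" "\<And>u A. 0 < A \<Longrightarrow> hajlasz_ball R \<sigma> q A u \<Longrightarrow> hajlasz_ball (R / 3) \<alpha> r' (A * C2) u"
    using hajlasz_ball_embedding[OF dens q(1) _ \<alpha>0 \<alpha>(2,4)] by blast
  have u1: "hajlasz_ball R' \<alpha> r (A * C1) (u n)" and u2: "hajlasz_ball R' \<alpha> r' (A * C2) (u n)" for n
    using C1(2)[OF A u] C2(2)[OF A u] by (auto simp: R'_def)
  define B where "B = 4 * (A * C1)"
  have B: "0 < B" using A C1 by (simp add: B_def)
  have ud: "hajlasz_ball R' \<alpha> r B (\<lambda>x. u n x - u m x)" for n m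
    unfolding B_def using A C1 q u1 by (intro hajlasz_ball_diff) auto
  obtain C3 where C3: "0 \<le> C3" "\<And>A \<eta> w. hajlasz_ball R' \<alpha> r A w \<Longrightarrow> 0 < \<eta> \<Longrightarrow> \<eta> \<le> R' \<Longrightarrow>
    gagliardo_energy \<Omega> \<tau> r w \<le> ennreal (C3 * \<eta> powr ((\<alpha> - \<tau>) * r / 2) * A powr r)
      + ennreal (C3 * \<eta> powr (- (real DIM('a) + \<tau> * r))) * (\<integral>\<^sup>+x. ennreal (\<bar>w x\<bar> powr r) \<partial>M)"
    using hajlasz_gagliardo_energy[OF q(2) \<tau>(1) \<alpha>(1)] by blast
  define I where "I p w = (\<integral>\<^sup>+x. ennreal (\<bar>w x\<bar> powr p) \<partial>M)" for p :: real and w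
  \<comment> \<open>The \<open>L^1\<close> distance is added to produce an almost everywhere limit;
    the other two terms are the quantities of interest.\<close>
  define D where "D n m = I 1 (\<lambda>x. u n x - u m x) + (I r (\<lambda>x. u n x - u m x) + gagliardo_energy \<Omega> \<tau> r (\<lambda>x. u n x - u m x))" for n m
  have "\<exists>col :: nat \<Rightarrow> ('a \<Rightarrow> int) \<times> ('a \<Rightarrow> int). finite (range col) \<and> (\<forall>n m. col n = col m \<longrightarrow> D n m \<le> ennreal e)"
    if e: "0 < e" for e
  proof -
    define \<beta> where "\<beta> = (\<alpha> - \<tau>) * r / 2"
    have \<beta>: "0 < \<beta>" using \<alpha> q by (simp add: \<beta>_def)
    \<comment> \<open>E, and through it \<eta>, keeps the energy near the diagonal below e / 4
      uniformly over the ball; only then is the \<open>L^r\<close> tolerance e' fixed in terms of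
      \<eta>.\<close>
    define E where "E = e / (4 * (C3 * B powr r + 1))"
    have E: "0 < E" "C3 * E * B powr r \<le> e / 4"
    proof -
      have p: "0 < C3 * B powr r + 1" using C3(1) by (intro add_nonneg_pos) auto
      then show "0 < E" using e by (simp add: E_def)
      have "C3 * E * B powr r = e / 4 * (C3 * B powr r / (C3 * B powr r + 1))" by (simp add: E_def)
      also have "\<dots> \<le> e / 4 * 1" using e p by (intro mult_left_mono) auto
      finally show "C3 * E * B powr r \<le> e / 4" by simp
    qed
    obtain \<eta>' where \<eta>': "0 < \<eta>'" "\<eta>' powr \<beta> = E" using powr_equation_solvable[of E \<beta>] E(1) \<beta> by auto
    define \<eta> where "\<eta> = min \<eta>' R'"
    have \<eta>: "0 < \<eta>" "\<eta> \<le> R'" using \<eta>' R' by (auto simp: \<eta>_def)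
    have "\<eta> powr \<beta> \<le> E" unfolding \<eta>'(2)[symmetric] using \<eta> \<beta> by (intro powr_mono2) (auto simp: \<eta>_def)
    then have "C3 * \<eta> powr \<beta> * B powr r \<le> C3 * E * B powr r" using C3 by (intro mult_right_mono mult_left_mono) auto
    then have \<eta>1: "C3 * \<eta> powr \<beta> * B powr r \<le> e / 4" using E by simp
    define L where "L = C3 * \<eta> powr (- (real DIM('a) + \<tau> * r))"
    have L: "0 \<le> L" using C3 by (simp add: L_def)
    define e' where "e' = e / (4 * (L + 1))"
    have e': "0 < e'" using e L by (simp add: e'_def)
    have e'1: "e' \<le> e / 4" "L * e' \<le> e / 4" using e L by (auto simp: e'_def field_simps)
    obtain c1 :: "nat \<Rightarrow> 'a \<Rightarrow> int" where c1: "finite (range c1)" "\<And>n m. c1 n = c1 m \<Longrightarrow> I 1 (\<lambda>x. u n x - u m x) \<le> ennreal (e / 4)"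
      using hajlasz_finite_colouring[of 1 r' \<alpha> R' "A * C2" u "e / 4"] q \<alpha> \<alpha>0 R' A C2(1) u2 e
      unfolding I_def by auto
    obtain c2 :: "nat \<Rightarrow> 'a \<Rightarrow> int" where c2: "finite (range c2)" "\<And>n m. c2 n = c2 m \<Longrightarrow> I r (\<lambda>x. u n x - u m x) \<le> ennreal e'"
      using hajlasz_finite_colouring[of r r' \<alpha> R' "A * C2" u e'] q \<alpha> \<alpha>0 R' A C2(1) u2 e'
      unfolding I_def by auto
    have "finite (range (\<lambda>n. (c1 n, c2 n)))"
      by (rule finite_subset[OF _ finite_cartesian_product[OF c1(1) c2(1)]]) auto
    moreover have "D n m \<le> ennreal e" if "(c1 n, c2 n) = (c1 m, c2 m)" for n m
    proof -
      have 1: "I 1 (\<lambda>x. u n x - u m x) \<le> ennreal (e / 4)" and 2: "I r (\<lambda>x. u n x - u m x) \<le> ennreal e'"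
        using c1 c2 that by auto
      have "gagliardo_energy \<Omega> \<tau> r (\<lambda>x. u n x - u m x) \<le> ennreal (C3 * \<eta> powr \<beta> * B powr r) + ennreal L * I r (\<lambda>x. u n x - u m x)"
        using C3(2)[OF ud \<eta>] unfolding \<beta>_def L_def I_def .
      also have "\<dots> \<le> ennreal (e / 4) + ennreal L * ennreal e'"
        using \<eta>1 2 by (intro add_mono ennreal_leI mult_left_mono) auto
      also have "\<dots> \<le> ennreal (e / 4) + ennreal (e / 4)" using e'1 L e' by (auto intro!: add_left_mono ennreal_leI simp flip: ennreal_mult)
      finally have 3: "gagliardo_energy \<Omega> \<tau> r (\<lambda>x. u n x - u m x) \<le> ennreal (e / 4) + ennreal (e / 4)" .
      have "I r (\<lambda>x. u n x - u m x) \<le> ennreal (e / 4)" using 2 e'1 by (meson ennreal_leI order_trans)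
      with 1 3 have "D n m \<le> ennreal (e / 4) + (ennreal (e / 4) + (ennreal (e / 4) + ennreal (e / 4)))"
        unfolding D_def by (intro add_mono)
      also have "\<dots> = ennreal e" using e by (simp flip: ennreal_plus)
      finally show ?thesis .
    qed
    ultimately show ?thesis by (intro exI[of _ "\<lambda>n. (c1 n, c2 n)"]) auto
  qed
  then obtain \<rho> :: "nat \<Rightarrow> nat" where \<rho>: "strict_mono \<rho>" "\<And>k n m. k \<le> n \<Longrightarrow> k \<le> m \<Longrightarrow> D (\<rho> n) (\<rho> m) \<le> ennreal ((1/2) ^ k)"
    using diagonal_subsequence_of_colourings[of D] by metis
  define w where "w n = u (\<rho> n)" for n
  have wm [measurable]: "w n \<in> borel_measurable M" for n by (simp add: w_def)
  have w1: "I 1 (\<lambda>x. w n x - w m x) \<le> ennreal ((1/2) ^ k)"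
    and wr: "I r (\<lambda>x. w n x - w m x) \<le> ennreal ((1/2) ^ k)"
    and wE: "gagliardo_energy \<Omega> \<tau> r (\<lambda>x. w n x - w m x) \<le> ennreal ((1/2) ^ k)" if "k \<le> n" "k \<le> m" for n m k
  proof -
    have le: "a \<le> s" "b \<le> s" "c \<le> s" if "a + (b + c) \<le> s" for a b c s :: ennreal
      using that by (meson le_iff_add order_trans add_increasing2 add_increasing zero_le order_refl)+
    note le[OF \<rho>(2)[OF that, unfolded D_def, folded w_def]]
    then show "I 1 (\<lambda>x. w n x - w m x) \<le> ennreal ((1/2) ^ k)" "I r (\<lambda>x. w n x - w m x) \<le> ennreal ((1/2) ^ k)"
      "gagliardo_energy \<Omega> \<tau> r (\<lambda>x. w n x - w m x) \<le> ennreal ((1/2) ^ k)" by auto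
  qed
  have "(\<integral>\<^sup>+x. ennreal \<bar>w n x - w (Suc n) x\<bar> \<partial>M) \<le> ennreal ((1/2) ^ n)" for n
    using w1[of n n "Suc n"] by (simp add: I_def)
  then obtain v where v [measurable]: "v \<in> borel_measurable M" and lim: "AE x in M. (\<lambda>n. w n x) \<longlonglongrightarrow> v x"
    using AE_limit_of_fast_Cauchy[of w M] wm by blast
  have limr: "AE x in M. (\<lambda>m. ennreal (\<bar>w n x - w (m + n) x\<bar> powr r)) \<longlonglongrightarrow> ennreal (\<bar>w n x - v x\<bar> powr r)" for n
    using lim
  proof eventually_elim
    case (elim x)
    then have "(\<lambda>m. w (m + n) x) \<longlonglongrightarrow> v x" by (rule LIMSEQ_ignore_initial_segment)
    then show ?case using q by (intro tendsto_ennrealI tendsto_powr' tendsto_intros) auto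
  qed
  have Ir: "I r (\<lambda>x. w n x - v x) \<le> ennreal ((1/2) ^ n)" for n
    unfolding I_def by (rule nn_integral_Fatou_bound[OF _ limr]) (use wr[of n n] in \<open>auto simp: I_def\<close>)
  have limw: "AE x in M. (\<lambda>m. w n x - w (m + n) x) \<longlonglongrightarrow> w n x - v x" for n
    using lim
  proof eventually_elim
    case (elim x)
    then show ?case by (intro tendsto_diff tendsto_const LIMSEQ_ignore_initial_segment)
  qed
  have En: "gagliardo_energy \<Omega> \<tau> r (\<lambda>x. w n x - v x) \<le> ennreal ((1/2) ^ n)" for n
    using q by (intro gagliardo_energy_Fatou[OF _ _ limw]) (auto intro!: wE)
  have half: "(\<lambda>n. ennreal ((1/2) ^ n)) \<longlonglongrightarrow> 0"
    using tendsto_ennrealI[OF LIMSEQ_realpow_zero[of "1/2"]] by simp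
  \<comment> \<open>Finiteness for v itself comes from uniform bounds along the sequence, again by
    Fatou.\<close>
  obtain C4 where C4: "\<And>u A. 0 < A \<Longrightarrow> hajlasz_ball R \<sigma> q A u \<Longrightarrow>
    lp_bound r (A * C4) u \<and> gagliardo_energy \<Omega> \<tau> r u \<le> ennreal ((A * C4) powr r)"
    by (rule hajlasz_bounded_embedding[OF dens q \<tau> gap]) (rule that)
  have w4: "I r (w n) \<le> ennreal ((A * C4) powr r)" "gagliardo_energy \<Omega> \<tau> r (w n) \<le> ennreal ((A * C4) powr r)" for n
    using C4[OF A u[of "\<rho> n"]] by (simp_all add: w_def I_def lp_bound_def)
  have limv: "AE x in M. (\<lambda>n. ennreal (\<bar>w n x\<bar> powr r)) \<longlonglongrightarrow> ennreal (\<bar>v x\<bar> powr r)"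
    using lim
  proof eventually_elim
    case (elim x)
    then show ?case using q by (intro tendsto_ennrealI tendsto_powr' tendsto_intros) auto
  qed
  show ?thesis
  proof (rule that[OF \<rho>(1) v])
    have "I r v \<le> ennreal ((A * C4) powr r)"
      unfolding I_def by (rule nn_integral_Fatou_bound[OF _ limv]) (use w4 in \<open>auto simp: I_def\<close>)
    then show "(\<integral>\<^sup>+x. ennreal (\<bar>v x\<bar> powr r) \<partial>M) < \<infinity>" by (simp add: I_def le_less_trans)
    have "gagliardo_energy \<Omega> \<tau> r v \<le> ennreal ((A * C4) powr r)"
      using q w4 by (intro gagliardo_energy_Fatou[OF _ _ lim]) auto
    then show "gagliardo_energy \<Omega> \<tau> r v < \<infinity>" by (simp add: le_less_trans)
    show "(\<lambda>n. \<integral>\<^sup>+x. ennreal (\<bar>u (\<rho> n) x - v x\<bar> powr r) \<partial>M) \<longlonglongrightarrow> 0"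
      by (rule tendsto_sandwich[OF _ _ tendsto_const half]) (use Ir in \<open>auto simp: I_def w_def\<close>)
    show "(\<lambda>n. gagliardo_energy \<Omega> \<tau> r (\<lambda>x. u (\<rho> n) x - v x)) \<longlonglongrightarrow> 0"
      by (rule tendsto_sandwich[OF _ _ tendsto_const half]) (use En in \<open>auto simp: w_def\<close>)
  qed
qed

end

section \<open>Mollified averages of functions with a weak gradient\<close>

text \<open>Derivatives of exp (-1 / t) bring in negative powers of t; with these as a parameter k
  the family is closed under differentiation up to linear combinations. The member k = 0 is the
  classical flat function.\<close>

definition flat_exp :: "nat \<Rightarrow> real \<Rightarrow> real" where
  "flat_exp k t = (if t \<le> 0 then 0 else exp (- (1 / t)) / t ^ k)"

lemma flat_exp_nonneg: "0 \<le> flat_exp k t"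
  by (simp add: flat_exp_def)

lemma flat_exp_0_le_1: "flat_exp 0 t \<le> 1"
  by (simp add: flat_exp_def)

text \<open>At 0 the right difference quotient is h^(-k - 1) exp (-1 / h), where the exponential
  wins.\<close>

lemma flat_exp_has_derivative:
  "(flat_exp k has_real_derivative flat_exp (k + 2) t - real k * flat_exp (k + 1) t) (at t)"
proof -
  consider "t < 0" | "t = 0" | "0 < t" by linarith
  then show ?thesis
  proof cases
    case 1
    have "((\<lambda>_. 0) has_real_derivative 0) (at t)" by simp
    then have "(flat_exp k has_real_derivative 0) (at t)"
      by (rule has_field_derivative_transform_within_open[where S="{..<0}"]) (use 1 in \<open>auto simp: flat_exp_def\<close>)
    then show ?thesis using 1 by (simp add: flat_exp_def)
  next
    case 2
    have "((\<lambda>h. flat_exp k h / h) \<longlongrightarrow> 0) (at 0)"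
      unfolding filterlim_at_split
    proof
      have "eventually (\<lambda>h. 0 = flat_exp k h / h) (at_left (0::real))"
        by (auto simp: eventually_at_filter flat_exp_def)
      then show "((\<lambda>h. flat_exp k h / h) \<longlongrightarrow> 0) (at_left 0)"
        by (rule Lim_transform_eventually[OF tendsto_const])
      have "((\<lambda>h::real. inverse h ^ (k + 1) / exp (inverse h)) \<longlongrightarrow> 0) (at_right 0)"
        using tendsto_power_div_exp_0 filterlim_inverse_at_top_right by (rule filterlim_compose)
      moreover have "eventually (\<lambda>h. inverse h ^ (k + 1) / exp (inverse h) = flat_exp k h / h) (at_right (0::real))"
        by (auto simp: eventually_at_filter flat_exp_def exp_minus field_simps)
      ultimately show "((\<lambda>h. flat_exp k h / h) \<longlongrightarrow> 0) (at_right 0)"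
        by (rule Lim_transform_eventually)
    qed
    then show ?thesis unfolding has_field_derivative_iff using 2 by (simp add: flat_exp_def[of _ 0])
  next
    case 3
    have "((\<lambda>t. exp (- (1 / t)) / t ^ k) has_real_derivative flat_exp (k + 2) t - real k * flat_exp (k + 1) t) (at t)"
      using 3
      by (cases k) (auto intro!: derivative_eq_intros simp: flat_exp_def field_simps power2_eq_square,
          metis One_nat_def Suc_pred' neq0_conv power_Suc)
    then show ?thesis
      by (rule has_field_derivative_transform_within_open[where S="{0<..}"]) (use 3 in \<open>auto simp: flat_exp_def\<close>)
  qed
qed

lemma continuous_flat_exp: "continuous_on UNIV (flat_exp k)"
  using flat_exp_has_derivative by (auto intro!: DERIV_continuous_on)

lemma measurable_flat_exp [measurable]: "flat_exp k \<in> borel_measurable borel"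
  by (intro borel_measurable_continuous_onI continuous_flat_exp)

lemma flat_exp_bounded:
  obtains C where "0 \<le> C" "\<And>t. t \<le> 1 \<Longrightarrow> flat_exp k t \<le> C"
proof -
  have "compact (flat_exp k ` {0..1})"
    by (intro compact_continuous_image) (auto intro: continuous_on_subset[OF continuous_flat_exp])
  then obtain C where "\<And>x. x \<in> flat_exp k ` {0..1} \<Longrightarrow> norm x \<le> C" using compact_imp_bounded bounded_iff by metis
  then have C: "flat_exp k t \<le> C" if "0 \<le> t" "t \<le> 1" for t using that by fastforce
  have "0 \<le> C" using C[of 0] flat_exp_nonneg[of k 0] by simp
  moreover have "flat_exp k t \<le> C" if "t \<le> 1" for t
    using C[of t] \<open>0 \<le> C\<close> that by (cases "0 \<le> t") (auto simp: flat_exp_def)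
  ultimately show ?thesis by (rule that)
qed

text \<open>Closure under directional derivatives gives differentiability of every order by
  induction, without formulas for higher derivatives. The class contains the mollifiers and their
  products with affine functions, which serve as test functions.\<close>

inductive smooth_algebra :: "('a::euclidean_space \<Rightarrow> real) \<Rightarrow> bool" where
  const: "smooth_algebra (\<lambda>x. c)"
| inner: "smooth_algebra (\<lambda>x. x \<bullet> b)"
| flat: "smooth_algebra f \<Longrightarrow> smooth_algebra (\<lambda>x. flat_exp k (f x))"
| add: "smooth_algebra f \<Longrightarrow> smooth_algebra g \<Longrightarrow> smooth_algebra (\<lambda>x. f x + g x)"
| mult: "smooth_algebra f \<Longrightarrow> smooth_algebra g \<Longrightarrow> smooth_algebra (\<lambda>x. f x * g x)"

lemma smooth_algebra_derivative:
  "smooth_algebra f \<Longrightarrow> \<exists>f'. (\<forall>x. (f has_derivative f' x) (at x)) \<and> (\<forall>b. smooth_algebra (\<lambda>x. f' x b))"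
proof (induction rule: smooth_algebra.induct)
  case (const c)
  show ?case by (intro exI[of _ "\<lambda>x v. 0"]) (auto intro!: derivative_eq_intros smooth_algebra.const)
next
  case (inner b)
  show ?case by (intro exI[of _ "\<lambda>x v. v \<bullet> b"]) (auto intro!: derivative_eq_intros smooth_algebra.const)
next
  case (flat f k)
  then obtain f' where f': "\<And>x. (f has_derivative f' x) (at x)" "\<And>b. smooth_algebra (\<lambda>x. f' x b)" by blast
  have "((\<lambda>x. flat_exp k (f x)) has_derivative (\<lambda>v. (flat_exp (k + 2) (f x) + (- real k) * flat_exp (k + 1) (f x)) * f' x v)) (at x)" for x
    using has_derivative_compose[OF f'(1)[of x] flat_exp_has_derivative[of k "f x", unfolded has_field_derivative_def]] by simp
  moreover have "smooth_algebra (\<lambda>x. (flat_exp (k + 2) (f x) + (- real k) * flat_exp (k + 1) (f x)) * f' x b)" for b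
    by (intro smooth_algebra.intros flat f')
  ultimately show ?case
    by (intro exI[of _ "\<lambda>x v. (flat_exp (k + 2) (f x) + (- real k) * flat_exp (k + 1) (f x)) * f' x v"]) blast
next
  case (add f g)
  then obtain f' g' where f': "\<And>x. (f has_derivative f' x) (at x)" "\<And>b. smooth_algebra (\<lambda>x. f' x b)"
    and g': "\<And>x. (g has_derivative g' x) (at x)" "\<And>b. smooth_algebra (\<lambda>x. g' x b)" by blast
  show ?case
    by (rule exI[of _ "\<lambda>x v. f' x v + g' x v"]) (intro conjI allI has_derivative_add smooth_algebra.add f' g')
next
  case (mult f g)
  then obtain f' g' where f': "\<And>x. (f has_derivative f' x) (at x)" "\<And>b. smooth_algebra (\<lambda>x. f' x b)"
    and g': "\<And>x. (g has_derivative g' x) (at x)" "\<And>b. smooth_algebra (\<lambda>x. g' x b)" by blast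
  show ?case
    by (rule exI[of _ "\<lambda>x v. f x * g' x v + f' x v * g x"])
      (intro conjI allI has_derivative_mult smooth_algebra.add smooth_algebra.mult f' g' mult)
qed

lemma smooth_algebra_times_differentiable: "smooth_algebra f \<Longrightarrow> times_differentiable k f"
proof (induction k arbitrary: f)
  case 0
  then obtain f' where "\<And>x. (f has_derivative f' x) (at x)" using smooth_algebra_derivative by blast
  then show ?case by (auto intro!: continuous_at_imp_continuous_on has_derivative_continuous)
next
  case (Suc k)
  then obtain f' where f': "\<And>x. (f has_derivative f' x) (at x)" "\<And>b. smooth_algebra (\<lambda>x. f' x b)"
    using smooth_algebra_derivative by blast
  then have "frechet_derivative f (at x) = f' x" for x by (metis frechet_derivative_at)
  then show ?case using f' Suc.IH by (auto simp: differentiable_def)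
qed

lemma smooth_algebra_sum:
  "finite I \<Longrightarrow> (\<And>i. i \<in> I \<Longrightarrow> smooth_algebra (f i)) \<Longrightarrow> smooth_algebra (\<lambda>x. \<Sum>i\<in>I. f i x)"
  by (induction I rule: finite_induct) (auto intro: smooth_algebra.intros)

text \<open>The factor 1 / r^N makes the mass independent of r and c, but the mass is not normalised
  to 1. The squared distance is an inner product so as to be a polynomial in z.\<close>

definition mollifier :: "'a::euclidean_space \<Rightarrow> real \<Rightarrow> 'a \<Rightarrow> real" where
  "mollifier c r z = flat_exp 0 (1 - ((z - c) \<bullet> (z - c)) / r\<^sup>2) / r ^ DIM('a)"

lemma mollifier_nonneg: "0 < r \<Longrightarrow> 0 \<le> mollifier c r z"
  by (simp add: mollifier_def flat_exp_nonneg)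

lemma mollifier_le: "0 < r \<Longrightarrow> mollifier c r z \<le> 1 / r ^ DIM('a)" for z :: "'a::euclidean_space"
  by (simp add: mollifier_def divide_right_mono flat_exp_0_le_1)

lemma flat_exp_ball_eq_0:
  assumes "0 < r" "z \<notin> cball c r"
  shows "flat_exp k (1 - ((z - c) \<bullet> (z - c)) / r\<^sup>2) = 0"
proof -
  have "r\<^sup>2 \<le> (norm (z - c))\<^sup>2" using assms by (intro power_mono) (auto simp: dist_norm norm_minus_commute)
  then show ?thesis using assms by (simp add: flat_exp_def power2_norm_eq_inner)
qed

lemma mollifier_eq_0: "0 < r \<Longrightarrow> z \<notin> cball c r \<Longrightarrow> mollifier c r z = 0"
  by (simp add: mollifier_def flat_exp_ball_eq_0)

lemma smooth_algebra_mollifier: "smooth_algebra (mollifier c r)"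
proof -
  have "smooth_algebra (\<lambda>z. flat_exp 0 (1 + (- 1 / r\<^sup>2) * (\<Sum>b\<in>Basis. (z \<bullet> b + - (c \<bullet> b)) * (z \<bullet> b + - (c \<bullet> b)))) * (1 / r ^ DIM('a)))"
    by (intro smooth_algebra.intros smooth_algebra_sum finite_Basis)
  also have "(\<lambda>z. flat_exp 0 (1 + (- 1 / r\<^sup>2) * (\<Sum>b\<in>Basis. (z \<bullet> b + - (c \<bullet> b)) * (z \<bullet> b + - (c \<bullet> b)))) * (1 / r ^ DIM('a))) = mollifier c r"
    unfolding mollifier_def fun_eq_iff by (subst (2) euclidean_inner) (simp add: inner_diff_left)
  finally show ?thesis .
qed

lemma measurable_mollifier [measurable]: "mollifier c r \<in> borel_measurable borel"
  unfolding mollifier_def by measurable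

text \<open>Moving the ball along \<open>t \<mapsto> (c + t e, r + t s)\<close> transports the mollifier by the velocity field
  \<open>V = e + (s / r) (z - c)\<close>, so its \<open>t\<close>-derivative is minus the divergence of \<open>mollifier * V\<close>.\<close>

definition mollifier_velocity :: "'a::euclidean_space \<Rightarrow> real \<Rightarrow> 'a \<Rightarrow> real \<Rightarrow> 'a \<Rightarrow> 'a" where
  "mollifier_velocity c r e s z = e + (s / r) *\<^sub>R (z - c)"

definition mollifier_rate :: "'a::euclidean_space \<Rightarrow> real \<Rightarrow> 'a \<Rightarrow> real \<Rightarrow> 'a \<Rightarrow> real" where
  "mollifier_rate c r e s z =
     flat_exp 2 (1 - ((z - c) \<bullet> (z - c)) / r\<^sup>2) * (2 / r\<^sup>2) * ((z - c) \<bullet> mollifier_velocity c r e s z) / r ^ DIM('a)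
     - DIM('a) * (s / r) * mollifier c r z"

lemma mollifier_has_rate:
  fixes c e z :: "'a::euclidean_space"
  assumes "0 < r + t * s"
  shows "((\<lambda>t. mollifier (c + t *\<^sub>R e) (r + t * s) z) has_real_derivative
    mollifier_rate (c + t *\<^sub>R e) (r + t * s) e s z) (at t within S)"
proof -
  let ?N = "DIM('a)"
  define d where "d = z - (c + t *\<^sub>R e)"
  define \<rho> where "\<rho> = r + t * s"
  have \<rho>: "0 < \<rho>" using assms by (simp add: \<rho>_def)
  have q: "((\<lambda>t. (z - (c + t *\<^sub>R e)) \<bullet> (z - (c + t *\<^sub>R e))) has_real_derivative - 2 * (d \<bullet> e)) (at t within S)"
    unfolding has_field_derivative_def d_def
    by (auto intro!: derivative_eq_intros simp: fun_eq_iff inner_commute algebra_simps)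
  have \<rho>': "((\<lambda>t. r + t * s) has_real_derivative s) (at t within S)"
    by (auto intro!: derivative_eq_intros)
  have F: "((\<lambda>t. 1 - ((z - (c + t *\<^sub>R e)) \<bullet> (z - (c + t *\<^sub>R e))) / (r + t * s)\<^sup>2) has_real_derivative
     (2 / \<rho>\<^sup>2) * (d \<bullet> (e + (s / \<rho>) *\<^sub>R d))) (at t within S)"
  proof -
    have "((\<lambda>t. 1 - ((z - (c + t *\<^sub>R e)) \<bullet> (z - (c + t *\<^sub>R e))) / (r + t * s)\<^sup>2) has_real_derivative
      0 - ((- 2 * (d \<bullet> e)) * \<rho>\<^sup>2 - (d \<bullet> d) * (real 2 * (s * \<rho> ^ (2 - Suc 0)))) / (\<rho>\<^sup>2 * \<rho>\<^sup>2)) (at t within S)"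
      unfolding d_def \<rho>_def
      by (rule DERIV_diff[OF DERIV_const DERIV_divide[OF q[unfolded d_def] DERIV_power[OF \<rho>']]]) (use assms in simp)
    moreover have "0 - ((- 2 * (d \<bullet> e)) * \<rho>\<^sup>2 - (d \<bullet> d) * (real 2 * (s * \<rho> ^ (2 - Suc 0)))) / (\<rho>\<^sup>2 * \<rho>\<^sup>2)
      = (2 / \<rho>\<^sup>2) * (d \<bullet> (e + (s / \<rho>) *\<^sub>R d))"
      using \<rho> by (simp add: inner_add_right field_simps power2_eq_square)
    ultimately show ?thesis by simp
  qed
  have b: "(flat_exp 0 has_real_derivative flat_exp 2 y) (at y)" for y
    using flat_exp_has_derivative[of 0 y] by (simp add: numeral_2_eq_2)
  have "((\<lambda>t. flat_exp 0 (1 - ((z - (c + t *\<^sub>R e)) \<bullet> (z - (c + t *\<^sub>R e))) / (r + t * s)\<^sup>2)) has_real_derivative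
     flat_exp 2 (1 - (d \<bullet> d) / \<rho>\<^sup>2) * ((2 / \<rho>\<^sup>2) * (d \<bullet> (e + (s / \<rho>) *\<^sub>R d)))) (at t within S)"
    using DERIV_chain2[OF b F] by (simp add: d_def \<rho>_def)
  from DERIV_divide[OF this DERIV_power[OF \<rho>', of ?N]] \<rho>
  have "((\<lambda>t. mollifier (c + t *\<^sub>R e) (r + t * s) z) has_real_derivative
    (flat_exp 2 (1 - (d \<bullet> d) / \<rho>\<^sup>2) * ((2 / \<rho>\<^sup>2) * (d \<bullet> (e + (s / \<rho>) *\<^sub>R d))) * \<rho> ^ ?N
      - flat_exp 0 (1 - (d \<bullet> d) / \<rho>\<^sup>2) * (real ?N * (s * \<rho> ^ (?N - Suc 0)))) / (\<rho> ^ ?N * \<rho> ^ ?N)) (at t within S)"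
    unfolding mollifier_def by (simp add: \<rho>_def d_def)
  moreover have "\<rho> ^ (?N - Suc 0) = \<rho> ^ ?N / \<rho>"
    using \<rho> by (metis DIM_positive Suc_pred' nonzero_mult_div_cancel_left order_less_irrefl power_Suc One_nat_def)
  ultimately show ?thesis
    unfolding mollifier_rate_def mollifier_velocity_def mollifier_def d_def[symmetric] \<rho>_def[symmetric]
    using \<rho> by (simp add: diff_divide_distrib mult_ac)
qed

lemma mollifier_has_derivative:
  fixes c z :: "'a::euclidean_space"
  assumes "0 < r"
  shows "(mollifier c r has_derivative
    (\<lambda>v. - flat_exp 2 (1 - ((z - c) \<bullet> (z - c)) / r\<^sup>2) * (2 / r\<^sup>2) * ((z - c) \<bullet> v) / r ^ DIM('a))) (at z)"
proof -
  have F: "((\<lambda>z. 1 - ((z - c) \<bullet> (z - c)) / r\<^sup>2) has_derivative (\<lambda>v. - (2 / r\<^sup>2) * ((z - c) \<bullet> v))) (at z)"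
    using assms by (auto intro!: derivative_eq_intros simp: fun_eq_iff inner_commute field_simps)
  have b: "(flat_exp 0 has_derivative (\<lambda>v. flat_exp 2 y * v)) (at y)" for y
    using flat_exp_has_derivative[of 0 y] by (simp add: has_field_derivative_def numeral_2_eq_2)
  have "(mollifier c r has_derivative (\<lambda>v. flat_exp 2 (1 - ((z - c) \<bullet> (z - c)) / r\<^sup>2) * (- (2 / r\<^sup>2) * ((z - c) \<bullet> v)) / r ^ DIM('a))) (at z)"
    unfolding mollifier_def[abs_def]
    by (rule bounded_linear.has_derivative[OF bounded_linear_divide has_derivative_compose[OF F b]])
  then show ?thesis by (simp add: mult.assoc)
qed

text \<open>Product rule: the gradient of the mollifier paired with the velocity gives the first
  part of the rate, and the velocity has constant divergence N s / r. A derivative in the parameters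
  of the ball becomes a spatial one, to which the definition of the weak gradient applies.\<close>

lemma mollifier_flux_divergence:
  fixes c e z :: "'a::euclidean_space"
  assumes r: "0 < r"
  shows "(\<Sum>b\<in>Basis. frechet_derivative (\<lambda>z. mollifier c r z * (mollifier_velocity c r e s z \<bullet> b)) (at z) b)
    = - mollifier_rate c r e s z"
proof -
  let ?V = "mollifier_velocity c r e s z"
  define p where "p = flat_exp 2 (1 - ((z - c) \<bullet> (z - c)) / r\<^sup>2) * (2 / r\<^sup>2) / r ^ DIM('a)"
  have fd: "frechet_derivative (\<lambda>z. mollifier c r z * (mollifier_velocity c r e s z \<bullet> b)) (at z) b
     = mollifier c r z * (s / r) - p * (((z - c) \<bullet> b) * (?V \<bullet> b))" if b: "b \<in> Basis" for b
  proof -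
    have "((\<lambda>z. mollifier_velocity c r e s z \<bullet> b) has_derivative (\<lambda>v. (s / r) * (v \<bullet> b))) (at z)"
      unfolding mollifier_velocity_def by (auto intro!: derivative_eq_intros)
    from has_derivative_mult[OF mollifier_has_derivative[OF r, of c z] this]
    show ?thesis using b by (simp add: frechet_derivative_at[symmetric] p_def)
  qed
  have "(\<Sum>b\<in>Basis. frechet_derivative (\<lambda>z. mollifier c r z * (mollifier_velocity c r e s z \<bullet> b)) (at z) b)
     = (\<Sum>b\<in>(Basis::'a set). mollifier c r z * (s / r) - p * (((z - c) \<bullet> b) * (?V \<bullet> b)))"
    by (intro sum.cong fd) auto
  also have "\<dots> = DIM('a) * (mollifier c r z * (s / r)) - p * ((z - c) \<bullet> ?V)"
    by (subst (3) euclidean_inner) (simp add: sum_subtractf sum_distrib_left)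
  also have "\<dots> = - mollifier_rate c r e s z" by (simp add: mollifier_rate_def p_def)
  finally show ?thesis .
qed

lemma test_function_mollifier_flux:
  assumes "0 < r" "cball c r \<subseteq> \<Omega>"
  shows "test_function \<Omega> (\<lambda>z. mollifier c r z * (mollifier_velocity c r e s z \<bullet> b))"
  unfolding test_function_def
proof (intro conjI allI exI[of _ "cball c r"] impI)
  have "smooth_algebra (\<lambda>z. mollifier c r z * ((e \<bullet> b + - ((s / r) * (c \<bullet> b))) + (s / r) * (z \<bullet> b)))"
    by (intro smooth_algebra.intros smooth_algebra_mollifier)
  also have "(\<lambda>z. mollifier c r z * ((e \<bullet> b + - ((s / r) * (c \<bullet> b))) + (s / r) * (z \<bullet> b)))
    = (\<lambda>z. mollifier c r z * (mollifier_velocity c r e s z \<bullet> b))"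
    by (auto simp: mollifier_velocity_def inner_add_left inner_diff_left algebra_simps)
  finally show "times_differentiable k (\<lambda>z. mollifier c r z * (mollifier_velocity c r e s z \<bullet> b))" for k
    by (rule smooth_algebra_times_differentiable)
  show "mollifier c r z * (mollifier_velocity c r e s z \<bullet> b) = 0" if "z \<notin> cball c r" for z
    using mollifier_eq_0[OF assms(1) that] by simp
qed (use assms in auto)

text \<open>The mean value inequality bounds the difference quotients of k by C, so C |u| is an
  integrable majorant.\<close>

lemma has_derivative_integral_dominated:
  fixes k k' :: "real \<Rightarrow> 'a \<Rightarrow> real"
  assumes u: "integrable M u" and uk: "\<And>t. t \<in> {0..1} \<Longrightarrow> integrable M (\<lambda>z. u z * k t z)"
    and [measurable]: "\<And>t. k t \<in> borel_measurable M" "\<And>t. k' t \<in> borel_measurable M"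
    and deriv: "\<And>t z. t \<in> {0..1} \<Longrightarrow> ((\<lambda>t. k t z) has_field_derivative k' t z) (at t within {0..1})"
    and C: "\<And>t z. t \<in> {0..1} \<Longrightarrow> \<bar>k' t z\<bar> \<le> C" and t: "t \<in> {0..1}"
  shows "((\<lambda>t. LINT z|M. u z * k t z) has_field_derivative (LINT z|M. u z * k' t z)) (at t within {0..1})"
  unfolding has_field_derivative_iff tendsto_at_iff_sequentially
proof (intro allI impI)
  fix X :: "nat \<Rightarrow> real" assume X: "\<forall>i. X i \<in> {0..1} - {t}" "X \<longlonglongrightarrow> t"
  have [measurable]: "u \<in> borel_measurable M" using u by simp
  define f where "f n z = u z * ((k (X n) z - k t z) / (X n - t))" for n z
  have lip: "\<bar>k a z - k b z\<bar> \<le> C * \<bar>a - b\<bar>" if "a \<in> {0..1}" "b \<in> {0..1}" for a b z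
    using field_differentiable_bound[of "{0..1}" "\<lambda>t. k t z" "\<lambda>t. k' t z" C a b] deriv C that by auto
  have "(\<lambda>n. LINT z|M. f n z) \<longlonglongrightarrow> (LINT z|M. u z * k' t z)"
  proof (rule integral_dominated_convergence[where w="\<lambda>z. C * \<bar>u z\<bar>"])
    show "integrable M (\<lambda>z. C * \<bar>u z\<bar>)" using u by simp
    show "AE z in M. (\<lambda>n. f n z) \<longlonglongrightarrow> u z * k' t z"
    proof (rule AE_I2)
      fix z
      have "((\<lambda>s. (k s z - k t z) / (s - t)) \<circ> X) \<longlonglongrightarrow> k' t z"
        using deriv[OF t, of z] X unfolding has_field_derivative_iff tendsto_at_iff_sequentially by blast
      then show "(\<lambda>n. f n z) \<longlonglongrightarrow> u z * k' t z" unfolding f_def comp_def by (intro tendsto_intros)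
    qed
    show "AE z in M. norm (f n z) \<le> C * \<bar>u z\<bar>" for n
    proof (rule AE_I2)
      fix z
      have "\<bar>(k (X n) z - k t z) / (X n - t)\<bar> \<le> C" using lip[of "X n" t z] X t by (auto simp: divide_le_eq)
      then have "\<bar>u z\<bar> * \<bar>(k (X n) z - k t z) / (X n - t)\<bar> \<le> \<bar>u z\<bar> * C" by (intro mult_left_mono) auto
      then show "norm (f n z) \<le> C * \<bar>u z\<bar>" by (simp add: f_def abs_mult mult.commute)
    qed
  qed (unfold f_def, measurable)
  moreover have "(LINT z|M. f n z) = ((LINT z|M. u z * k (X n) z) - (LINT z|M. u z * k t z)) / (X n - t)" for n
  proof -
    have "(LINT z|M. f n z) = (LINT z|M. (u z * k (X n) z - u z * k t z) / (X n - t))"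
      by (simp add: f_def right_diff_distrib)
    also have "\<dots> = (LINT z|M. u z * k (X n) z - u z * k t z) / (X n - t)" by simp
    also have "(LINT z|M. u z * k (X n) z - u z * k t z) = (LINT z|M. u z * k (X n) z) - (LINT z|M. u z * k t z)"
      using X t by (intro Bochner_Integration.integral_diff uk) auto
    finally show ?thesis .
  qed
  ultimately show "((\<lambda>s. ((LINT z|M. u z * k s z) - (LINT z|M. u z * k t z)) / (s - t)) \<circ> X) \<longlonglongrightarrow> (LINT z|M. u z * k' t z)"
    by (simp add: comp_def)
qed

lemma mollifier_velocity_norm_le:
  assumes "0 < r" "z \<in> cball c r"
  shows "norm (mollifier_velocity c r e s z) \<le> norm e + \<bar>s\<bar>"
proof -
  have "norm (mollifier_velocity c r e s z) \<le> norm e + norm ((s / r) *\<^sub>R (z - c))"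
    unfolding mollifier_velocity_def by (rule norm_triangle_ineq)
  also have "norm ((s / r) *\<^sub>R (z - c)) = \<bar>s\<bar> / r * norm (z - c)" using assms by simp
  also have "\<dots> \<le> \<bar>s\<bar> / r * r"
    using assms by (intro mult_left_mono) (auto simp: dist_norm norm_minus_commute)
  finally show ?thesis using assms by simp
qed

text \<open>Only the existence of a uniform bound matters, as a majorant for difference quotients.
  The quantitative estimate is made after integration by parts, when no derivative of the mollifier
  is left.\<close>

lemma mollifier_rate_bounded:
  fixes c e :: "'a::euclidean_space"
  assumes m: "0 < m" "m \<le> T"
  obtains C where "\<And>c r z. m \<le> r \<Longrightarrow> r \<le> T \<Longrightarrow> \<bar>mollifier_rate c r e s (z :: 'a)\<bar> \<le> C"
proof -
  obtain C2 where C2: "0 \<le> C2" "\<And>t. t \<le> 1 \<Longrightarrow> flat_exp 2 t \<le> C2" using flat_exp_bounded by blast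
  define C where "C = C2 * (2 / m\<^sup>2) * (T * (norm e + \<bar>s\<bar>)) / m ^ DIM('a) + DIM('a) * (\<bar>s\<bar> / m) * (1 / m ^ DIM('a))"
  have C0: "0 \<le> C" using C2 m by (simp add: C_def)
  show ?thesis
  proof (rule that[of C])
    fix c z :: 'a and r assume r: "m \<le> r" "r \<le> T"
    then have r0: "0 < r" using m by simp
    show "\<bar>mollifier_rate c r e s z\<bar> \<le> C"
    proof (cases "z \<in> cball c r")
      case False
      then show ?thesis using C0 r0 by (simp add: mollifier_rate_def flat_exp_ball_eq_0 mollifier_eq_0)
    next
      case True
      let ?V = "mollifier_velocity c r e s z" and ?F = "flat_exp 2 (1 - ((z - c) \<bullet> (z - c)) / r\<^sup>2)"
      have F: "\<bar>?F\<bar> \<le> C2" using C2(2) flat_exp_nonneg by simp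
      have "\<bar>(z - c) \<bullet> ?V\<bar> \<le> norm (z - c) * norm ?V" by (rule Cauchy_Schwarz_ineq2)
      also have "\<dots> \<le> T * (norm e + \<bar>s\<bar>)"
        using True r0 r mollifier_velocity_norm_le[OF r0 True, of e s] by (intro mult_mono) (auto simp: dist_norm norm_minus_commute)
      finally have zV: "\<bar>(z - c) \<bullet> ?V\<bar> \<le> T * (norm e + \<bar>s\<bar>)" .
      have p: "m\<^sup>2 \<le> r\<^sup>2" "m ^ DIM('a) \<le> r ^ DIM('a)" using r m by (auto intro: power_mono)
      have "\<bar>?F * (2 / r\<^sup>2) * ((z - c) \<bullet> ?V) / r ^ DIM('a)\<bar> = \<bar>?F\<bar> * (2 / r\<^sup>2) * \<bar>(z - c) \<bullet> ?V\<bar> / r ^ DIM('a)"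
        using r0 by (simp add: abs_mult)
      also have "\<dots> \<le> C2 * (2 / m\<^sup>2) * (T * (norm e + \<bar>s\<bar>)) / m ^ DIM('a)"
        using F zV p m C2 r0 r by (intro frac_le mult_mono divide_left_mono) auto
      finally have 1: "\<bar>?F * (2 / r\<^sup>2) * ((z - c) \<bullet> ?V) / r ^ DIM('a)\<bar> \<le> \<dots>" .
      have "\<bar>DIM('a) * (s / r) * mollifier c r z\<bar> = DIM('a) * (\<bar>s\<bar> / r) * mollifier c r z"
        using r0 mollifier_nonneg[OF r0, of c z] by (simp add: abs_mult)
      also have "\<dots> \<le> DIM('a) * (\<bar>s\<bar> / m) * (1 / m ^ DIM('a))"
      proof (intro mult_mono divide_left_mono)
        have "mollifier c r z \<le> 1 / r ^ DIM('a)" by (rule mollifier_le[OF r0])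
        also have "\<dots> \<le> 1 / m ^ DIM('a)" using p m r0 by (intro divide_left_mono) auto
        finally show "mollifier c r z \<le> 1 / m ^ DIM('a)" .
      qed (use r m r0 mollifier_nonneg[OF r0] in auto)
      finally have 2: "\<bar>DIM('a) * (s / r) * mollifier c r z\<bar> \<le> \<dots>" .
      show ?thesis unfolding mollifier_rate_def C_def using 1 2
        by (intro order_trans[OF abs_triangle_ineq4] add_mono)
    qed
  qed
qed

section \<open>Integration by parts along a moving ball\<close>

context bounded_domain
begin

lemma integrable_mult_continuous:
  assumes u: "integrable M u" and h: "continuous_on UNIV (h :: 'a \<Rightarrow> real)"
  shows "integrable M (\<lambda>z. u z * h z)"
proof -
  have "compact (h ` closure \<Omega>)"
    using bounded_domain by (intro compact_continuous_image continuous_on_subset[OF h]) (auto simp: compact_closure)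
  then obtain C where C: "\<And>y. y \<in> h ` closure \<Omega> \<Longrightarrow> norm y \<le> C" using compact_imp_bounded bounded_iff by metis
  have hC: "\<bar>h z\<bar> \<le> C" if "z \<in> \<Omega>" for z using C[of "h z"] that closure_subset by auto
  have "h \<in> borel_measurable borel" using h by (rule borel_measurable_continuous_onI)
  then have [measurable]: "h \<in> borel_measurable M" using measurable_compose[OF measurable_id_borel] by simp
  have [measurable]: "u \<in> borel_measurable M" using u by simp
  show ?thesis
  proof (rule Bochner_Integration.integrable_bound[of M "\<lambda>z. C * u z"])
    show "AE z in M. norm (u z * h z) \<le> norm (C * u z)"
    proof (rule AE_I2)
      fix z assume "z \<in> space M"
      then have "\<bar>h z\<bar> \<le> \<bar>C\<bar>" using hC[of z] by simp
      then show "norm (u z * h z) \<le> norm (C * u z)" by (simp add: abs_mult mult.commute mult_right_mono)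
    qed
  qed (use u in auto)
qed

lemma continuous_mollifier: "continuous_on UNIV (mollifier c r)"
  using smooth_algebra_times_differentiable[OF smooth_algebra_mollifier, of 0] by simp

lemma integrable_mult_mollifier: "integrable M u \<Longrightarrow> integrable M (\<lambda>z. u z * mollifier c r z)"
  by (intro integrable_mult_continuous continuous_mollifier)

text \<open>Each component of mollifier times velocity is a test function. Summed over the
  coordinates, the weak derivative identities give the divergence on the side of u and the inner
  product with the velocity on the side of g.\<close>

lemma weak_gradient_mollifier_rate:
  assumes wg: "has_weak_gradient \<Omega> u g" and u: "integrable M u" and g: "integrable M g"
    and r: "0 < r" "cball c r \<subseteq> \<Omega>"
  shows "(LINT z|M. u z * mollifier_rate c r e s z)
    = (LINT z|M. (g z \<bullet> mollifier_velocity c r e s z) * mollifier c r z)"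
proof -
  let ?V = "mollifier_velocity c r e s"
  let ?\<phi> = "\<lambda>b z. mollifier c r z * (?V z \<bullet> b)"
  have test: "test_function \<Omega> (?\<phi> b)" for b using r by (rule test_function_mollifier_flux)
  have cont: "continuous_on UNIV (?\<phi> b)" for b using test[of b] by (auto simp: test_function_def dest!: spec[of _ "0::nat"])
  have cont': "continuous_on UNIV (\<lambda>z. frechet_derivative (?\<phi> b) (at z) b)" if b: "b \<in> Basis" for b
  proof -
    have "times_differentiable (Suc 0) (?\<phi> b)" using test[of b] by (simp only: test_function_def)
    then show ?thesis using b by simp
  qed
  have gb: "integrable M (\<lambda>z. g z \<bullet> b)" for b using g by simp
  have "(LINT z|M. u z * mollifier_rate c r e s z) = (LINT z|M. - (\<Sum>b\<in>Basis. u z * frechet_derivative (?\<phi> b) (at z) b))"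
    by (simp add: sum_distrib_left[symmetric] mollifier_flux_divergence[OF r(1)])
  also have "\<dots> = - (\<Sum>b\<in>Basis. LINT z|M. u z * frechet_derivative (?\<phi> b) (at z) b)"
    by (simp add: Bochner_Integration.integral_sum integrable_mult_continuous[OF u cont'])
  also have "\<dots> = (\<Sum>b\<in>Basis. LINT z|M. (g z \<bullet> b) * ?\<phi> b z)"
    using wg test unfolding has_weak_gradient_def by (simp add: sum_negf)
  also have "\<dots> = (LINT z|M. (\<Sum>b\<in>Basis. (g z \<bullet> b) * ?\<phi> b z))"
    by (rule Bochner_Integration.integral_sum[symmetric]) (rule integrable_mult_continuous[OF gb cont])
  also have "\<dots> = (LINT z|M. (g z \<bullet> ?V z) * mollifier c r z)"
  proof (intro Bochner_Integration.integral_cong refl)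
    fix z
    have "(\<Sum>b\<in>Basis. (g z \<bullet> b) * (?V z \<bullet> b)) = g z \<bullet> ?V z" by (rule euclidean_inner[symmetric])
    moreover have "(\<Sum>b\<in>Basis. (g z \<bullet> b) * ?\<phi> b z) = (\<Sum>b\<in>Basis. (g z \<bullet> b) * (?V z \<bullet> b) * mollifier c r z)"
      by (intro sum.cong refl) simp
    ultimately show "(\<Sum>b\<in>Basis. (g z \<bullet> b) * ?\<phi> b z) = (g z \<bullet> ?V z) * mollifier c r z"
      by (simp only: sum_distrib_right[symmetric])
  qed
  finally show ?thesis .
qed

text \<open>Mean value inequality in the path parameter. On the ball the velocity is at most |e| +
  |s| and the mollifier at most 1 / m^N, so only the gradient over the swept region remains. Just
  the balls along the path have to stay inside \<Omega>, not the segment between the points whose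
  values are compared in the end.\<close>

lemma mollified_average_path:
  assumes wg: "has_weak_gradient \<Omega> u g" and u: "integrable M u" and g: "integrable M g" and m: "0 < m"
    and path: "\<And>t. t \<in> {0..1} \<Longrightarrow> m \<le> r + t * s \<and> cball (c + t *\<^sub>R e) (r + t * s) \<subseteq> \<Omega> \<inter> cball x \<rho>"
  shows "\<bar>(LINT z|M. u z * mollifier (c + e) (r + s) z) - (LINT z|M. u z * mollifier c r z)\<bar>
    \<le> (norm e + \<bar>s\<bar>) / m ^ DIM('a) * (LINT z|M. norm (g z) * indicator (cball x \<rho>) z)"
proof -
  let ?K = "(norm e + \<bar>s\<bar>) / m ^ DIM('a)"
  have [measurable]: "u \<in> borel_measurable M" "g \<in> borel_measurable M" using u g by auto
  define k where "k t z = mollifier (c + t *\<^sub>R e) (r + t * s) z" for t z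
  define k' where "k' t z = mollifier_rate (c + t *\<^sub>R e) (r + t * s) e s z" for t z
  have [measurable]: "k t \<in> borel_measurable M" for t
    unfolding k_def using measurable_compose[OF measurable_id_borel measurable_mollifier] by simp
  have "mollifier_rate c r e s \<in> borel_measurable borel" for c r
    unfolding mollifier_rate_def mollifier_velocity_def by measurable
  then have [measurable]: "k' t \<in> borel_measurable M" for t
    unfolding k'_def using measurable_compose[OF measurable_id_borel] by simp
  have radius: "m \<le> r + t * s" "0 < r + t * s" "r + t * s \<le> \<bar>r\<bar> + \<bar>s\<bar> + m" if "t \<in> {0..1}" for t
  proof -
    show *: "m \<le> r + t * s" using path that by blast
    then show "0 < r + t * s" using m by linarith
    have "t * s \<le> t * \<bar>s\<bar>" using that by (intro mult_left_mono) auto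
    also have "\<dots> \<le> 1 * \<bar>s\<bar>" using that by (intro mult_right_mono) auto
    finally have "t * s \<le> \<bar>s\<bar>" by simp
    then show "r + t * s \<le> \<bar>r\<bar> + \<bar>s\<bar> + m" using m by linarith
  qed
  have mT: "m \<le> \<bar>r\<bar> + \<bar>s\<bar> + m" by simp
  obtain C where C: "\<And>c r' z. m \<le> r' \<Longrightarrow> r' \<le> \<bar>r\<bar> + \<bar>s\<bar> + m \<Longrightarrow> \<bar>mollifier_rate c r' e s z\<bar> \<le> C"
    by (rule mollifier_rate_bounded[OF m mT, of e s]) (rule that)
  have deriv: "((\<lambda>t. LINT z|M. u z * k t z) has_field_derivative (LINT z|M. u z * k' t z)) (at t within {0..1})"
    if t: "t \<in> {0..1}" for t
  proof (rule has_derivative_integral_dominated[OF u _ _ _ _ _ t])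
    show "integrable M (\<lambda>z. u z * k t z)" for t unfolding k_def by (rule integrable_mult_mollifier[OF u])
    show "((\<lambda>t. k t z) has_field_derivative k' t z) (at t within {0..1})" if "t \<in> {0..1}" for t z
      unfolding k_def k'_def using radius(2)[OF that] by (rule mollifier_has_rate)
    show "\<bar>k' t z\<bar> \<le> C" if "t \<in> {0..1}" for t z unfolding k'_def using radius[OF that] by (intro C)
  qed measurable
  have [measurable]: "(\<lambda>z. indicator (cball x \<rho>) z :: real) \<in> borel_measurable M"
    by (rule measurable_compose[OF measurable_id_borel]) (intro borel_measurable_indicator borel_closed closed_cball)
  have "integrable M (\<lambda>z. norm (g z) * indicator (cball x \<rho>) z)"
    by (rule Bochner_Integration.integrable_bound[of M "\<lambda>z. norm (g z)"])
      (use g in \<open>auto split: split_indicator\<close>)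
  then have gi: "integrable M (\<lambda>z. ?K * (norm (g z) * indicator (cball x \<rho>) z))" by simp
  have bound: "norm (LINT z|M. u z * k' t z) \<le> ?K * (LINT z|M. norm (g z) * indicator (cball x \<rho>) z)" if t: "t \<in> {0..1}" for t
  proof -
    define ct rt where "ct = c + t *\<^sub>R e" and "rt = r + t * s"
    have rt: "0 < rt" "m \<le> rt" "cball ct rt \<subseteq> \<Omega>" "cball ct rt \<subseteq> cball x \<rho>"
      using radius[OF t] path[OF t] by (auto simp: ct_def rt_def)
    have "(LINT z|M. u z * k' t z) = (LINT z|M. (g z \<bullet> mollifier_velocity ct rt e s z) * mollifier ct rt z)"
      unfolding k'_def ct_def[symmetric] rt_def[symmetric] by (rule weak_gradient_mollifier_rate[OF wg u g rt(1,3)])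
    also have "norm \<dots> \<le> (LINT z|M. ?K * (norm (g z) * indicator (cball x \<rho>) z))"
    proof -
      have bd: "norm ((g z \<bullet> mollifier_velocity ct rt e s z) * mollifier ct rt z) \<le> ?K * (norm (g z) * indicator (cball x \<rho>) z)" for z
      proof (cases "z \<in> cball ct rt")
        case True
        have "\<bar>g z \<bullet> mollifier_velocity ct rt e s z\<bar> \<le> norm (g z) * norm (mollifier_velocity ct rt e s z)"
          by (rule Cauchy_Schwarz_ineq2)
        also have "\<dots> \<le> norm (g z) * (norm e + \<bar>s\<bar>)" by (intro mult_left_mono mollifier_velocity_norm_le rt True) auto
        finally have 1: "\<bar>g z \<bullet> mollifier_velocity ct rt e s z\<bar> \<le> norm (g z) * (norm e + \<bar>s\<bar>)" .
        have "mollifier ct rt z \<le> 1 / rt ^ DIM('a)" using rt(1) by (rule mollifier_le)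
        also have "\<dots> \<le> 1 / m ^ DIM('a)" using rt m by (intro divide_left_mono power_mono) auto
        finally have "\<bar>mollifier ct rt z\<bar> \<le> 1 / m ^ DIM('a)" using mollifier_nonneg[OF rt(1), of ct z] by simp
        with 1 have "\<bar>g z \<bullet> mollifier_velocity ct rt e s z\<bar> * \<bar>mollifier ct rt z\<bar> \<le> (norm (g z) * (norm e + \<bar>s\<bar>)) * (1 / m ^ DIM('a))"
          by (intro mult_mono) auto
        moreover have "z \<in> cball x \<rho>" using True rt(4) by blast
        ultimately show ?thesis by (simp add: abs_mult mult_ac)
      next
        case False
        then show ?thesis using m by (simp add: mollifier_eq_0[OF rt(1)])
      qed
      have "mollifier_velocity ct rt e s \<in> borel_measurable borel" unfolding mollifier_velocity_def by measurable
      then have [measurable]: "mollifier_velocity ct rt e s \<in> borel_measurable M" using measurable_compose[OF measurable_id_borel] by simp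
      have [measurable]: "mollifier ct rt \<in> borel_measurable M" using measurable_compose[OF measurable_id_borel measurable_mollifier] by simp
      have "integrable M (\<lambda>z. (g z \<bullet> mollifier_velocity ct rt e s z) * mollifier ct rt z)"
      proof (rule Bochner_Integration.integrable_bound[OF gi])
        show "AE z in M. norm ((g z \<bullet> mollifier_velocity ct rt e s z) * mollifier ct rt z) \<le> norm (?K * (norm (g z) * indicator (cball x \<rho>) z))"
          by (intro AE_I2 order_trans[OF bd]) (simp only: real_norm_def abs_ge_self)
      qed measurable
      then show ?thesis by (rule Bochner_Integration.integral_norm_bound_integral[OF _ gi bd])
    qed
    finally show ?thesis by simp
  qed
  have "norm ((LINT z|M. u z * k 1 z) - (LINT z|M. u z * k 0 z)) \<le> ?K * (LINT z|M. norm (g z) * indicator (cball x \<rho>) z) * norm (1 - 0 :: real)"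
    by (rule field_differentiable_bound[of "{0..1}"]) (use deriv bound in auto)
  then show ?thesis by (simp add: k_def)
qed

end

text \<open>Boxes form an intersection-stable generator of the Borel sets. The support in one box
  turns the integral over the whole space into a box integral, as the complement step of the
  induction demands.\<close>

lemma AE_zero_of_box_integrals:
  fixes g :: "'a::euclidean_space \<Rightarrow> real"
  assumes g: "integrable lborel g" and off: "\<And>x. x \<notin> box p q \<Longrightarrow> g x = 0"
    and box: "\<And>a b. (LINT x:box a b|lborel. g x) = 0"
  shows "AE x in lborel. g x = 0"
proof (rule density_unique_real[OF g integrable_zero])
  have all: "(LINT x|lborel. g x) = 0"
  proof -
    have "(LINT x|lborel. g x) = (LINT x:box p q|lborel. g x)"
      unfolding set_lebesgue_integral_def using off
      by (intro Bochner_Integration.integral_cong) (auto split: split_indicator)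
    then show ?thesis using box by simp
  qed
  fix A :: "'a set" assume "A \<in> sets lborel"
  then have A: "A \<in> sigma_sets UNIV (range (\<lambda>(a, b). box a b))" by (simp add: borel_eq_box)
  have pow: "range (\<lambda>(a, b). box a b :: 'a set) \<subseteq> Pow UNIV" by simp
  have "Int_stable (range (\<lambda>(a, b). box a b :: 'a set))"
  proof (rule Int_stableI)
    fix A B :: "'a set" assume "A \<in> range (\<lambda>(a, b). box a b)" "B \<in> range (\<lambda>(a, b). box a b)"
    then obtain a b c d where "A = box a b" "B = box c d" by auto
    moreover obtain p q where "box a b \<inter> box c d = box p q" by (rule that[OF box_Int_box])
    ultimately show "A \<inter> B \<in> range (\<lambda>(a, b). box a b)" by auto
  qed
  from this pow A have "(LINT x:A|lborel. g x) = 0"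
  proof (induction rule: sigma_sets_induct_disjoint)
    case (basic A)
    then obtain a b where "A = box a b" by auto
    then show ?case using box by simp
  next
    case (compl A)
    then have A: "A \<in> sets lborel" by (simp add: borel_eq_box)
    have i: "set_integrable lborel A g" "set_integrable lborel (UNIV - A) g"
      unfolding set_integrable_def using A g by (intro integrable_mult_indicator; simp)+
    have "(LINT x|lborel. g x) = (LINT x:A \<union> (UNIV - A)|lborel. g x)"
      by (simp add: set_lebesgue_integral_def)
    also have "\<dots> = (LINT x:A|lborel. g x) + (LINT x:(UNIV - A)|lborel. g x)"
      using A i by (intro set_integral_Un) auto
    finally show ?case using all compl by simp
  next
    case (union A)
    then have A: "A i \<in> sets lborel" for i by (auto simp: borel_eq_box)
    have "set_integrable lborel (\<Union>i. A i) g"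
      unfolding set_integrable_def using A g by (intro integrable_mult_indicator) auto
    then have "(LINT x:(\<Union>i. A i)|lborel. g x) = (\<Sum>i. LINT x:A i|lborel. g x)"
      using union A by (intro lebesgue_integral_countable_add) (auto simp: disjoint_family_on_def)
    then show ?case using union by simp
  qed (auto simp: set_lebesgue_integral_def)
  then show "(LINT x:A|lborel. g x) = (LINT x:A|lborel. 0)" by (simp add: set_lebesgue_integral_def)
qed

lemma nn_integral_mollifier:
  fixes c :: "'a::euclidean_space"
  assumes t: "0 < t"
  shows "(\<integral>\<^sup>+y. ennreal (mollifier c t y) \<partial>lborel) = (\<integral>\<^sup>+y. ennreal (mollifier 0 1 (y :: 'a)) \<partial>lborel)"
proof -
  have "(\<integral>\<^sup>+y. ennreal (mollifier c t y) \<partial>lborel)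
     = (\<integral>\<^sup>+y. ennreal (mollifier c t y) \<partial>density (distr lborel borel (\<lambda>x. c + t *\<^sub>R x)) (\<lambda>_. ennreal (\<bar>t\<bar> ^ DIM('a))))"
    using t by (subst lborel_affine[of t c]) auto
  also have "\<dots> = (\<integral>\<^sup>+x. ennreal (\<bar>t\<bar> ^ DIM('a)) * ennreal (mollifier c t (c + t *\<^sub>R x)) \<partial>lborel)"
    by (simp add: nn_integral_density nn_integral_distr)
  also have "\<dots> = (\<integral>\<^sup>+x. ennreal (mollifier 0 1 (x :: 'a)) \<partial>lborel)"
    using t by (intro nn_integral_cong) (simp add: mollifier_def flat_exp_nonneg power2_eq_square flip: ennreal_mult)
  finally show ?thesis .
qed

definition mollifier_mass :: "'a::euclidean_space itself \<Rightarrow> real" where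
  "mollifier_mass _ = (LINT y|lborel. mollifier 0 1 (y :: 'a))"

text \<open>Finite because the bump is at most 1 with support in the unit ball, positive because it
  does not vanish in the open ball.\<close>

lemma nn_integral_mollifier_unit:
  "(\<integral>\<^sup>+y. ennreal (mollifier 0 1 (y :: 'a::euclidean_space)) \<partial>lborel) = ennreal (mollifier_mass TYPE('a))"
  "0 < mollifier_mass TYPE('a)"
proof -
  have m1: "mollifier 0 1 y \<le> 1" for y :: 'a using mollifier_le[of 1 0 y] by simp
  have m0: "0 \<le> mollifier 0 1 y" for y :: 'a by (simp add: mollifier_nonneg)
  have "(\<integral>\<^sup>+y. ennreal (mollifier 0 1 (y :: 'a)) \<partial>lborel) \<le> (\<integral>\<^sup>+y. indicator (cball 0 1) (y :: 'a) \<partial>lborel)"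
    using m1 by (intro nn_integral_mono) (auto split: split_indicator simp: mollifier_eq_0)
  also have "\<dots> < \<infinity>" by (simp add: emeasure_cball)
  finally have fin: "(\<integral>\<^sup>+y. ennreal (mollifier 0 1 (y :: 'a)) \<partial>lborel) < \<infinity>" .
  have mm: "mollifier_mass TYPE('a) = enn2real (\<integral>\<^sup>+y. ennreal (mollifier 0 1 (y :: 'a)) \<partial>lborel)"
    unfolding mollifier_mass_def by (rule integral_eq_nn_integral) (auto simp: m0)
  show eq: "(\<integral>\<^sup>+y. ennreal (mollifier 0 1 (y :: 'a::euclidean_space)) \<partial>lborel) = ennreal (mollifier_mass TYPE('a))"
    unfolding mm using fin by simp
  have "(\<integral>\<^sup>+y. ennreal (mollifier 0 1 (y :: 'a)) \<partial>lborel) \<noteq> 0"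
  proof
    assume "(\<integral>\<^sup>+y. ennreal (mollifier 0 1 (y :: 'a)) \<partial>lborel) = 0"
    then have "AE y in lborel. ennreal (mollifier 0 1 (y :: 'a)) = 0" by (subst (asm) nn_integral_0_iff_AE) auto
    then have "AE y in lborel. (y :: 'a) \<notin> ball 0 1"
    proof eventually_elim
      case (elim y)
      have "0 < mollifier 0 1 y" if "norm y < 1"
      proof -
        have "(norm y)\<^sup>2 < 1\<^sup>2" using that by (intro power_strict_mono) auto
        then have "y \<bullet> y < 1" by (simp add: power2_norm_eq_inner)
        then show ?thesis by (simp add: mollifier_def flat_exp_def)
      qed
      with elim show ?case using m0[of y] by force
    qed
    then have "emeasure lborel (ball 0 1 :: 'a set) = 0"
      by (subst (asm) AE_iff_measurable[of "ball 0 1"]) auto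
    then show False using unit_ball_vol_pos[of "real DIM('a)"] by (simp add: emeasure_ball)
  qed
  with eq show "0 < mollifier_mass TYPE('a)" using mm by (cases "mollifier_mass TYPE('a) = 0") (auto simp: less_le)
qed

section \<open>Identifying the limit of mollified averages\<close>

context bounded_domain
begin

lemma integral_domain_box:
  fixes f :: "'a \<Rightarrow> real"
  assumes "box a b \<subseteq> \<Omega>" "f \<in> borel_measurable borel"
  shows "(LINT y|M. indicator (box a b) y * f y) = (LINT y|lborel. indicator (box a b) y * f y)"
proof -
  have "(LINT y|M. indicator (box a b) y * f y) = (LINT y|lebesgue. indicator \<Omega> y *\<^sub>R (indicator (box a b) y * f y))"
    using open_domain by (intro integral_restrict_space) auto
  also have "\<dots> = (LINT y|lebesgue. indicator (box a b) y * f y)"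
    using assms(1) by (intro Bochner_Integration.integral_cong refl) (simp add: indicator_def subset_iff)
  also have "\<dots> = (LINT y|lborel. indicator (box a b) y * f y)"
  proof (rule integral_completion)
    have [measurable]: "f \<in> borel_measurable lborel" using assms(2) by simp
    show "(\<lambda>y. indicator (box a b) y * f y) \<in> borel_measurable lborel" by measurable
  qed
  finally show ?thesis .
qed

text \<open>On each box the function is replaced by a Borel version, to which the criterion on the
  whole space applies; countably many rational boxes exhaust S.\<close>

lemma AE_zero_on_open_of_box_integrals:
  fixes f :: "'a \<Rightarrow> real"
  assumes f: "integrable M f" and S: "open S" "S \<subseteq> \<Omega>"
    and box: "\<And>a b. box a b \<subseteq> S \<Longrightarrow> (LINT x|M. indicator (box a b) x * f x) = 0"
  shows "AE x in M. x \<in> S \<longrightarrow> f x = 0"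
proof -
  have one: "AE x in M. x \<in> box a b \<longrightarrow> f x = 0" if ab: "box a b \<subseteq> S" for a b
  proof -
    define h where "h x = indicator \<Omega> x * f x" for x
    have hI: "integrable lebesgue h"
      using f open_domain by (subst (asm) integrable_restrict_space) (auto simp: h_def[abs_def])
    then obtain h' where h' [measurable]: "h' \<in> borel_measurable lborel" and AEh: "AE x in lborel. h x = h' x"
      using completion_ex_borel_measurable_real[of h lborel] by auto
    have AEh': "AE x in lebesgue. h x = h' x" using AEh by (rule AE_completion)
    have h'm: "h' \<in> borel_measurable lebesgue" by (rule measurable_completion) simp
    have "integrable lebesgue h'" using hI AEh' h'm by (subst integrable_cong_AE[of _ _ h]) auto
    then have h'I: "integrable lborel h'" by (subst (asm) integrable_completion) auto
    define g where "g x = indicator (box a b) x * h' x" for x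
    have "AE x in lborel. g x = 0"
    proof (rule AE_zero_of_box_integrals[where p=a and q=b])
      show "integrable lborel g"
        unfolding g_def using integrable_mult_indicator[OF _ h'I, of "box a b"] by simp
      show "g x = 0" if "x \<notin> box a b" for x using that by (simp add: g_def)
      fix c d
      obtain a' b' where ab': "box c d \<inter> box a b = box a' b'" by (simp add: box_Int_box)
      then have sub: "box a' b' \<subseteq> S" using ab by blast
      have "(LINT x:box c d|lborel. g x) = (LINT x|lborel. indicator (box a' b') x * h' x)"
        unfolding set_lebesgue_integral_def g_def ab'[symmetric]
        by (intro Bochner_Integration.integral_cong) (auto split: split_indicator)
      also have "\<dots> = (LINT x|lebesgue. indicator (box a' b') x * h' x)"
        by (rule integral_completion[symmetric]) measurable
      also have "\<dots> = (LINT x|lebesgue. indicator (box a' b') x * h x)"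
      proof (rule integral_cong_AE)
        show "(\<lambda>x. indicator (box a' b') x * h' x) \<in> borel_measurable lebesgue"
          by (intro borel_measurable_times borel_measurable_indicator h'm) auto
        show "(\<lambda>x. indicator (box a' b') x * h x) \<in> borel_measurable lebesgue"
          using hI by (intro borel_measurable_times borel_measurable_indicator) auto
        show "AE x in lebesgue. indicator (box a' b') x * h' x = indicator (box a' b') x * h x"
          using AEh' by eventually_elim simp
      qed
      also have "\<dots> = (LINT x|lebesgue. indicator \<Omega> x *\<^sub>R (indicator (box a' b') x * f x))"
        by (intro Bochner_Integration.integral_cong) (auto simp: h_def)
      also have "\<dots> = (LINT x|M. indicator (box a' b') x * f x)"
        using open_domain by (intro integral_restrict_space[symmetric]) auto
      also have "\<dots> = 0" by (rule box[OF sub])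
      finally show "(LINT x:box c d|lborel. g x) = 0" .
    qed
    with AEh have "AE x in lborel. x \<in> box a b \<longrightarrow> h x = 0" by eventually_elim (auto simp: g_def)
    then have "AE x in lebesgue. x \<in> box a b \<longrightarrow> h x = 0" by (rule AE_completion)
    then have "AE x in lebesgue. x \<in> \<Omega> \<longrightarrow> (x \<in> box a b \<longrightarrow> f x = 0)" by eventually_elim (auto simp: h_def)
    then show ?thesis using open_domain by (subst AE_restrict_space_iff) auto
  qed
  obtain I and a b :: "('a \<Rightarrow> real \<times> real) \<Rightarrow> 'a" where I: "countable I" "\<And>i. i \<in> I \<Longrightarrow> box (a i) (b i) \<subseteq> S" "S = (\<Union>i\<in>I. box (a i) (b i))"
  proof -
    define I where "I = {f \<in> Basis \<rightarrow>\<^sub>E \<rat> \<times> \<rat>. box (\<Sum>(i::'a)\<in>Basis. fst (f i) *\<^sub>R i) (\<Sum>(i::'a)\<in>Basis. snd (f i) *\<^sub>R i) \<subseteq> S}"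
    have "countable I" unfolding I_def
      by (rule countable_subset[of _ "Basis \<rightarrow>\<^sub>E \<rat> \<times> \<rat>"]) (auto simp: countable_PiE countable_rat)
    then show ?thesis using open_UNION_box[OF S(1)] by (intro that[of I "\<lambda>f. \<Sum>i\<in>Basis. fst (f i) *\<^sub>R i" "\<lambda>f. \<Sum>i\<in>Basis. snd (f i) *\<^sub>R i"]) (auto simp: I_def)
  qed
  have "AE x in M. \<forall>i\<in>I. x \<in> box (a i) (b i) \<longrightarrow> f x = 0"
    using I one by (intro AE_ball_countable') auto
  then show ?thesis by eventually_elim (use I(3) in blast)
qed

lemma integrable_double_mollifier:
  assumes u: "integrable M u" and t: "0 < t" and B: "B \<in> sets borel"
  shows "integrable (M \<Otimes>\<^sub>M M) (\<lambda>(y, z). indicator B y * (u z * mollifier (y + v) t z) :: real)"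
proof -
  have [measurable]: "u \<in> borel_measurable M" using u by simp
  have [measurable]: "(\<lambda>y. indicator B y :: real) \<in> borel_measurable M"
    using measurable_compose[OF measurable_id_borel borel_measurable_indicator[OF B]] .
  have m [measurable]: "(\<lambda>(y, z). indicator B y * (u z * mollifier (y + v) t z)) \<in> borel_measurable (M \<Otimes>\<^sub>M M)"
    unfolding mollifier_def by measurable
  show ?thesis
  proof (rule integrableI_bounded[OF m])
    have "(\<integral>\<^sup>+p. ennreal (norm (case p of (y, z) \<Rightarrow> indicator B y * (u z * mollifier (y + v) t z))) \<partial>(M \<Otimes>\<^sub>M M))
      = (\<integral>\<^sup>+y. (\<integral>\<^sup>+z. ennreal (norm (indicator B y * (u z * mollifier (y + v) t z))) \<partial>M) \<partial>M)"
      by (subst nn_integral_fst[symmetric]) auto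
    also have "\<dots> \<le> (\<integral>\<^sup>+y. (\<integral>\<^sup>+z. ennreal (1 / t ^ DIM('a)) * ennreal (norm (u z)) \<partial>M) \<partial>M)"
    proof (intro nn_integral_mono)
      fix y z
      have "\<bar>indicator B y\<bar> * (\<bar>u z\<bar> * \<bar>mollifier (y + v) t z\<bar>) \<le> 1 * (\<bar>u z\<bar> * (1 / t ^ DIM('a)))"
        using mollifier_le[OF t, of "y + v" z] mollifier_nonneg[OF t, of "y + v" z]
        by (intro mult_mono) (auto split: split_indicator)
      then show "ennreal (norm (indicator B y * (u z * mollifier (y + v) t z))) \<le> ennreal (1 / t ^ DIM('a)) * ennreal (norm (u z))"
        using t by (simp add: abs_mult mult.commute ennreal_leI flip: ennreal_mult)
    qed
    also have "\<dots> = ennreal (1 / t ^ DIM('a)) * (\<integral>\<^sup>+z. ennreal (norm (u z)) \<partial>M) * emeasure M \<Omega>"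
      by (simp add: nn_integral_cmult)
    also have "\<dots> < \<infinity>"
      using u by (simp add: integrable_iff_bounded emeasure_eq_measure ennreal_mult_less_top)
    finally show "(\<integral>\<^sup>+p. ennreal (norm (case p of (y, z) \<Rightarrow> indicator B y * (u z * mollifier (y + v) t z))) \<partial>(M \<Otimes>\<^sub>M M)) < \<infinity>" .
  qed
qed

text \<open>In the variable y the mollifier is centred at z - v, which is the view after exchanging
  the order of integration.\<close>

lemma mollifier_shift: "mollifier (y + v) t z = mollifier (z - v) t y"
proof -
  have "z - (y + v) = - (y - (z - v))" by simp
  then show ?thesis unfolding mollifier_def by (simp only: inner_minus_left inner_minus_right minus_minus)
qed

lemma box_weight:
  fixes z v :: 'a
  assumes t: "0 < t" and ab: "box a b \<subseteq> \<Omega>"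
  defines "W \<equiv> LINT y|M. indicator (box a b) y * mollifier (y + v) t z"
  shows "\<bar>W\<bar> \<le> mollifier_mass TYPE('a)"
    and "cball (z - v) t \<subseteq> box a b \<Longrightarrow> W = mollifier_mass TYPE('a)"
    and "cball (z - v) t \<inter> box a b = {} \<Longrightarrow> W = 0"
proof -
  let ?m = "mollifier (z - v) t"
  have W: "W = (LINT y|lborel. indicator (box a b) y * ?m y)"
    unfolding W_def mollifier_shift[of _ v] by (rule integral_domain_box[OF ab]) measurable
  have nn: "(\<integral>\<^sup>+y. ennreal (?m y) \<partial>lborel) = ennreal (mollifier_mass TYPE('a))"
    using nn_integral_mollifier[OF t] nn_integral_mollifier_unit(1) by metis
  have m0: "0 \<le> ?m y" for y using t by (rule mollifier_nonneg)
  have int: "integrable lborel ?m" using nn m0 by (intro integrableI_nonneg) auto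
  have mass: "(LINT y|lborel. ?m y) = mollifier_mass TYPE('a)"
    using nn m0 nn_integral_mollifier_unit(2)[where 'a='a] by (subst integral_eq_nn_integral) auto
  have intb: "integrable lborel (\<lambda>y. indicator (box a b) y * ?m y)"
    using integrable_mult_indicator[OF _ int, of "box a b"] by simp
  have "W \<le> (LINT y|lborel. ?m y)" unfolding W
    by (intro integral_mono[OF intb int]) (auto split: split_indicator simp: m0)
  moreover have "0 \<le> W" unfolding W by (intro Bochner_Integration.integral_nonneg) (simp add: m0)
  ultimately show "\<bar>W\<bar> \<le> mollifier_mass TYPE('a)" using mass by simp
  show "W = mollifier_mass TYPE('a)" if "cball (z - v) t \<subseteq> box a b"
  proof -
    have "indicator (box a b) y * ?m y = ?m y" for y
      using subsetD[OF that, of y] mollifier_eq_0[OF t, of y "z - v"] by (auto split: split_indicator)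
    then show ?thesis unfolding W mass[symmetric] by (simp only:)
  qed
  show "W = 0" if "cball (z - v) t \<inter> box a b = {}"
  proof -
    have "indicator (box a b) y * ?m y = 0" for y
    proof -
      have "y \<notin> cball (z - v) t \<or> y \<notin> box a b" using that by blast
      then show ?thesis using mollifier_eq_0[OF t, of y "z - v"] by (auto split: split_indicator)
    qed
    then have "W = (LINT y|(lborel :: 'a measure). 0)" unfolding W by (simp only:)
    then show ?thesis by simp
  qed
qed

end

context bounded_domain
begin

text \<open>The limit is identified without a differentiation theorem for integrals. Over a box, the
  integrals of the averages tend to that of their limit w by dominated convergence. By Fubini they
  are also integrals of u against weights W k, which tend to the mass inside the box and to 0 off
  its closure. Hence w and the mass times u have the same integral over every box in S.\<close>

lemma mollified_average_limit:
  fixes t :: "nat \<Rightarrow> real" and v :: 'a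
  assumes u: "integrable M u" and S: "open S" "S \<subseteq> \<Omega>" and t: "\<And>k. 0 < t k" "t \<longlonglongrightarrow> 0"
    and H: "integrable M H"
  defines "A \<equiv> \<lambda>k y. LINT z|M. u z * mollifier (y + t k *\<^sub>R v) (t k) z"
  assumes conv: "AE y in M. y \<in> S \<longrightarrow> convergent (\<lambda>k. A k y)"
    and bound: "AE y in M. y \<in> S \<longrightarrow> (\<forall>k. \<bar>A k y\<bar> \<le> H y)"
  shows "AE y in M. y \<in> S \<longrightarrow> (\<lambda>k. A k y) \<longlonglongrightarrow> mollifier_mass TYPE('a) * u y"
proof -
  let ?m = "mollifier_mass TYPE('a)"
  have [measurable]: "u \<in> borel_measurable M" "H \<in> borel_measurable M" using u H by auto
  have iS [measurable]: "(\<lambda>y. indicator S y :: real) \<in> borel_measurable M"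
    by (rule measurable_compose[OF measurable_id_borel]) (intro borel_measurable_indicator borel_open S)
  have Am [measurable]: "A k \<in> borel_measurable M" for k
  proof -
    have "(\<lambda>(y, z). u z * mollifier (y + t k *\<^sub>R v) (t k) z) \<in> borel_measurable (M \<Otimes>\<^sub>M M)"
      unfolding mollifier_def by measurable
    then show ?thesis unfolding A_def by (rule borel_measurable_lebesgue_integral)
  qed
  define w where "w y = lim (\<lambda>k. A k y)" for y
  have [measurable]: "w \<in> borel_measurable M" unfolding w_def by measurable
  have limw: "AE y in M. y \<in> S \<longrightarrow> (\<lambda>k. A k y) \<longlonglongrightarrow> w y"
    using conv by eventually_elim (simp add: w_def convergent_LIMSEQ_iff)
  have wH: "AE y in M. y \<in> S \<longrightarrow> \<bar>w y\<bar> \<le> H y"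
    using limw bound
  proof eventually_elim
    case (elim y)
    show ?case
    proof
      assume y: "y \<in> S"
      then have "(\<lambda>k. \<bar>A k y\<bar>) \<longlonglongrightarrow> \<bar>w y\<bar>" using elim by (intro tendsto_rabs) simp
      then show "\<bar>w y\<bar> \<le> H y" using elim y by (intro LIMSEQ_le_const2) auto
    qed
  qed
  define f where "f y = indicator S y * (w y - ?m * u y)" for y
  have wI: "integrable M (\<lambda>y. indicator S y * w y)"
  proof (rule Bochner_Integration.integrable_bound[OF H])
    show "AE y in M. norm (indicator S y * w y) \<le> norm (H y)" using wH by eventually_elim (auto split: split_indicator)
  qed measurable
  have uI: "integrable M (\<lambda>y. indicator S y * (?m * u y))"
    by (rule Bochner_Integration.integrable_bound[where f="\<lambda>y. ?m * u y"]) (use u in \<open>auto split: split_indicator\<close>)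
  have fI: "integrable M f" unfolding f_def right_diff_distrib by (rule Bochner_Integration.integrable_diff[OF wI uI])
  have "AE y in M. y \<in> S \<longrightarrow> f y = 0"
  proof (rule AE_zero_on_open_of_box_integrals[OF fI S])
    fix a b assume ab: "box a b \<subseteq> S"
    have ab': "box a b \<subseteq> \<Omega>" using ab S by blast
    let ?i = "\<lambda>y. indicator (box a b) y :: real"
    have [measurable]: "?i \<in> borel_measurable M"
      by (rule measurable_compose[OF measurable_id_borel]) (intro borel_measurable_indicator borel_open open_box)
    define W where "W k z = (LINT y|M. ?i y * mollifier (y + t k *\<^sub>R v) (t k) z)" for k z
    have swap: "(LINT y|M. ?i y * A k y) = (LINT z|M. u z * W k z)" for k
    proof -
      have "(LINT y|M. ?i y * A k y) = (LINT y|M. LINT z|M. ?i y * (u z * mollifier (y + t k *\<^sub>R v) (t k) z))"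
        by (simp add: A_def)
      also have "\<dots> = (LINT z|M. LINT y|M. ?i y * (u z * mollifier (y + t k *\<^sub>R v) (t k) z))"
        by (rule pair.Fubini_integral[symmetric]) (rule integrable_double_mollifier[OF u t(1)], simp)
      also have "\<dots> = (LINT z|M. u z * W k z)"
        by (simp add: W_def mult.left_commute[of "indicator _ _"])
      finally show ?thesis .
    qed
    have lim1: "(\<lambda>k. LINT y|M. ?i y * A k y) \<longlonglongrightarrow> (LINT y|M. ?i y * w y)"
    proof (rule integral_dominated_convergence[where w="\<lambda>y. \<bar>H y\<bar>"])
      show "AE y in M. (\<lambda>k. ?i y * A k y) \<longlonglongrightarrow> ?i y * w y"
        using limw by eventually_elim (use ab in \<open>auto split: split_indicator\<close>)
      show "AE y in M. norm (?i y * A k y) \<le> \<bar>H y\<bar>" for k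
        using bound by eventually_elim
          (use ab in \<open>auto split: split_indicator dest: order_trans[OF _ abs_ge_self]\<close>)
      show "integrable M (\<lambda>y. \<bar>H y\<bar>)" using H by simp
    qed measurable
    have Wm: "W k \<in> borel_measurable M" for k
    proof -
      have "(\<lambda>(z, y). ?i y * mollifier (y + t k *\<^sub>R v) (t k) z) \<in> borel_measurable (M \<Otimes>\<^sub>M M)"
        unfolding mollifier_def by measurable
      then show ?thesis unfolding W_def by (rule borel_measurable_lebesgue_integral)
    qed
    have sub: "cball (z - t k *\<^sub>R v) (t k) \<subseteq> cball z (t k * (norm v + 1))" for k z
    proof
      fix y assume "y \<in> cball (z - t k *\<^sub>R v) (t k)"
      moreover have "dist z (z - t k *\<^sub>R v) = t k * norm v" using t(1)[of k] by (simp add: dist_norm)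
      ultimately show "y \<in> cball z (t k * (norm v + 1))"
        using dist_triangle[of z y "z - t k *\<^sub>R v"] t(1)[of k] by (simp add: algebra_simps)
    qed
    have ev: "eventually (\<lambda>k. t k * (norm v + 1) < e) sequentially" if "0 < e" for e
    proof -
      have "(\<lambda>k. t k * (norm v + 1)) \<longlonglongrightarrow> 0 * (norm v + 1)" by (intro tendsto_intros t)
      then show ?thesis using that by (intro order_tendstoD) auto
    qed
    \<comment> \<open>The boundary of the box is left out; it is a null set.\<close>
    have limW: "(\<lambda>k. W k z) \<longlonglongrightarrow> ?i z * ?m" if z: "z \<notin> cbox a b - box a b" for z
    proof (cases "z \<in> box a b")
      case True
      then obtain e where e: "0 < e" "ball z e \<subseteq> box a b" using open_box openE by metis
      have "eventually (\<lambda>k. W k z = ?m) sequentially" using ev[OF e(1)]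
      proof eventually_elim
        case (elim k)
        then have "cball z (t k * (norm v + 1)) \<subseteq> ball z e" by auto
        then have "cball (z - t k *\<^sub>R v) (t k) \<subseteq> box a b" using sub e by blast
        then show ?case unfolding W_def by (rule box_weight(2)[OF t(1) ab'])
      qed
      then show ?thesis using True by (auto intro: tendsto_eventually)
    next
      case False
      then have "z \<in> - cbox a b" using z by auto
      then obtain e where e: "0 < e" "ball z e \<subseteq> - cbox a b" using open_Compl[OF closed_cbox] openE by metis
      have "eventually (\<lambda>k. W k z = 0) sequentially" using ev[OF e(1)]
      proof eventually_elim
        case (elim k)
        then have "cball z (t k * (norm v + 1)) \<subseteq> ball z e" by auto
        then have "cball (z - t k *\<^sub>R v) (t k) \<inter> box a b = {}" using sub e box_subset_cbox by blast
        then show ?case unfolding W_def by (rule box_weight(3)[OF t(1) ab'])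
      qed
      then show ?thesis using False by (auto intro: tendsto_eventually)
    qed
    have "AE z in lborel. z \<notin> cbox a b - box a b" using null_sets_cbox_Diff_box[of a b] by (rule AE_not_in)
    then have "AE z in lebesgue. z \<notin> cbox a b - box a b" by (rule AE_completion)
    then have AEb: "AE z in M. z \<notin> cbox a b - box a b"
      using open_domain by (subst AE_restrict_space_iff) (auto elim: eventually_mono)
    have lim2: "(\<lambda>k. LINT z|M. u z * W k z) \<longlonglongrightarrow> (LINT z|M. u z * (?i z * ?m))"
    proof (rule integral_dominated_convergence[where w="\<lambda>z. ?m * \<bar>u z\<bar>"])
      show "AE z in M. (\<lambda>k. u z * W k z) \<longlonglongrightarrow> u z * (?i z * ?m)"
        using AEb by eventually_elim (intro tendsto_intros limW)
      show "AE z in M. norm (u z * W k z) \<le> ?m * \<bar>u z\<bar>" for k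
      proof (rule AE_I2)
        fix z
        have "\<bar>W k z\<bar> \<le> ?m" unfolding W_def by (rule box_weight(1)[OF t(1) ab'])
        then show "norm (u z * W k z) \<le> ?m * \<bar>u z\<bar>" using mult_left_mono[of "\<bar>W k z\<bar>" ?m "\<bar>u z\<bar>"]
            by (simp add: abs_mult mult.commute)
      qed
      show "(\<lambda>z. u z * W k z) \<in> borel_measurable M" for k using Wm by measurable
      show "integrable M (\<lambda>z. ?m * \<bar>u z\<bar>)" using u by simp
    qed measurable
    have eq: "(LINT y|M. ?i y * w y) = (LINT z|M. u z * (?i z * ?m))"
      using lim1 lim2 unfolding swap by (rule LIMSEQ_unique)
    have i1: "integrable M (\<lambda>y. ?i y * w y)"
      by (rule Bochner_Integration.integrable_bound[OF wI]) (use ab in \<open>auto split: split_indicator\<close>)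
    have i2: "integrable M (\<lambda>z. u z * (?i z * ?m))"
      by (rule Bochner_Integration.integrable_bound[where f="\<lambda>z. ?m * u z"])
        (use u in \<open>auto split: split_indicator simp: abs_mult mult.commute\<close>)
    have "(LINT y|M. ?i y * f y) = (LINT y|M. ?i y * w y - u y * (?i y * ?m))"
      using ab by (intro Bochner_Integration.integral_cong) (auto simp: f_def algebra_simps split: split_indicator)
    also have "\<dots> = (LINT y|M. ?i y * w y) - (LINT z|M. u z * (?i z * ?m))"
      by (rule Bochner_Integration.integral_diff[OF i1 i2])
    finally show "(LINT y|M. ?i y * f y) = 0" using eq by simp
  qed
  with limw show ?thesis by eventually_elim (auto simp: f_def)
qed

end

section \<open>Averages controlled by the potential of the gradient\<close>

context bounded_domain
begin

lemma integrable_of_nn_integral_powr: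
  fixes f :: "'a \<Rightarrow> 'b::euclidean_space"
  assumes [measurable]: "f \<in> borel_measurable M" and q: "1 \<le> q"
    and fq: "(\<integral>\<^sup>+x. ennreal (norm (f x) powr q) \<partial>M) \<le> 1"
  shows "integrable M f"
proof (rule integrableI_bounded)
  have "(\<integral>\<^sup>+x. ennreal (norm (f x)) \<partial>M) = (\<integral>\<^sup>+x. ennreal (norm (f x) powr 1) \<partial>M)" by simp
  also have "\<dots> \<le> ennreal (measure M \<Omega> + 1)"
    using fq q by (intro nn_integral_powr_lower_exponent[where q=q]) auto
  finally show "(\<integral>\<^sup>+x. ennreal (norm (f x)) \<partial>M) < \<infinity>" by (simp add: le_less_trans)
qed measurable

text \<open>An open set is a countable union of compact sets, and integrability on each of them
  includes measurability there.\<close>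

lemma locally_integrable_measurable:
  fixes g :: "'a \<Rightarrow> 'b::euclidean_space"
  assumes "locally_integrable \<Omega> g"
  shows "g \<in> borel_measurable M"
proof -
  obtain C where C: "\<And>n::nat. compact (C n)" "\<And>n. C n \<subseteq> \<Omega>" "\<Union>(range C) = \<Omega>"
    using open_Union_compact_subsets[OF open_domain] by metis
  show ?thesis
  proof (rule measurable_piecewise_restrict[of "range C"])
    show "space M \<subseteq> \<Union>(range C)" using C by simp
    show "A \<inter> space M \<in> sets M" if "A \<in> range C" for A
    proof -
      have "compact A" "A \<inter> space M = A" using that C by auto
      moreover have "A \<in> sets lebesgue" using \<open>compact A\<close> by (intro fmeasurableD lmeasurable_compact)
      ultimately show ?thesis using that C(2) open_domain by (auto simp: sets_restrict_space_iff)
    qed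
    show "g \<in> borel_measurable (restrict_space M A)" if A: "A \<in> range C" for A
    proof -
      have "compact A" "A \<subseteq> \<Omega>" using A C by auto
      have Aset: "A \<in> sets lebesgue" using \<open>compact A\<close> by (intro fmeasurableD lmeasurable_compact)
      have "g absolutely_integrable_on A" using \<open>compact A\<close> \<open>A \<subseteq> \<Omega>\<close> assms unfolding locally_integrable_def by blast
      then have "g \<in> borel_measurable (lebesgue_on A)"
        using absolutely_integrable_measurable[OF Aset] by blast
      moreover have "restrict_space M A = lebesgue_on A"
        using \<open>A \<subseteq> \<Omega>\<close> Aset open_domain by (subst restrict_restrict_space) (auto simp: Int_absorb1)
      ultimately show ?thesis by simp
    qed
  qed simp
qed

text \<open>Young's inequality at a suitable height replaces Hoelder's inequality.\<close>

lemma ball_integral_le_potential: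
  fixes g :: "'a \<Rightarrow> 'a" and d :: real
  assumes [measurable]: "g \<in> borel_measurable M" and q: "1 \<le> q" and D: "0 < D"
  defines "P \<equiv> dyadic_potential M D d (\<lambda>z. ennreal (norm (g z) powr q))"
  assumes P: "P x < \<infinity>"
  shows "(LINT z|M. norm (g z) * indicator (cball x (D / 2 ^ k)) z)
    \<le> (unit_ball_vol DIM('a) + 1) * (D / 2 ^ k) powr (DIM('a) - d / q) * (enn2real (P x) + 1) powr (1 / q)"
proof -
  let ?N = "real DIM('a)" and ?w = "unit_ball_vol DIM('a)"
  define \<rho> where "\<rho> = D / 2 ^ k"
  have \<rho>: "0 < \<rho>" using D by (simp add: \<rho>_def)
  define X where "X = enn2real (P x) + 1"
  have X: "1 \<le> X" "P x = ennreal (X - 1)" using P by (auto simp: X_def)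
  \<comment> \<open>The height at which the bounds for both summands of Young's inequality are of
    the same size: l^q = \<rho>^(-d) X balances the volume against the mass of |g|^q in the ball.
    Adding 1 in X keeps l positive.\<close>
  define l where "l = (\<rho> powr (- d) * X) powr (1 / q)"
  have l: "0 < l" using \<rho> X by (simp add: l_def)
  have lq: "l powr q = \<rho> powr (- d) * X" using q \<rho> X by (simp add: l_def powr_powr)
  have young: "s \<le> l + l powr (1 - q) * s powr q" if s: "0 \<le> s" for s
  proof (cases "s \<le> l")
    case True
    then show ?thesis by (simp add: add_increasing2)
  next
    case False
    then have s0: "0 < s" using l by simp
    have "s = s powr (1 - q) * s powr q" using s0 by (simp flip: powr_add)
    also have "\<dots> \<le> l powr (1 - q) * s powr q"
      using False l q by (intro mult_right_mono powr_mono2') auto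
    finally show ?thesis using l by simp
  qed
  have [measurable]: "(\<lambda>z. indicator (cball x \<rho>) z :: real) \<in> borel_measurable M"
    by (rule measurable_compose[OF measurable_id_borel]) (intro borel_measurable_indicator borel_closed closed_cball)
  have [measurable]: "(\<lambda>z. indicator (cball x \<rho>) z :: ennreal) \<in> borel_measurable M"
    by (rule measurable_compose[OF measurable_id_borel]) (intro borel_measurable_indicator borel_closed closed_cball)
  have "(\<integral>\<^sup>+z. ennreal (norm (g z) * indicator (cball x \<rho>) z) \<partial>M)
     \<le> (\<integral>\<^sup>+z. ennreal l * indicator (\<Omega> \<inter> cball x \<rho>) z + ennreal (l powr (1 - q)) * (ennreal (norm (g z) powr q) * indicator (cball x \<rho>) z) \<partial>M)"
  proof (rule nn_integral_mono)
    fix z assume "z \<in> space M"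
    moreover have "ennreal (norm (g z)) \<le> ennreal l + ennreal (l powr (1 - q)) * ennreal (norm (g z) powr q)"
      using young[of "norm (g z)"] l by (simp add: ennreal_leI flip: ennreal_plus ennreal_mult)
    ultimately show "ennreal (norm (g z) * indicator (cball x \<rho>) z)
      \<le> ennreal l * indicator (\<Omega> \<inter> cball x \<rho>) z + ennreal (l powr (1 - q)) * (ennreal (norm (g z) powr q) * indicator (cball x \<rho>) z)"
      by (simp split: split_indicator)
  qed
  also have "\<dots> = ennreal l * emeasure M (\<Omega> \<inter> cball x \<rho>) + ennreal (l powr (1 - q)) * (\<integral>\<^sup>+z\<in>cball x \<rho>. ennreal (norm (g z) powr q) \<partial>M)"
    by (simp add: nn_integral_add nn_integral_cmult nn_integral_cmult_indicator)
  also have "\<dots> \<le> ennreal l * ennreal (?w * \<rho> powr ?N) + ennreal (l powr (1 - q)) * (ennreal (\<rho> powr (?N - d)) * ennreal X)"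
  proof (intro add_mono mult_left_mono emeasure_cball_le \<rho>)
    have "(\<integral>\<^sup>+z\<in>cball x \<rho>. ennreal (norm (g z) powr q) \<partial>M) \<le> ennreal (\<rho> powr (?N - d)) * P x"
      unfolding \<rho>_def P_def by (rule nn_integral_cball_le_dyadic_potential[OF D])
    also have "\<dots> \<le> ennreal (\<rho> powr (?N - d)) * ennreal X"
      unfolding X(2) by (intro mult_left_mono ennreal_leI) auto
    finally show "(\<integral>\<^sup>+z\<in>cball x \<rho>. ennreal (norm (g z) powr q) \<partial>M) \<le> ennreal (\<rho> powr (?N - d)) * ennreal X" .
  qed auto
  also have "\<dots> = ennreal (l * (?w * \<rho> powr ?N) + l powr (1 - q) * (\<rho> powr (?N - d) * X))"
    using l X by (simp flip: ennreal_mult ennreal_plus)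
  also have "l powr (1 - q) * (\<rho> powr (?N - d) * X) = l * \<rho> powr ?N"
  proof -
    have "l powr (1 - q) * (\<rho> powr (?N - d) * X) = l powr (1 - q) * (\<rho> powr ?N * l powr q)"
      by (simp add: lq mult_ac flip: powr_add)
    also have "\<dots> = (l powr (1 - q) * l powr q) * \<rho> powr ?N" by simp
    also have "l powr (1 - q) * l powr q = l" using l by (simp flip: powr_add)
    finally show ?thesis .
  qed
  also have "l * (?w * \<rho> powr ?N) + l * \<rho> powr ?N = (?w + 1) * \<rho> powr ?N * l" by (simp add: algebra_simps)
  also have "l = \<rho> powr (- d / q) * X powr (1 / q)" by (simp add: l_def powr_mult powr_powr)
  also have "(?w + 1) * \<rho> powr ?N * (\<rho> powr (- d / q) * X powr (1 / q)) = (?w + 1) * \<rho> powr (?N - d / q) * X powr (1 / q)"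
  proof -
    have "\<rho> powr ?N * \<rho> powr (- d / q) = \<rho> powr (?N - d / q)" by (subst powr_add[symmetric]) simp
    then show ?thesis by (simp only: mult.assoc[symmetric]) (simp only: mult.assoc)
  qed
  finally have le: "(\<integral>\<^sup>+z. ennreal (norm (g z) * indicator (cball x \<rho>) z) \<partial>M) \<le> ennreal ((?w + 1) * \<rho> powr (?N - d / q) * X powr (1 / q))" .
  have "(LINT z|M. norm (g z) * indicator (cball x \<rho>) z) = enn2real (\<integral>\<^sup>+z. ennreal (norm (g z) * indicator (cball x \<rho>) z) \<partial>M)"
    by (rule integral_eq_nn_integral) auto
  also have "\<dots> \<le> (?w + 1) * \<rho> powr (?N - d / q) * X powr (1 / q)"
    using le by (intro enn2real_leI) auto
  finally show ?thesis by (simp add: \<rho>_def X_def)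
qed

text \<open>Count of powers: speed L \<tau>, mollifier bound (\<tau> / 2)^(-N) and gradient integral
  of order \<tau>^(N - d / q) leave \<tau>^(1 - d / q). Thus d / q is the smoothness given away for
  the use of the potential.\<close>

lemma mollified_average_step:
  fixes g :: "'a \<Rightarrow> 'a" and d :: real
  assumes wg: "has_weak_gradient \<Omega> u g" and u: "integrable M u" and g: "integrable M g"
    and q: "1 \<le> q" and D: "0 < D" and L: "0 < L"
  defines "P \<equiv> dyadic_potential M (L * D) d (\<lambda>z. ennreal (norm (g z) powr q))"
  assumes P: "P x < \<infinity>" and \<tau>: "\<tau> = D / 2 ^ k"
    and path: "\<And>t. t \<in> {0..1} \<Longrightarrow> \<tau> / 2 \<le> r + t * s \<and> cball (c + t *\<^sub>R e) (r + t * s) \<subseteq> \<Omega> \<inter> cball x (L * \<tau>)"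
    and speed: "norm e + \<bar>s\<bar> \<le> L * \<tau>"
  shows "\<bar>(LINT z|M. u z * mollifier (c + e) (r + s) z) - (LINT z|M. u z * mollifier c r z)\<bar>
    \<le> 2 ^ DIM('a) * (unit_ball_vol DIM('a) + 1) * L powr (real DIM('a) + 1 - d / q) * \<tau> powr (1 - d / q) * (enn2real (P x) + 1) powr (1 / q)"
proof -
  let ?N = "real DIM('a)" and ?w = "unit_ball_vol DIM('a)"
  have [measurable]: "g \<in> borel_measurable M" using g by simp
  have \<tau>0: "0 < \<tau>" using D by (simp add: \<tau>)
  have LD: "0 < L * D" using L D by simp
  define Q where "Q = (enn2real (P x) + 1) powr (1 / q)"
  have "\<bar>(LINT z|M. u z * mollifier (c + e) (r + s) z) - (LINT z|M. u z * mollifier c r z)\<bar>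
    \<le> (norm e + \<bar>s\<bar>) / (\<tau> / 2) ^ DIM('a) * (LINT z|M. norm (g z) * indicator (cball x (L * \<tau>)) z)"
    using \<tau>0 path by (intro mollified_average_path[OF wg u g]) auto
  also have "\<dots> \<le> (L * \<tau>) / (\<tau> / 2) ^ DIM('a) * ((?w + 1) * (L * \<tau>) powr (?N - d / q) * Q)"
  proof (intro mult_mono divide_right_mono speed)
    show "(LINT z|M. norm (g z) * indicator (cball x (L * \<tau>)) z) \<le> (?w + 1) * (L * \<tau>) powr (?N - d / q) * Q"
      using ball_integral_le_potential[of g q "L * D" d x k] q LD P unfolding \<tau> P_def Q_def by simp
    show "0 \<le> (LINT z|M. norm (g z) * indicator (cball x (L * \<tau>)) z)" by (intro Bochner_Integration.integral_nonneg) auto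
  qed (use \<tau>0 L in auto)
  also have "\<dots> = 2 ^ DIM('a) * (?w + 1) * (L powr 1 * L powr (?N - d / q)) * ((\<tau> powr 1 * \<tau> powr (?N - d / q)) / \<tau> powr ?N) * Q"
    using \<tau>0 L by (simp add: powr_mult power_divide powr_realpow mult_ac)
  also have "L powr 1 * L powr (?N - d / q) = L powr (?N + 1 - d / q)"
    by (simp only: powr_add[symmetric]) (simp add: algebra_simps)
  also have "(\<tau> powr 1 * \<tau> powr (?N - d / q)) / \<tau> powr ?N = \<tau> powr (1 - d / q)"
    by (simp only: powr_add[symmetric] powr_diff[symmetric]) (simp add: algebra_simps)
  finally show ?thesis by (simp only: Q_def)
qed

end

section \<open>Pointwise bound for functions with a weak gradient\<close>

context bounded_domain
begin

text \<open>For a direction v admissible at y, the averages A v k y over balls of radius t k centred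
  at y + t k v form a Cauchy sequence with error of order (t k)^\<sigma> Q y, and their limit is the
  mass times u y. For two nearby points with a common direction, the averages at the scale of their
  distance are compared by moving one ball to the other.\<close>

lemma weak_gradient_hajlasz_unit:
  assumes cone: "uniform_cone \<Omega> R V" and q: "1 \<le> q" and \<sigma>: "0 < \<sigma>" "\<sigma> < 1"
  obtains C where "0 \<le> C" "\<And>u g. has_weak_gradient \<Omega> u g \<Longrightarrow> lp_bound q 1 u \<Longrightarrow>
    (\<integral>\<^sup>+x. ennreal (norm (g x) powr q) \<partial>M) \<le> 1 \<Longrightarrow> hajlasz (R / 2) \<sigma> q C u"
proof -
  let ?m = "mollifier_mass TYPE('a)" and ?N = "real DIM('a)"
  have R: "0 < R" and V: "finite V" using cone by (auto simp: uniform_cone_def)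
  have m: "0 < ?m" by (rule nn_integral_mollifier_unit(2))
  define L where "L = Max (insert 1 (norm ` V)) + 1"
  have L: "norm v + 1 \<le> L" if "v \<in> V" for v using V that by (simp add: L_def)
  have L2: "2 \<le> L" using V by (simp add: L_def Max_ge_iff)
  \<comment> \<open>The loss d / q is exactly 1 - \<sigma>, and d > 0 because \<sigma> < 1.\<close>
  define d where "d = q * (1 - \<sigma>)"
  have d: "0 < d" "1 - d / q = \<sigma>" using q \<sigma> by (auto simp: d_def)
  have LR: "0 < L * R" using L2 R by simp
  obtain CP where CP: "0 \<le> CP" "\<And>h. h \<in> borel_measurable M \<Longrightarrow>
    (\<integral>\<^sup>+x. dyadic_potential M (L * R) d h x \<partial>M) \<le> ennreal CP * (\<integral>\<^sup>+x. h x \<partial>M)"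
    using nn_integral_dyadic_potential_le[OF LR d(1)] by blast
  define K where "K = 2 ^ DIM('a) * (unit_ball_vol DIM('a) + 1) * L powr (?N + 1 - d / q)"
  have K: "0 \<le> K" by (simp add: K_def)
  define b where "b = 2 powr (- \<sigma>)"
  have b: "0 < b" "b < 1" using \<sigma> powr_less_mono[of "- \<sigma>" 0 2] by (auto simp: b_def)
  define K3 where "K3 = K / (1 - b)"
  have K3: "0 \<le> K3" "K3 * (1 - b) = K" using K b by (auto simp: K3_def)
  \<comment> \<open>The 4 stems from t j < 4 dist x y, the division from the mass of the
    mollifier.\<close>
  define K5 where "K5 = (K3 + K) * 4 powr \<sigma> / ?m"
  have K5: "0 \<le> K5" using K K3 m by (simp add: K5_def)
  define t where "t k = R / 2 ^ k" for k :: nat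
  have t0: "0 < t k" for k using R by (simp add: t_def)
  have tS: "t (Suc k) = t k / 2" for k by (simp add: t_def)
  have tR: "t k \<le> R" for k
  proof -
    have "R / 2 ^ k \<le> R / 1" using R by (intro divide_left_mono) auto
    then show ?thesis by (simp add: t_def)
  qed
  have tpow: "(\<lambda>k. t k powr \<sigma>) \<longlonglongrightarrow> 0"
    unfolding t_def using R \<sigma> by (intro summable_LIMSEQ_zero summable_dyadic_powr)
  have tlim: "t \<longlonglongrightarrow> 0"
    using summable_LIMSEQ_zero[OF summable_dyadic_powr[OF R zero_less_one]] R by (simp add: t_def[abs_def])
  define C where "C = K5 * (CP + measure M \<Omega>) powr (1 / q)"
  show ?thesis
  proof (rule that[of C])
    show "0 \<le> C" using K5 by (simp add: C_def)
    fix u g assume wg: "has_weak_gradient \<Omega> u g" and lu: "lp_bound q 1 u"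
      and gq: "(\<integral>\<^sup>+x. ennreal (norm (g x) powr q) \<partial>M) \<le> 1"
    have um [measurable]: "u \<in> borel_measurable M" using lu by (simp add: lp_bound_def)
    have gm [measurable]: "g \<in> borel_measurable M" using wg by (auto simp: has_weak_gradient_def intro: locally_integrable_measurable)
    have u: "integrable M u" using lu q by (intro integrable_of_nn_integral_powr[OF um]) (auto simp: lp_bound_def)
    have g: "integrable M g" using gm q gq by (rule integrable_of_nn_integral_powr)
    define P where "P = dyadic_potential M (L * R) d (\<lambda>z. ennreal (norm (g z) powr q))"
    have P [measurable]: "P \<in> borel_measurable M" unfolding P_def by measurable
    have "(\<integral>\<^sup>+x. P x \<partial>M) \<le> ennreal CP * (\<integral>\<^sup>+x. ennreal (norm (g x) powr q) \<partial>M)" unfolding P_def by (rule CP) measurable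
    also have "\<dots> \<le> ennreal CP * 1" using gq by (intro mult_left_mono) auto
    finally have intP: "(\<integral>\<^sup>+x. P x \<partial>M) \<le> ennreal CP" by simp
    then have "(\<integral>\<^sup>+x. P x \<partial>M) \<noteq> \<infinity>" by (auto simp: top_unique)
    then have AEP: "AE x in M. P x \<noteq> \<infinity>" using P by (intro nn_integral_PInf_AE) auto
    \<comment> \<open>The added 1 is inherited from the gradient estimate and stays integrable, as
      \<Omega> has finite measure.\<close>
    define Q where "Q x = (enn2real (P x) + 1) powr (1 / q)" for x
    have Q0: "0 \<le> Q x" for x by (simp add: Q_def)
    have [measurable]: "Q \<in> borel_measurable M" unfolding Q_def by measurable
    have Qq: "(\<integral>\<^sup>+x. ennreal (Q x powr q) \<partial>M) \<le> ennreal (CP + measure M \<Omega>)"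
    proof -
      have "(\<integral>\<^sup>+x. ennreal (Q x powr q) \<partial>M) \<le> (\<integral>\<^sup>+x. P x + 1 \<partial>M)"
      proof (rule nn_integral_mono)
        fix x
        have "ennreal (Q x powr q) = ennreal (enn2real (P x)) + 1" using q by (simp add: Q_def powr_powr)
        also have "\<dots> \<le> P x + 1" by (intro add_right_mono ennreal_enn2real_le)
        finally show "ennreal (Q x powr q) \<le> P x + 1" .
      qed
      also have "\<dots> = (\<integral>\<^sup>+x. P x \<partial>M) + emeasure M \<Omega>" by (simp add: nn_integral_add)
      also have "\<dots> \<le> ennreal CP + ennreal (measure M \<Omega>)" using intP by (intro add_mono) (auto simp: emeasure_eq_measure)
      finally show ?thesis using CP by simp
    qed
    have QI: "integrable M Q"
    proof (rule integrableI_bounded)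
      have "(\<integral>\<^sup>+x. ennreal (norm (Q x)) \<partial>M) \<le> (\<integral>\<^sup>+x. 1 + ennreal (Q x powr q) \<partial>M)"
      proof (rule nn_integral_mono)
        fix x
        have "Q x powr 1 \<le> 1 + Q x powr q" using Q0 q by (intro powr_le_one_plus_powr) auto
        then show "ennreal (norm (Q x)) \<le> 1 + ennreal (Q x powr q)"
          using Q0[of x] by (simp add: ennreal_leI flip: ennreal_1 ennreal_plus)
      qed
      also have "\<dots> = emeasure M \<Omega> + (\<integral>\<^sup>+x. ennreal (Q x powr q) \<partial>M)" by (simp add: nn_integral_add)
      also have "\<dots> \<le> ennreal (measure M \<Omega>) + ennreal (CP + measure M \<Omega>)" using Qq by (intro add_mono) (auto simp: emeasure_eq_measure)
      also have "\<dots> < \<infinity>" by simp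
      finally show "(\<integral>\<^sup>+x. ennreal (norm (Q x)) \<partial>M) < \<infinity>" .
    qed measurable
    define A where "A v k y = (LINT z|M. u z * mollifier (y + t k *\<^sub>R v) (t k) z)" for v k y
    define cone_at where "cone_at v y \<longleftrightarrow> (\<forall>s\<in>{0<..R}. cball (y + s *\<^sub>R v) s \<subseteq> \<Omega>)" for v y
    have step: "\<bar>(LINT z|M. u z * mollifier (c + e) (r + s) z) - (LINT z|M. u z * mollifier c r z)\<bar> \<le> K * t k powr \<sigma> * Q x"
      if "P x \<noteq> \<infinity>" "\<And>l. l \<in> {0..1} \<Longrightarrow> t k / 2 \<le> r + l * s \<and> cball (c + l *\<^sub>R e) (r + l * s) \<subseteq> \<Omega> \<inter> cball x (L * t k)"
        "norm e + \<bar>s\<bar> \<le> L * t k" for x k c e r s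
    proof -
      have "P x < \<infinity>" using that(1) by (simp add: less_top)
      from mollified_average_step[OF wg u g q R _ this[unfolded P_def] t_def that(2,3)] L2
      show ?thesis by (simp add: K_def P_def Q_def d(2) mult_ac)
    qed
    have cone_ball: "cball (y + s *\<^sub>R v) s \<subseteq> \<Omega> \<inter> cball y (L * t k)"
      if "cone_at v y" "v \<in> V" "0 < s" "s \<le> t k" for v y s k
    proof -
      have "cball (y + s *\<^sub>R v) s \<subseteq> \<Omega>" using that tR[of k] by (auto simp: cone_at_def)
      moreover have "cball (y + s *\<^sub>R v) s \<subseteq> cball y (L * t k)"
      proof
        fix z assume "z \<in> cball (y + s *\<^sub>R v) s"
        then have "dist y z \<le> norm (s *\<^sub>R v) + s" using dist_triangle[of y z "y + s *\<^sub>R v"] by (simp add: dist_norm)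
        also have "\<dots> = s * (norm v + 1)" using that by (simp add: algebra_simps)
        also have "\<dots> \<le> t k * L" using that L[of v] by (intro mult_mono) auto
        finally show "z \<in> cball y (L * t k)" by (simp add: mult.commute)
      qed
      ultimately show ?thesis by blast
    qed
    \<comment> \<open>From one scale to the next, centre and radius shrink together along v, so
      every ball on the way is again a cone ball.\<close>
    have Astep: "\<bar>A v (Suc k) y - A v k y\<bar> \<le> K * t k powr \<sigma> * Q y"
      if y: "P y \<noteq> \<infinity>" "cone_at v y" "v \<in> V" for v k y
    proof -
      have c: "y + t (Suc k) *\<^sub>R v = y + t k *\<^sub>R v + (- (t k / 2)) *\<^sub>R v" by (simp add: tS flip: scaleR_left_diff_distrib)
      have r: "t (Suc k) = t k + (- (t k / 2))" by (simp add: tS)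
      have "\<bar>(LINT z|M. u z * mollifier (y + t k *\<^sub>R v + (- (t k / 2)) *\<^sub>R v) (t k + (- (t k / 2))) z)
        - (LINT z|M. u z * mollifier (y + t k *\<^sub>R v) (t k) z)\<bar> \<le> K * t k powr \<sigma> * Q y"
      proof (rule step[OF y(1)])
        fix l :: real assume l: "l \<in> {0..1}"
        have "l * t k \<le> 1 * t k" using l t0[of k] by (intro mult_right_mono) auto
        then have s: "t k / 2 \<le> t k + l * (- (t k / 2))" by simp
        have E: "y + t k *\<^sub>R v + l *\<^sub>R ((- (t k / 2)) *\<^sub>R v) = y + (t k + l * (- (t k / 2))) *\<^sub>R v"
          by (simp add: algebra_simps)
        have "cball (y + (t k + l * (- (t k / 2))) *\<^sub>R v) (t k + l * (- (t k / 2))) \<subseteq> \<Omega> \<inter> cball y (L * t k)"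
          using s l t0[of k] by (intro cone_ball[OF y(2,3)]) auto
        then show "t k / 2 \<le> t k + l * (- (t k / 2)) \<and>
          cball (y + t k *\<^sub>R v + l *\<^sub>R ((- (t k / 2)) *\<^sub>R v)) (t k + l * (- (t k / 2))) \<subseteq> \<Omega> \<inter> cball y (L * t k)"
          unfolding E using s by blast
      next
        have "norm ((- (t k / 2)) *\<^sub>R v) + \<bar>- (t k / 2)\<bar> = (norm v + 1) * (t k / 2)" using t0[of k] by (simp add: algebra_simps)
        also have "\<dots> \<le> L * t k" using L[OF y(3)] t0[of k] L2 by (intro mult_mono) auto
        finally show "norm ((- (t k / 2)) *\<^sub>R v) + \<bar>- (t k / 2)\<bar> \<le> L * t k" .
      qed
      then show ?thesis by (simp only: A_def c[symmetric] r[symmetric])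
    qed
    have Atele: "\<bar>A v (j + n) y - A v j y\<bar> \<le> K3 * Q y * (t j powr \<sigma> - t (j + n) powr \<sigma>)"
      if y: "P y \<noteq> \<infinity>" "cone_at v y" "v \<in> V" for v j n y
    proof (induction n)
      case (Suc n)
      let ?T = "t (j + n) powr \<sigma>"
      have "t (Suc (j + n)) powr \<sigma> = b * ?T" unfolding tS powr_divide b_def powr_minus_divide by simp
      then have "K3 * Q y * (?T - t (Suc (j + n)) powr \<sigma>) = K3 * (1 - b) * ?T * Q y" by (simp add: algebra_simps)
      then have "K3 * Q y * (?T - t (Suc (j + n)) powr \<sigma>) = K * ?T * Q y" by (simp only: K3(2))
      moreover have "\<bar>A v (Suc (j + n)) y - A v (j + n) y\<bar> \<le> K * ?T * Q y" by (rule Astep[OF y])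
      moreover have "K3 * Q y * (t j powr \<sigma> - t (Suc (j + n)) powr \<sigma>)
         = K3 * Q y * (t j powr \<sigma> - ?T) + K3 * Q y * (?T - t (Suc (j + n)) powr \<sigma>)"
        by (simp add: algebra_simps)
      ultimately have "\<bar>A v (Suc (j + n)) y - A v j y\<bar> \<le> K3 * Q y * (t j powr \<sigma> - t (Suc (j + n)) powr \<sigma>)"
        using Suc by linarith
      then show ?case by simp
    qed simp
    have Adiff: "\<bar>A v (j + n) y - A v j y\<bar> \<le> K3 * Q y * t j powr \<sigma>"
      if y: "P y \<noteq> \<infinity>" "cone_at v y" "v \<in> V" for v j n y
    proof -
      have "K3 * Q y * (t j powr \<sigma> - t (j + n) powr \<sigma>) \<le> K3 * Q y * t j powr \<sigma>"
        using K3 Q0[of y] by (intro mult_left_mono) auto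
      then show ?thesis using Atele[OF y, of j n] by linarith
    qed
    \<comment> \<open>The limit lemma works on open sets, while admissibility of v at single points
      need not be an open condition. S v therefore collects the points near some x for which v is
      admissible throughout \<open>cball x R\<close>.\<close>
    define S where "S v = \<Omega> \<inter> \<Union>{ball x R |x. x \<in> \<Omega> \<and> (\<forall>y\<in>\<Omega> \<inter> cball x R. cone_at v y)}" for v
    have Sopen: "open (S v)" for v unfolding S_def using open_domain by (intro open_Int open_Union) auto
    have Ssub: "S v \<subseteq> \<Omega>" for v by (auto simp: S_def)
    have Scone: "cone_at v y" if "y \<in> S v" for v y using that unfolding S_def by auto
    have lim: "AE y in M. y \<in> S v \<longrightarrow> (\<lambda>k. A v k y) \<longlonglongrightarrow> ?m * u y" if v: "v \<in> V" for v
    proof -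
      \<comment> \<open>Majorant for all averages: the first one plus the bound for its distance to
        the later ones.\<close>
      define H where "H y = \<bar>A v 0 y\<bar> + K3 * Q y * t 0 powr \<sigma>" for y
      have "AE y in M. y \<in> S v \<longrightarrow> convergent (\<lambda>k. A v k y)"
        using AEP
      proof eventually_elim
        case (elim y)
        show ?case
        proof
          assume "y \<in> S v"
          then have y: "P y \<noteq> \<infinity>" "cone_at v y" "v \<in> V" using elim Scone v by auto
          have "(\<lambda>j. K3 * Q y * t j powr \<sigma>) \<longlonglongrightarrow> K3 * Q y * 0" by (intro tendsto_intros tpow)
          then have "Cauchy (\<lambda>k. A v k y)"
            unfolding Cauchy_altdef2
          proof (intro allI impI)
            fix e :: real assume "0 < e"
            with \<open>(\<lambda>j. K3 * Q y * t j powr \<sigma>) \<longlonglongrightarrow> K3 * Q y * 0\<close>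
            have "eventually (\<lambda>j. K3 * Q y * t j powr \<sigma> < e) sequentially" by (intro order_tendstoD) auto
            then obtain N where "K3 * Q y * t N powr \<sigma> < e" by (auto simp: eventually_sequentially)
            then show "\<exists>N. \<forall>n\<ge>N. dist (A v n y) (A v N y) < e"
              using Adiff[OF y, of N] by (intro exI[of _ N]) (auto simp: dist_real_def le_iff_add intro: order_le_less_trans)
          qed
          then show "convergent (\<lambda>k. A v k y)" by (rule Cauchy_convergent)
        qed
      qed
      moreover have "AE y in M. y \<in> S v \<longrightarrow> (\<forall>k. \<bar>A v k y\<bar> \<le> H y)"
        using AEP
      proof eventually_elim
        case (elim y)
        show ?case
        proof (intro impI allI)
          fix k assume "y \<in> S v"
          then have y: "P y \<noteq> \<infinity>" "cone_at v y" "v \<in> V" using elim Scone v by auto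
          show "\<bar>A v k y\<bar> \<le> H y" using Adiff[OF y, of 0 k] by (simp add: H_def)
        qed
      qed
      moreover have "integrable M H"
      proof -
        have "integrable (M \<Otimes>\<^sub>M M) (\<lambda>(y, z). indicator UNIV y * (u z * mollifier (y + t 0 *\<^sub>R v) (t 0) z))"
          by (rule integrable_double_mollifier[OF u t0]) simp
        from pair.integrable_fst[OF this] have "integrable M (A v 0)" by (simp add: A_def[abs_def])
        then show ?thesis unfolding H_def using QI by simp
      qed
      ultimately show ?thesis
        unfolding A_def using mollified_average_limit[OF u Sopen Ssub t0 tlim, of H v v] by blast
    qed
    have AElim: "AE y in M. \<forall>v\<in>V. y \<in> S v \<longrightarrow> (\<lambda>k. A v k y) \<longlonglongrightarrow> ?m * u y"
      using V lim by (intro AE_ball_countable') (auto intro: countable_finite)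
    define Z where "Z = {y \<in> \<Omega>. P y \<noteq> \<infinity> \<and> (\<forall>v\<in>V. y \<in> S v \<longrightarrow> (\<lambda>k. A v k y) \<longlonglongrightarrow> ?m * u y)}"
    have close: "\<bar>?m * u y - A v j y\<bar> \<le> K3 * Q y * t j powr \<sigma>" if y: "y \<in> Z" "y \<in> S v" "v \<in> V" for y v j
    proof -
      have "(\<lambda>n. \<bar>A v (j + n) y - A v j y\<bar>) \<longlonglongrightarrow> \<bar>?m * u y - A v j y\<bar>"
      proof (intro tendsto_intros)
        have "(\<lambda>n. A v n y) \<longlonglongrightarrow> ?m * u y" using y by (auto simp: Z_def)
        then show "(\<lambda>n. A v (j + n) y) \<longlonglongrightarrow> ?m * u y" by (subst add.commute) (rule LIMSEQ_ignore_initial_segment)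
      qed
      then show ?thesis using Adiff[OF _ Scone[OF y(2)] y(3), of j] y(1)
        by (intro LIMSEQ_le_const2[where X="\<lambda>n. \<bar>A v (j + n) y - A v j y\<bar>"]) (auto simp: Z_def)
    qed
    show "hajlasz (R / 2) \<sigma> q C u"
    proof (rule hajlaszI[where G="\<lambda>x. K5 * Q x" and Z=Z])
      show "(\<lambda>x. K5 * Q x) \<in> borel_measurable M" by measurable
      show "0 \<le> K5 * Q x" for x using K5 Q0 by simp
      have "AE y in M. y \<in> \<Omega>" by (rule AE_I2) simp
      then show "AE x in M. x \<in> Z" using AEP AElim by eventually_elim (simp add: Z_def)
      have "(\<integral>\<^sup>+x. ennreal ((K5 * Q x) powr q) \<partial>M) = ennreal (K5 powr q) * (\<integral>\<^sup>+x. ennreal (Q x powr q) \<partial>M)"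
        by (simp add: powr_mult ennreal_mult nn_integral_cmult)
      also have "\<dots> \<le> ennreal (K5 powr q) * ennreal (CP + measure M \<Omega>)" using Qq by (intro mult_left_mono) auto
      also have "\<dots> = ennreal (C powr q)"
        using CP q by (simp add: C_def powr_mult powr_powr ennreal_mult add_nonneg_nonneg)
      finally show "(\<integral>\<^sup>+x. ennreal ((K5 * Q x) powr q) \<partial>M) \<le> ennreal (C powr q)" .
      fix x y assume x: "x \<in> Z" and y: "y \<in> Z" and xy: "x \<noteq> y" "dist x y \<le> R / 2"
      have x\<Omega>: "x \<in> \<Omega>" and y\<Omega>: "y \<in> \<Omega>" and Px: "P x \<noteq> \<infinity>" and Py: "P y \<noteq> \<infinity>" using x y by (auto simp: Z_def)
      obtain v where v: "v \<in> V" "\<forall>w\<in>\<Omega> \<inter> cball x R. cone_at v w"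
        using cone x\<Omega> unfolding uniform_cone_def cone_at_def by blast
      have Sx: "x \<in> S v" and Sy: "y \<in> S v" using v x\<Omega> y\<Omega> xy R by (force simp: S_def)+
      have cx: "cone_at v x" and cy: "cone_at v y" using Sx Sy by (auto intro: Scone)
      \<comment> \<open>The scale is fitted to twice the distance, which gives dist x y \<le> t j /
        2, the room needed to shrink one ball inside another.\<close>
      obtain j where "R / 2 ^ Suc j < 2 * dist x y" "2 * dist x y \<le> R / 2 ^ j"
        using dyadic_scale[of "2 * dist x y" R] xy by auto
      then have j: "dist x y \<le> t j / 2" "t j < 4 * dist x y" by (auto simp: t_def)
      let ?t = "t j"
      \<comment> \<open>Intermediate average: the centre belongs to y, the radius is halved. On the
        way from x the radius decreases as fast as the centre may drift, so all balls stay inside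
        the cone ball of x; growing back to radius t j happens inside the cone ball of y.\<close>
      define B where "B = (LINT z|M. u z * mollifier (y + ?t *\<^sub>R v) (?t / 2) z)"
      have l1: "\<bar>B - A v j x\<bar> \<le> K * ?t powr \<sigma> * Q x"
      proof -
        have c: "x + ?t *\<^sub>R v + (y - x) = y + ?t *\<^sub>R v" and r: "?t + (- (?t / 2)) = ?t / 2" by simp_all
        have "\<bar>(LINT z|M. u z * mollifier (x + ?t *\<^sub>R v + (y - x)) (?t + (- (?t / 2))) z)
          - (LINT z|M. u z * mollifier (x + ?t *\<^sub>R v) ?t z)\<bar> \<le> K * ?t powr \<sigma> * Q x"
        proof (rule step[OF Px])
          fix l :: real assume l: "l \<in> {0..1}"
          have lt: "l * ?t \<le> 1 * ?t" using l t0[of j] by (intro mult_right_mono) auto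
          have "cball (x + ?t *\<^sub>R v + l *\<^sub>R (y - x)) (?t + l * (- (?t / 2))) \<subseteq> cball (x + ?t *\<^sub>R v) ?t"
          proof
            fix z assume z: "z \<in> cball (x + ?t *\<^sub>R v + l *\<^sub>R (y - x)) (?t + l * (- (?t / 2)))"
            have "dist (x + ?t *\<^sub>R v) (x + ?t *\<^sub>R v + l *\<^sub>R (y - x)) = l * dist x y"
              using l by (simp add: dist_norm norm_minus_commute)
            also have "\<dots> \<le> l * (?t / 2)" using l j by (intro mult_left_mono) auto
            finally show "z \<in> cball (x + ?t *\<^sub>R v) ?t"
              using z dist_triangle[of "x + ?t *\<^sub>R v" z "x + ?t *\<^sub>R v + l *\<^sub>R (y - x)"] by simp
          qed
          then show "?t / 2 \<le> ?t + l * (- (?t / 2)) \<and> cball (x + ?t *\<^sub>R v + l *\<^sub>R (y - x)) (?t + l * (- (?t / 2))) \<subseteq> \<Omega> \<inter> cball x (L * ?t)"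
            using cone_ball[OF cx v(1) t0 order_refl, of j] lt by auto
        next
          have "norm (y - x) + \<bar>- (?t / 2)\<bar> \<le> 1 * ?t" using j t0[of j] by (simp add: dist_norm norm_minus_commute)
          also have "\<dots> \<le> L * ?t" using L2 t0[of j] by (intro mult_right_mono) auto
          finally show "norm (y - x) + \<bar>- (?t / 2)\<bar> \<le> L * ?t" .
        qed
        then show ?thesis by (simp only: A_def B_def c r)
      qed
      have l2: "\<bar>A v j y - B\<bar> \<le> K * ?t powr \<sigma> * Q y"
      proof -
        have r: "?t / 2 + ?t / 2 = ?t" by simp
        have "\<bar>(LINT z|M. u z * mollifier (y + ?t *\<^sub>R v + 0) (?t / 2 + ?t / 2) z)
          - (LINT z|M. u z * mollifier (y + ?t *\<^sub>R v) (?t / 2) z)\<bar> \<le> K * ?t powr \<sigma> * Q y"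
        proof (rule step[OF Py])
          fix l :: real assume l: "l \<in> {0..1}"
          have lt: "l * ?t \<le> 1 * ?t" "0 \<le> l * ?t" using l t0[of j] by (auto intro!: mult_right_mono)
          then have "cball (y + ?t *\<^sub>R v + l *\<^sub>R 0) (?t / 2 + l * (?t / 2)) \<subseteq> cball (y + ?t *\<^sub>R v) ?t" by auto
          then show "?t / 2 \<le> ?t / 2 + l * (?t / 2) \<and> cball (y + ?t *\<^sub>R v + l *\<^sub>R 0) (?t / 2 + l * (?t / 2)) \<subseteq> \<Omega> \<inter> cball y (L * ?t)"
            using cone_ball[OF cy v(1) t0 order_refl, of j] lt by auto
        next
          have "norm (0::'a) + \<bar>?t / 2\<bar> \<le> 1 * ?t" using t0[of j] by simp
          also have "\<dots> \<le> L * ?t" using L2 t0[of j] by (intro mult_right_mono) auto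
          finally show "norm (0::'a) + \<bar>?t / 2\<bar> \<le> L * ?t" .
        qed
        then show ?thesis by (simp only: A_def B_def add_0_right r)
      qed
      have "\<bar>?m * u x - ?m * u y\<bar> \<le> (K3 + K) * ?t powr \<sigma> * Q x + (K3 + K) * ?t powr \<sigma> * Q y"
        using close[OF x Sx v(1), of j] close[OF y Sy v(1), of j] l1 l2 by (simp add: algebra_simps abs_le_iff)
      also have "\<dots> = (K3 + K) * ?t powr \<sigma> * (Q x + Q y)" by (simp add: algebra_simps)
      also have "\<dots> \<le> (K3 + K) * (4 * dist x y) powr \<sigma> * (Q x + Q y)"
        using j K K3 Q0 \<sigma> t0[of j] by (intro mult_mono powr_mono2) auto
      finally have "?m * \<bar>u x - u y\<bar> \<le> (K3 + K) * 4 powr \<sigma> * dist x y powr \<sigma> * (Q x + Q y)"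
        using m by (simp add: powr_mult abs_mult mult.assoc flip: right_diff_distrib)
      then have "\<bar>u x - u y\<bar> \<le> (K3 + K) * 4 powr \<sigma> * dist x y powr \<sigma> * (Q x + Q y) / ?m"
        using m by (simp add: pos_le_divide_eq mult.commute)
      also have "\<dots> = dist x y powr \<sigma> * (K5 * Q x + K5 * Q y)"
        by (simp add: K5_def algebra_simps add_divide_distrib)
      finally show "\<bar>u x - u y\<bar> \<le> dist x y powr \<sigma> * (K5 * Q x + K5 * Q y)" .
    qed
  qed
qed

end

section \<open>Sobolev norms\<close>

lemma epowr_ennreal: "0 \<le> t \<Longrightarrow> epowr (ennreal t) a = ennreal (t powr a)"
  by (simp add: epowr_def)

lemma epowr_infinity [simp]: "epowr \<infinity> a = \<infinity>"
  by (simp add: epowr_def)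

lemma epowr_lt_infinity_iff: "epowr x a < \<infinity> \<longleftrightarrow> x < \<infinity>"
  by (simp add: epowr_def less_top)

lemma epowr_root: "0 < p \<Longrightarrow> epowr (epowr x (1 / p)) p = x"
  by (cases x) (auto simp: epowr_def powr_powr)

lemma epowr_mono:
  assumes "x \<le> y" "0 \<le> a"
  shows "epowr x a \<le> epowr y a"
proof (cases y)
  case (real t)
  then obtain s where "x = ennreal s" "0 \<le> s" "s \<le> t"
    using assms by (cases x) (auto simp: top_unique)
  then show ?thesis using real assms by (simp add: epowr_ennreal ennreal_leI powr_mono2)
qed (simp add: epowr_def)

lemma epowr_root_le: "0 < p \<Longrightarrow> 0 \<le> B \<Longrightarrow> epowr x (1 / p) \<le> ennreal B \<Longrightarrow> x \<le> ennreal (B powr p)"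
  using epowr_mono[of "epowr x (1 / p)" "ennreal B" p] by (simp add: epowr_root epowr_ennreal)

lemma epowr_root_leI: "0 < p \<Longrightarrow> 0 \<le> B \<Longrightarrow> x \<le> ennreal (B powr p) \<Longrightarrow> epowr x (1 / p) \<le> ennreal B"
  using epowr_mono[of x "ennreal (B powr p)" "1 / p"] by (simp add: epowr_ennreal powr_powr)

lemma epowr_root_tendsto_0:
  assumes f: "(f \<longlongrightarrow> 0) F" and p: "0 < p"
  shows "((\<lambda>n. epowr (f n) (1 / p)) \<longlongrightarrow> 0) F"
proof (rule order_tendstoI)
  fix a :: ennreal assume a: "0 < a"
  obtain e where e: "0 < e" "ennreal e < a"
  proof (cases a)
    case (real r)
    then show ?thesis using a by (intro that[of "r / 2"]) (auto simp: ennreal_less_iff)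
  qed (auto intro: that[of 1])
  have "eventually (\<lambda>n. f n < ennreal (e powr p)) F" using e by (intro order_tendstoD(2)[OF f]) simp
  then show "eventually (\<lambda>n. epowr (f n) (1 / p) < a) F"
  proof eventually_elim
    case (elim n)
    then have "epowr (f n) (1 / p) \<le> ennreal e" using p e by (intro epowr_root_leI) auto
    then show ?case using e(2) by (rule order_le_less_trans)
  qed
qed simp

text \<open>The first Gamma argument is positive because p + N - 2 \<ge> 0 and p s > 0; for N = p =
  1 only the latter keeps it off the pole at 0.\<close>

lemma sobolev_const_pos:
  assumes "0 < s" "s < 1" "1 \<le> p" "1 \<le> N"
  shows "0 < sobolev_const N s p"
proof -
  have "0 < p * s" using assms by simp
  then have "0 < p * s + (p + N - 2)" using assms by (intro add_pos_nonneg) auto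
  then have "0 < (p * s + p + N - 2) / 2" by (simp add: algebra_simps)
  then show ?thesis using assms unfolding sobolev_const_def
    by (intro divide_pos_pos mult_pos_pos Gamma_real_pos) auto
qed

section \<open>Sobolev norms, Hajlasz balls and compact embeddings\<close>

context bounded_domain
begin

lemma sobolev_norm_source:
  assumes \<sigma>: "0 < \<sigma>" and q: "1 \<le> q" and A: "0 \<le> A"
    and u: "u \<in> borel_measurable M" and norm: "sobolev_norm \<Omega> \<sigma> q u \<le> ennreal A"
  shows "lp_bound q A u" "epowr (sobolev_seminorm \<Omega> \<sigma> q u) q \<le> ennreal (A powr q)"
proof -
  have "epowr (epowr (sobolev_seminorm \<Omega> \<sigma> q u) q + epowr (Lp_norm \<Omega> q u) q) (1 / q) \<le> ennreal A"
    using norm \<sigma> by (simp add: sobolev_norm_def)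
  then have sum: "epowr (sobolev_seminorm \<Omega> \<sigma> q u) q + epowr (Lp_norm \<Omega> q u) q \<le> ennreal (A powr q)"
    using q A by (intro epowr_root_le) auto
  have lp: "epowr (Lp_norm \<Omega> q u) q = (\<integral>\<^sup>+x. ennreal (\<bar>u x\<bar> powr q) \<partial>M)"
    using q by (simp add: Lp_norm_def epowr_root)
  have "epowr (Lp_norm \<Omega> q u) q \<le> ennreal (A powr q)"
    using sum by (rule order_trans[rotated]) (simp add: add_increasing)
  with u show "lp_bound q A u" by (simp add: lp lp_bound_def)
  show "epowr (sobolev_seminorm \<Omega> \<sigma> q u) q \<le> ennreal (A powr q)"
    using sum by (rule order_trans[rotated]) (simp add: add_increasing2)
qed

lemma gagliardo_energy_scale:
  assumes [measurable]: "u \<in> borel_measurable M" and b: "0 \<le> b"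
  shows "gagliardo_energy \<Omega> \<tau> r (\<lambda>x. b * u x) = ennreal (b powr r) * gagliardo_energy \<Omega> \<tau> r u"
proof -
  let ?F = "\<lambda>(x, y). ennreal (\<bar>u x - u y\<bar> powr r / norm (x - y) powr (real DIM('a) + \<tau> * r))"
  have "gagliardo_energy \<Omega> \<tau> r (\<lambda>x. b * u x) = (\<integral>\<^sup>+p. ennreal (b powr r) * ?F p \<partial>(M \<Otimes>\<^sub>M M))"
    unfolding gagliardo_energy_def using b
    by (intro nn_integral_cong) (auto simp: abs_mult powr_mult simp flip: right_diff_distrib ennreal_mult)
  also have "\<dots> = ennreal (b powr r) * gagliardo_energy \<Omega> \<tau> r u"
    unfolding gagliardo_energy_def by (rule nn_integral_cmult) measurable
  finally show ?thesis .
qed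

lemma fractional_sobolev_source:
  assumes dens: "measure_density \<Omega> R c" and \<sigma>: "0 < \<sigma>" "\<sigma> < 1" and q: "1 \<le> q"
  obtains C where "0 < C" "\<And>u A. 0 < A \<Longrightarrow> u \<in> sobolev_space \<Omega> \<sigma> q \<Longrightarrow> sobolev_norm \<Omega> \<sigma> q u \<le> ennreal A \<Longrightarrow>
    hajlasz_ball R \<sigma> q (A * C) u"
proof -
  define k where "k = sobolev_const (real DIM('a)) \<sigma> q"
  have "1 \<le> real DIM('a)" using DIM_ge_Suc0[where 'a='a] by linarith
  then have k: "0 < k" using sobolev_const_pos \<sigma> q by (simp add: k_def)
  obtain C where C: "0 \<le> C" "\<And>u. u \<in> borel_measurable M \<Longrightarrow> gagliardo_energy \<Omega> \<sigma> q u \<le> 1 \<Longrightarrow> hajlasz R \<sigma> q C u"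
    using gagliardo_hajlasz[OF dens q \<sigma>(1)] by blast
  \<comment> \<open>Absorbs the constant in front of the energy: k l^q = 1, hence u / (A l) has
    energy at most 1.\<close>
  define l where "l = k powr (- 1 / q)"
  have l: "0 < l" using k by (simp add: l_def)
  have lk: "k * l powr q = 1" unfolding l_def powr_powr using k q by (simp add: powr_minus)
  show ?thesis
  proof (rule that[of "l * C + 1"])
    show "0 < l * C + 1" using l C by (simp add: add_nonneg_pos)
    fix u A assume A: "0 < (A :: real)" and u: "u \<in> sobolev_space \<Omega> \<sigma> q" and norm: "sobolev_norm \<Omega> \<sigma> q u \<le> ennreal A"
    have um [measurable]: "u \<in> borel_measurable M" using u by (simp add: sobolev_space_def)
    have lp: "lp_bound q A u" and semi: "epowr (sobolev_seminorm \<Omega> \<sigma> q u) q \<le> ennreal (A powr q)"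
      using sobolev_norm_source[OF \<sigma>(1) q _ um norm] A by auto
    have "epowr (sobolev_seminorm \<Omega> \<sigma> q u) q = ennreal k * gagliardo_energy \<Omega> \<sigma> q u"
      using \<sigma> q by (simp add: sobolev_seminorm_def epowr_root k_def)
    with semi have kE: "ennreal k * gagliardo_energy \<Omega> \<sigma> q u \<le> ennreal (A powr q)" by simp
    have "(1 / (A * l)) powr q = A powr (- q) * k"
      using A l k lk by (simp add: powr_divide powr_mult powr_minus field_simps)
    then have "gagliardo_energy \<Omega> \<sigma> q (\<lambda>x. 1 / (A * l) * u x) = ennreal (A powr (- q) * k) * gagliardo_energy \<Omega> \<sigma> q u"
      using gagliardo_energy_scale[OF um, of "1 / (A * l)" \<sigma> q] A l by simp
    also have "\<dots> = ennreal (A powr (- q)) * (ennreal k * gagliardo_energy \<Omega> \<sigma> q u)"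
      using k by (simp add: ennreal_mult mult.assoc)
    also have "\<dots> \<le> ennreal (A powr (- q)) * ennreal (A powr q)" using kE by (intro mult_left_mono) auto
    also have "\<dots> = 1" using A by (simp flip: ennreal_mult powr_add)
    finally have "hajlasz R \<sigma> q C (\<lambda>x. 1 / (A * l) * u x)" by (intro C) measurable
    from hajlasz_scale[OF this C(1), of "A * l"] have h: "hajlasz R \<sigma> q (A * l * C) u" using A l by simp
    have "A * 1 \<le> A * (l * C + 1)" "A * l * C \<le> A * (l * C + 1)"
      using A l C by (auto simp: algebra_simps)
    then show "hajlasz_ball R \<sigma> q (A * (l * C + 1)) u"
      using h lp A l C(1) q unfolding hajlasz_ball_def by (auto elim!: hajlasz_mono lp_bound_mono)
  qed
qed

lemma has_weak_gradient_scale: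
  assumes "has_weak_gradient \<Omega> u g"
  shows "has_weak_gradient \<Omega> (\<lambda>x. b * u x) (\<lambda>x. b *\<^sub>R g x)"
  unfolding has_weak_gradient_def
proof (intro conjI allI impI ballI)
  show "locally_integrable \<Omega> (\<lambda>x. b * u x)" "locally_integrable \<Omega> (\<lambda>x. b *\<^sub>R g x)"
    using assms unfolding has_weak_gradient_def locally_integrable_def
    by (auto intro: absolutely_integrable_scaleR_left absolutely_integrable_scaleR_left[where f=u, unfolded real_scaleR_def])
  fix \<phi> :: "'a \<Rightarrow> real" and e :: 'a assume "test_function \<Omega> \<phi>" "e \<in> Basis"
  then have eq: "(LINT x|M. u x * frechet_derivative \<phi> (at x) e) = - (LINT x|M. (g x \<bullet> e) * \<phi> x)"
    using assms by (simp add: has_weak_gradient_def)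
  have "(LINT x|M. b * u x * frechet_derivative \<phi> (at x) e) = b * (LINT x|M. u x * frechet_derivative \<phi> (at x) e)"
    by (simp add: mult.assoc)
  also have "\<dots> = - (LINT x|M. b * ((g x \<bullet> e) * \<phi> x))" using eq by simp
  finally show "(LINT x|M. b * u x * frechet_derivative \<phi> (at x) e) = - (LINT x|M. (b *\<^sub>R g x \<bullet> e) * \<phi> x)"
    by (simp add: mult.assoc)
qed

lemma first_order_sobolev_source:
  assumes cone: "uniform_cone \<Omega> R V" and \<sigma>: "0 < \<sigma>" "\<sigma> < 1" and q: "1 \<le> q"
  obtains C where "0 < C" "\<And>u A. 0 < A \<Longrightarrow> u \<in> sobolev_space \<Omega> 1 q \<Longrightarrow> sobolev_norm \<Omega> 1 q u \<le> ennreal A \<Longrightarrow>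
    hajlasz_ball (R / 2) \<sigma> q (A * C) u"
proof -
  obtain C where C: "0 \<le> C" "\<And>u g. has_weak_gradient \<Omega> u g \<Longrightarrow> lp_bound q 1 u \<Longrightarrow>
    (\<integral>\<^sup>+x. ennreal (norm (g x) powr q) \<partial>M) \<le> 1 \<Longrightarrow> hajlasz (R / 2) \<sigma> q C u"
    using weak_gradient_hajlasz_unit[OF cone q \<sigma>] by blast
  show ?thesis
  proof (rule that[of "C + 1"])
    show "0 < C + 1" using C by simp
    fix u A assume A: "0 < (A :: real)" and u: "u \<in> sobolev_space \<Omega> 1 q" and norm: "sobolev_norm \<Omega> 1 q u \<le> ennreal A"
    have um: "u \<in> borel_measurable M" using u by (simp add: sobolev_space_def)
    have lp: "lp_bound q A u" and semi: "epowr (sobolev_seminorm \<Omega> 1 q u) q \<le> ennreal (A powr q)"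
      using sobolev_norm_source[OF _ q _ um norm] A by auto
    have ex: "\<exists>g. has_weak_gradient \<Omega> u g" using u by (auto simp: sobolev_space_def sobolev_seminorm_def split: if_splits)
    define g where "g = weak_gradient \<Omega> u"
    have wg: "has_weak_gradient \<Omega> u g" unfolding g_def weak_gradient_def using ex by (rule someI_ex)
    then have [measurable]: "g \<in> borel_measurable M" by (auto simp: has_weak_gradient_def intro: locally_integrable_measurable)
    have gq: "(\<integral>\<^sup>+x. ennreal (norm (g x) powr q) \<partial>M) \<le> ennreal (A powr q)"
      using semi ex q by (simp add: sobolev_seminorm_def Lp_norm_def epowr_root g_def)
    have "(\<integral>\<^sup>+x. ennreal (norm ((1 / A) *\<^sub>R g x) powr q) \<partial>M) = (\<integral>\<^sup>+x. ennreal (A powr (- q)) * ennreal (norm (g x) powr q) \<partial>M)"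
      using A by (intro nn_integral_cong) (simp add: powr_divide powr_minus_divide flip: ennreal_mult)
    also have "\<dots> = ennreal (A powr (- q)) * (\<integral>\<^sup>+x. ennreal (norm (g x) powr q) \<partial>M)" by (rule nn_integral_cmult) measurable
    also have "\<dots> \<le> ennreal (A powr (- q)) * ennreal (A powr q)" using gq by (intro mult_left_mono) auto
    also have "\<dots> = 1" using A by (simp flip: ennreal_mult powr_add)
    finally have g1: "(\<integral>\<^sup>+x. ennreal (norm ((1 / A) *\<^sub>R g x) powr q) \<partial>M) \<le> 1" .
    have "lp_bound q 1 (\<lambda>x. 1 / A * u x)" using lp_bound_scale[OF lp, of "1 / A"] A by simp
    then have "hajlasz (R / 2) \<sigma> q C (\<lambda>x. 1 / A * u x)" using C(2)[OF has_weak_gradient_scale[OF wg] _ g1] by blast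
    from hajlasz_scale[OF this C(1), of A] have h: "hajlasz (R / 2) \<sigma> q (A * C) u" using A by simp
    show "hajlasz_ball (R / 2) \<sigma> q (A * (C + 1)) u"
      using h lp A C(1) q unfolding hajlasz_ball_def by (auto elim!: hajlasz_mono lp_bound_mono simp: algebra_simps)
  qed
qed

text \<open>The r-th power of the norm for smoothness below 1. At \<tau> = 0 the coefficient 0
  removes the Gagliardo term, even an infinite one, so both kinds of target are treated at
  once.\<close>

definition sobolev_energy :: "real \<Rightarrow> real \<Rightarrow> ('a \<Rightarrow> real) \<Rightarrow> ennreal" where
  "sobolev_energy \<tau> r u = (if \<tau> = 0 then 0 else ennreal (sobolev_const (real DIM('a)) \<tau> r)) * gagliardo_energy \<Omega> \<tau> r u
     + (\<integral>\<^sup>+x. ennreal (\<bar>u x\<bar> powr r) \<partial>M)"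

lemma sobolev_norm_energy:
  assumes "0 \<le> \<tau>" "\<tau> < 1" "1 \<le> r"
  shows "sobolev_norm \<Omega> \<tau> r u = epowr (sobolev_energy \<tau> r u) (1 / r)"
  using assms by (auto simp: sobolev_norm_def sobolev_energy_def sobolev_seminorm_def Lp_norm_def epowr_root)

lemma sobolev_spaceI:
  assumes "0 \<le> \<tau>" "\<tau> < 1" "1 \<le> r" "u \<in> borel_measurable M"
    and "(\<integral>\<^sup>+x. ennreal (\<bar>u x\<bar> powr r) \<partial>M) < \<infinity>" "gagliardo_energy \<Omega> \<tau> r u < \<infinity>"
  shows "u \<in> sobolev_space \<Omega> \<tau> r"
  using assms by (auto simp: sobolev_space_def sobolev_seminorm_def Lp_norm_def epowr_lt_infinity_iff[unfolded infinity_ennreal_def] ennreal_mult_less_top)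

lemma sobolev_norm_finite:
  assumes "u \<in> sobolev_space \<Omega> \<sigma> q"
  shows "sobolev_norm \<Omega> \<sigma> q u < \<infinity>"
  using assms by (auto simp: sobolev_space_def sobolev_norm_def epowr_lt_infinity_iff[unfolded infinity_ennreal_def])

text \<open>The source space enters only through a pointwise bound of some smoothness \<sigma>. For
  fractional spaces \<sigma> is \<sigma>' itself, for first-order spaces \<sigma>' = 1 and \<sigma>
  is slightly smaller.\<close>

theorem sobolev_compact_embedding:
  assumes dens: "measure_density \<Omega> R c" and C: "0 < C"
    and source: "\<And>u A. 0 < A \<Longrightarrow> u \<in> sobolev_space \<Omega> \<sigma>' q \<Longrightarrow> sobolev_norm \<Omega> \<sigma>' q u \<le> ennreal A \<Longrightarrow>
      hajlasz_ball R \<sigma> q (A * C) u"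
    and q: "1 \<le> q" "1 \<le> r" and \<tau>: "0 \<le> \<tau>" "\<tau> < \<sigma>" "\<tau> < 1"
    and gap: "\<tau> - DIM('a) / r < \<sigma> - DIM('a) / q"
  shows "sobolev_compactly_embedded \<Omega> (\<sigma>', q) (\<tau>, r)"
proof -
  obtain C1 where C1: "0 < C1" "\<And>u A. 0 < A \<Longrightarrow> hajlasz_ball R \<sigma> q A u \<Longrightarrow>
    lp_bound r (A * C1) u \<and> gagliardo_energy \<Omega> \<tau> r u \<le> ennreal ((A * C1) powr r)"
    using hajlasz_bounded_embedding[OF dens q \<tau>(1,2) gap] by blast
  define k where "k = (if \<tau> = 0 then 0 else sobolev_const (real DIM('a)) \<tau> r)"
  have "1 \<le> real DIM('a)" using DIM_ge_Suc0[where 'a='a] by linarith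
  then have k: "0 \<le> k" using sobolev_const_pos[of \<tau> r "real DIM('a)"] \<tau> q by (auto simp: k_def)
  have energy: "sobolev_energy \<tau> r u = ennreal k * gagliardo_energy \<Omega> \<tau> r u + (\<integral>\<^sup>+x. ennreal (\<bar>u x\<bar> powr r) \<partial>M)" for u
    by (simp add: sobolev_energy_def k_def)
  define C2 where "C2 = C * C1 * (k + 1) powr (1 / r)"
  have C2: "0 < C2" using C C1 k by (simp add: C2_def)
  have target: "u \<in> sobolev_space \<Omega> \<tau> r \<and> sobolev_norm \<Omega> \<tau> r u \<le> ennreal (A * C2)"
    if A: "0 < A" and u: "u \<in> sobolev_space \<Omega> \<sigma>' q" "sobolev_norm \<Omega> \<sigma>' q u \<le> ennreal A" for u A
  proof -
    define B where "B = A * C * C1"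
    have B: "0 \<le> B" using A C C1 by (simp add: B_def)
    have lp: "lp_bound r B u" and E: "gagliardo_energy \<Omega> \<tau> r u \<le> ennreal (B powr r)"
      using C1(2)[OF _ source[OF A u]] A C by (auto simp: B_def)
    have I: "(\<integral>\<^sup>+x. ennreal (\<bar>u x\<bar> powr r) \<partial>M) \<le> ennreal (B powr r)" and um: "u \<in> borel_measurable M"
      using lp by (auto simp: lp_bound_def)
    have mem: "u \<in> sobolev_space \<Omega> \<tau> r"
      using \<tau> q um I E by (intro sobolev_spaceI) (auto simp: le_less_trans)
    have "sobolev_energy \<tau> r u \<le> ennreal k * ennreal (B powr r) + ennreal (B powr r)"
      unfolding energy using E I by (intro add_mono mult_left_mono) auto
    also have "\<dots> = ennreal ((A * C2) powr r)"
      using k q by (simp add: C2_def B_def powr_mult powr_powr algebra_simps flip: ennreal_mult ennreal_plus)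
    finally show ?thesis
      using mem A C2 \<tau> q by (auto simp: sobolev_norm_energy intro!: epowr_root_leI)
  qed
  have finite_norm: "\<exists>a\<ge>0. sobolev_norm \<Omega> \<sigma>' q u = ennreal a" if "u \<in> sobolev_space \<Omega> \<sigma>' q" for u
    using sobolev_norm_finite[OF that] by (cases "sobolev_norm \<Omega> \<sigma>' q u") auto
  have sub: "sobolev_space \<Omega> \<sigma>' q \<subseteq> sobolev_space \<Omega> \<tau> r"
  proof
    fix u assume u: "u \<in> sobolev_space \<Omega> \<sigma>' q"
    then obtain a where "0 \<le> a" "sobolev_norm \<Omega> \<sigma>' q u = ennreal a" using finite_norm by blast
    then show "u \<in> sobolev_space \<Omega> \<tau> r" using target[of "a + 1" u] u by (simp add: ennreal_leI)
  qed
  have bounded: "sobolev_norm \<Omega> \<tau> r u \<le> ennreal C2 * sobolev_norm \<Omega> \<sigma>' q u" if u: "u \<in> sobolev_space \<Omega> \<sigma>' q" for u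
  proof -
    obtain a where a: "0 \<le> a" "sobolev_norm \<Omega> \<sigma>' q u = ennreal a" using finite_norm[OF u] by blast
    show ?thesis
    \<comment> \<open>\<open>target\<close> asks for a positive bound, but the norm of u may be 0;
      hence the arbitrary surplus e.\<close>
    proof (rule ennreal_le_epsilon)
      fix e :: real assume e: "0 < e"
      have "sobolev_norm \<Omega> \<tau> r u \<le> ennreal ((a + e / C2) * C2)"
        using target[of "a + e / C2" u] u a e C2 by (simp add: ennreal_leI add_nonneg_pos)
      also have "\<dots> = ennreal C2 * sobolev_norm \<Omega> \<sigma>' q u + ennreal e"
        using a e C2 by (simp add: field_simps flip: ennreal_mult ennreal_plus)
      finally show "sobolev_norm \<Omega> \<tau> r u \<le> ennreal C2 * sobolev_norm \<Omega> \<sigma>' q u + ennreal e" .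
    qed
  qed
  have compact: "\<exists>v\<in>sobolev_space \<Omega> \<tau> r. \<exists>\<rho> :: nat \<Rightarrow> nat. strict_mono \<rho> \<and>
      (\<lambda>n. sobolev_norm \<Omega> \<tau> r (\<lambda>x. u (\<rho> n) x - v x)) \<longlonglongrightarrow> 0"
    if u: "\<And>n. u n \<in> sobolev_space \<Omega> \<sigma>' q" "\<And>n. sobolev_norm \<Omega> \<sigma>' q (u n) \<le> ennreal B" for u :: "nat \<Rightarrow> 'a \<Rightarrow> real" and B
  proof -
    \<comment> \<open>The given bound B may fail to be positive.\<close>
    define A where "A = max B 1"
    have A: "0 < A" by (simp add: A_def)
    have "sobolev_norm \<Omega> \<sigma>' q (u n) \<le> ennreal A" for n
      using u(2)[of n] by (rule order_trans) (auto simp: A_def intro: ennreal_leI)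
    then have h: "hajlasz_ball R \<sigma> q (A * C) (u n)" for n using u(1) by (intro source A) auto
    have AC: "0 < A * C" using A C by simp
    obtain \<rho> v where \<rho>: "strict_mono (\<rho> :: nat \<Rightarrow> nat)" and v: "v \<in> borel_measurable M"
      "(\<integral>\<^sup>+x. ennreal (\<bar>v x\<bar> powr r) \<partial>M) < \<infinity>" "gagliardo_energy \<Omega> \<tau> r v < \<infinity>"
      and lim: "(\<lambda>n. \<integral>\<^sup>+x. ennreal (\<bar>u (\<rho> n) x - v x\<bar> powr r) \<partial>M) \<longlonglongrightarrow> 0"
      "(\<lambda>n. gagliardo_energy \<Omega> \<tau> r (\<lambda>x. u (\<rho> n) x - v x)) \<longlonglongrightarrow> 0"
      by (rule hajlasz_compact_embedding[OF dens q \<tau>(1,2) gap AC h])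
    have "(\<lambda>n. sobolev_energy \<tau> r (\<lambda>x. u (\<rho> n) x - v x)) \<longlonglongrightarrow> ennreal k * 0 + 0"
      unfolding energy by (intro tendsto_add ennreal_tendsto_cmult lim) simp
    then have "(\<lambda>n. sobolev_energy \<tau> r (\<lambda>x. u (\<rho> n) x - v x)) \<longlonglongrightarrow> 0" by simp
    then have "(\<lambda>n. sobolev_norm \<Omega> \<tau> r (\<lambda>x. u (\<rho> n) x - v x)) \<longlonglongrightarrow> 0"
      using \<tau> q by (simp add: sobolev_norm_energy epowr_root_tendsto_0)
    moreover have "v \<in> sobolev_space \<Omega> \<tau> r" using \<tau> q v by (intro sobolev_spaceI) auto
    ultimately show ?thesis using \<rho> by blast
  qed
  show ?thesis
    unfolding sobolev_compactly_embedded_def prod.case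
    using sub bounded compact by blast
qed

lemma fractional_sobolev_compact_embedding:
  assumes "uniform_cone \<Omega> R V" "0 < \<sigma>" "\<sigma> < 1" "1 \<le> q" "1 \<le> r" "0 \<le> \<tau>" "\<tau> < \<sigma>"
    and "\<tau> - DIM('a) / r < \<sigma> - DIM('a) / q"
  shows "sobolev_compactly_embedded \<Omega> (\<sigma>, q) (\<tau>, r)"
proof -
  obtain c where dens: "measure_density \<Omega> R c" using uniform_cone_measure_density[OF open_domain assms(1)] by blast
  obtain C where C: "0 < C" "\<And>u A. 0 < A \<Longrightarrow> u \<in> sobolev_space \<Omega> \<sigma> q \<Longrightarrow> sobolev_norm \<Omega> \<sigma> q u \<le> ennreal A \<Longrightarrow>
    hajlasz_ball R \<sigma> q (A * C) u"
    using fractional_sobolev_source[OF dens assms(2-4)] by blast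
  show ?thesis by (rule sobolev_compact_embedding[OF dens C]) (use assms in auto)
qed

lemma first_order_sobolev_compact_embedding:
  assumes cone: "uniform_cone \<Omega> R V" and "1 \<le> q" "1 \<le> r" "0 \<le> \<tau>" "\<tau> < 1"
    and gap: "\<tau> - DIM('a) / r < 1 - DIM('a) / q"
  shows "sobolev_compactly_embedded \<Omega> (1, q) (\<tau>, r)"
proof -
  obtain c where dens: "measure_density \<Omega> R c" using uniform_cone_measure_density[OF open_domain cone] by blast
  then have dens': "measure_density \<Omega> (R / 2) c"
    by (rule measure_density_mono) (use dens in \<open>auto simp: measure_density_def\<close>)
  \<comment> \<open>The strict gap leaves room for a smoothness below 1 that still satisfies
    it.\<close>
  obtain \<sigma> where \<sigma>: "max \<tau> (\<tau> - DIM('a) / r + DIM('a) / q) < \<sigma>" "\<sigma> < 1"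
    using dense[of "max \<tau> (\<tau> - DIM('a) / r + DIM('a) / q)" 1] assms by auto
  then have \<sigma>0: "0 < \<sigma>" using assms by simp
  obtain C where C: "0 < C" "\<And>u A. 0 < A \<Longrightarrow> u \<in> sobolev_space \<Omega> 1 q \<Longrightarrow> sobolev_norm \<Omega> 1 q u \<le> ennreal A \<Longrightarrow>
    hajlasz_ball (R / 2) \<sigma> q (A * C) u"
    using first_order_sobolev_source[OF cone \<sigma>0 \<sigma>(2) assms(2)] by blast
  show ?thesis by (rule sobolev_compact_embedding[OF dens' C]) (use assms \<sigma> in auto)
qed

end

section \<open>Embeddings along the exponent curve\<close>

theorem theorem1p8:
  fixes \<Omega> :: "(real ^ 'n) set" and s p s' p' :: real
  assumes "0 < s" and "s \<le> 1" and "1 \<le> p"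
    and "s * p = real CARD('n)" and "s \<noteq> p"
    and "open \<Omega>" and "connected \<Omega>" and "\<Omega> \<noteq> {}" and "bounded \<Omega>" and "lipschitz_boundary \<Omega>"
    and "(0 < s' \<and> s' < s \<and> 1 \<le> p' \<and> p' < real CARD('n) / s') \<or> (s' = 0 \<and> 1 \<le> p')"
  shows "sobolev_compactly_embedded \<Omega> (s, p) (s', p') \<and>
    (\<forall>\<theta>\<^sub>1 \<theta>\<^sub>2. 0 < \<theta>\<^sub>1 \<and> \<theta>\<^sub>1 < \<theta>\<^sub>2 \<and> \<theta>\<^sub>2 \<le> 1 \<longrightarrow>
       sobolev_compactly_embedded \<Omega> (exponent_curve s p s' p' \<theta>\<^sub>1) (exponent_curve s p s' p' \<theta>\<^sub>2))"
proof -
  let ?N = "real CARD('n)"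
  have N: "1 \<le> ?N" by (simp add: Suc_leI)
  have s: "0 < s" "s \<le> 1" and p: "1 \<le> p" and sp: "s * p = ?N" using assms by auto
  have s': "0 \<le> s'" "s' < s" and p': "1 \<le> p'" using assms by auto
  have crit: "s - ?N / p = 0" using p sp by (simp add: field_simps)
  \<comment> \<open>The target is subcritical in both alternatives; for s' = 0 this is N / p' >
    0.\<close>
  have sub: "s' - ?N / p' < 0"
    using assms(11) N by (auto simp: field_simps)
  interpret bounded_domain \<Omega> using assms by unfold_locales auto
  obtain R V where cone: "uniform_cone \<Omega> R V"
    using lipschitz_boundary_uniform_cone[of \<Omega>] assms by blast
  have "sobolev_compactly_embedded \<Omega> (s, p) (s', p')"
  proof (cases "s = 1")
    case True
    then show ?thesis
      using first_order_sobolev_compact_embedding[OF cone p p' s'(1)] s' sub crit by simp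
  next
    case False
    then show ?thesis
      using fractional_sobolev_compact_embedding[OF cone s(1) _ p p' s'] s sub crit by simp
  qed
  moreover have "sobolev_compactly_embedded \<Omega> (exponent_curve s p s' p' \<theta>\<^sub>1) (exponent_curve s p s' p' \<theta>\<^sub>2)"
    if \<theta>: "0 < \<theta>\<^sub>1" "\<theta>\<^sub>1 < \<theta>\<^sub>2" "\<theta>\<^sub>2 \<le> 1" for \<theta>\<^sub>1 \<theta>\<^sub>2
  proof -
    define S where "S \<theta> = \<theta> * s' + (1 - \<theta>) * s" for \<theta>
    \<comment> \<open>D runs affinely from p' to p, so 1 / P runs affinely from 1 / p to 1 /
      p'.\<close>
    define D where "D \<theta> = p' + \<theta> * (p - p')" for \<theta>
    define P where "P \<theta> = p * p' / D \<theta>" for \<theta>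
    have curve: "exponent_curve s p s' p' \<theta> = (S \<theta>, P \<theta>)" for \<theta>
      by (simp add: exponent_curve_def S_def P_def D_def)
    have D: "0 < D \<theta> \<and> D \<theta> \<le> p * p'" if "0 \<le> \<theta>" "\<theta> \<le> 1" for \<theta>
    proof -
      have D_eq: "D \<theta> = (1 - \<theta>) * p' + \<theta> * p" by (simp add: D_def algebra_simps)
      have pp: "p' \<le> p * p'" "p \<le> p * p'" using p p' by auto
      have "(1 - \<theta>) * p' + \<theta> * p \<le> (1 - \<theta>) * (p * p') + \<theta> * (p * p')"
        using pp that by (intro add_mono mult_left_mono) auto
      also have "\<dots> = p * p'" by (simp add: algebra_simps)
      finally have "D \<theta> \<le> p * p'" by (simp add: D_eq)
      moreover have "(1 - \<theta>) * 1 + \<theta> * 1 \<le> D \<theta>"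
        unfolding D_eq using that p p' by (intro add_mono mult_left_mono) auto
      ultimately show ?thesis by simp
    qed
    have P1: "1 \<le> P \<theta>" if "0 \<le> \<theta>" "\<theta> \<le> 1" for \<theta>
      using D[OF that] by (simp add: P_def)
    \<comment> \<open>Smoothness and reciprocal exponent are affine in \<theta>, hence so is the
      defect; its value at \<theta> = 0 vanishes since s p = N.\<close>
    have defect: "S \<theta> - ?N / P \<theta> = \<theta> * (s' - ?N / p')" if "0 \<le> \<theta>" "\<theta> \<le> 1" for \<theta>
    proof -
      have "?N / P \<theta> = ?N * D \<theta> / (p * p')" by (simp add: P_def)
      also have "\<dots> = (1 - \<theta>) * (?N / p) + \<theta> * (?N / p')"
        using p p' by (simp add: D_def field_simps)
      also have "?N / p = s" using crit by simp
      finally show ?thesis by (simp add: S_def algebra_simps)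
    qed
    have \<theta>1: "0 \<le> \<theta>\<^sub>1" "\<theta>\<^sub>1 < 1" and \<theta>2: "0 \<le> \<theta>\<^sub>2" "\<theta>\<^sub>2 \<le> 1" using \<theta> by auto
    have S_eq: "S \<theta> = s - \<theta> * (s - s')" for \<theta> by (simp add: S_def algebra_simps)
    have "\<theta>\<^sub>1 * (s - s') < \<theta>\<^sub>2 * (s - s')" using \<theta> s' by simp
    then have S12: "S \<theta>\<^sub>2 < S \<theta>\<^sub>1" by (simp add: S_eq)
    \<comment> \<open>Since \<open>\<theta>\<^sub>1\<close> is positive, the source smoothness is
      strictly below 1 even for s = 1, and the fractional embedding applies.\<close>
    have "0 < \<theta>\<^sub>1 * (s - s')" using \<theta> s' by simp
    then have S1: "S \<theta>\<^sub>1 < 1" using s by (simp add: S_eq)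
    have S2: "0 \<le> S \<theta>\<^sub>2" unfolding S_def using \<theta>2 s s' by (intro add_nonneg_nonneg mult_nonneg_nonneg) auto
    have "\<theta>\<^sub>2 * (s' - ?N / p') < \<theta>\<^sub>1 * (s' - ?N / p')"
      using \<theta> sub by (intro mult_strict_right_mono_neg)
    then have gap: "S \<theta>\<^sub>2 - ?N / P \<theta>\<^sub>2 < S \<theta>\<^sub>1 - ?N / P \<theta>\<^sub>1"
      using defect[of "\<theta>\<^sub>1"] defect[of "\<theta>\<^sub>2"] \<theta>1 \<theta>2 by simp
    show ?thesis
      unfolding curve using \<theta>1 \<theta>2 gap S1 S2 S12
      by (intro fractional_sobolev_compact_embedding[OF cone] P1) auto
  qed
  ultimately show ?thesis by blast
qed

end
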